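(* Let $\mathcal X,\mathcal U,\mathcal Y$ be (possibly infinite-dimensional) complex Hilbert spaces and let $A\in\mathcal L(\mathcal X)$, $B\in\mathcal L(\mathcal U,\mathcal X)$, $C\in\mathcal L(\mathcal X,\mathcal Y)$, $D\in\mathcal L(\mathcal U,\mathcal Y)$ be such that the associated linear system has a dichotomy, i.e. $\sigma(A)\cap\mathbb T=\emptyset$, where $\mathbb T$ is the unit circle. Then the following are equivalent: (1) $\|F_\Sigma\|_{\infty,\mathbb T}:=\sup_{z\in\mathbb T}\|F_\Sigma(z)\|<1$, where $F_\Sigma(z)=D+zC(I-zA)^{-1}B$. (2) There is a bounded and boundedly invertible selfadjoint operator $H$ on $\mathcal X$ which satisfies the strict KYP-inequality $$\begin{bmatrix}A&B\\C&D\end{bmatrix}^*\begin{bmatrix}H&0\\0&I_{\mathcal Y}\end{bmatrix}\begin{bmatrix}A&B\\C&D\end{bmatrix}\prec\begin{bmatrix}H&0\\0&I_{\mathcal U}\end{bmatrix}.$$ Moreover, the inertia of $A$ partitioned by the unit circle lines up with the inertia of $H$ partitioned by the point $0$ on the real line: the dimension of the spectral subspace of $A$ over the unit disk (respectively, exterior of the closed unit disk) agrees with the dimension of the spectral subspace of $H$ over the positive real line (respectively, over the negative real line).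
   Context: For bounded selfadjoint operators, $X\prec Y$ means that $Y-X$ is strictly positive-definite, i.e. there is $\delta>0$ with $\langle(Y-X)v,v\rangle\ge\delta\|v\|^2$ for all $v$. The linear system is $\mathbf x(n+1)=A\mathbf x(n)+B\mathbf u(n)$, $\mathbf y(n)=C\mathbf x(n)+D\mathbf u(n)$ ($n\in\mathbb Z$). Spectral subspaces of $A$ are ranges of Riesz projections; spectral subspaces of the selfadjoint operator $H$ are ranges of its spectral projections. *)

theory Defs
  imports "HOL-Complex_Analysis.Complex_Analysis"
begin

unbundle cardinal_syntax

text \<open>
  Complex Hilbert spaces. The inner product is linear in its first argument; the last axiom makes
  it positive definite and makes the (complete) norm the one it induces.
\<close>

class complex_hilbert = banach +
  fixes scaleC :: "complex \<Rightarrow> 'a \<Rightarrow> 'a"  (infixr \<open>*\<^sub>C\<close> 75)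
    and cinner :: "'a \<Rightarrow> 'a \<Rightarrow> complex"
  assumes scaleR_scaleC: "r *\<^sub>R x = complex_of_real r *\<^sub>C x"
    and scaleC_add_right: "a *\<^sub>C (x + y) = a *\<^sub>C x + a *\<^sub>C y"
    and scaleC_add_left: "(a + b) *\<^sub>C x = a *\<^sub>C x + b *\<^sub>C x"
    and scaleC_scaleC: "a *\<^sub>C (b *\<^sub>C x) = (a * b) *\<^sub>C x"
    and scaleC_one: "1 *\<^sub>C x = x"
    and cinner_commute: "cinner x y = cnj (cinner y x)"
    and cinner_add_left: "cinner (x + y) z = cinner x z + cinner y z"
    and cinner_scaleC_left: "cinner (a *\<^sub>C x) y = a * cinner x y"
    and cinner_self: "cinner x x = complex_of_real ((norm x)\<^sup>2)"

global_interpretation complex_vector: vector_space "scaleC :: complex \<Rightarrow> 'a \<Rightarrow> 'a::complex_hilbert"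
  defines cspan = complex_vector.span
  by standard (simp_all add: scaleC_add_right scaleC_add_left scaleC_scaleC scaleC_one)

instantiation complex :: complex_hilbert
begin

definition scaleC_complex :: "complex \<Rightarrow> complex \<Rightarrow> complex" where
  "scaleC_complex a x = a * x"

definition cinner_complex :: "complex \<Rightarrow> complex \<Rightarrow> complex" where
  "cinner_complex x y = x * cnj y"

instance
proof
  fix x y :: complex
  show "cinner x y = cnj (cinner y x)"
    by (simp add: cinner_complex_def)
  show "cinner x x = complex_of_real ((norm x)\<^sup>2)"
    by (simp only: cinner_complex_def complex_norm_square)
qed (simp_all add: scaleC_complex_def cinner_complex_def scaleR_conv_of_real distrib_left
      distrib_right mult.assoc)

end

text \<open>The Hilbert space direct sum; the library norm on products is already the Hilbert one.\<close>

instantiation prod :: (complex_hilbert, complex_hilbert) complex_hilbert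
begin

definition scaleC_prod :: "complex \<Rightarrow> 'a \<times> 'b \<Rightarrow> 'a \<times> 'b" where
  "scaleC_prod a x = (a *\<^sub>C fst x, a *\<^sub>C snd x)"

definition cinner_prod :: "'a \<times> 'b \<Rightarrow> 'a \<times> 'b \<Rightarrow> complex" where
  "cinner_prod x y = cinner (fst x) (fst y) + cinner (snd x) (snd y)"

instance
proof
  fix x y :: "'a \<times> 'b"
  show "cinner x y = cnj (cinner y x)"
    using cinner_commute[of "fst x" "fst y"] cinner_commute[of "snd x" "snd y"]
    by (simp add: cinner_prod_def)
  show "cinner x x = complex_of_real ((norm x)\<^sup>2)"
    by (simp add: cinner_prod_def cinner_self norm_prod_def)
qed (simp_all add: scaleC_prod_def cinner_prod_def prod_eq_iff scaleR_scaleC scaleC_add_right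
      scaleC_add_left scaleC_scaleC scaleC_one cinner_add_left cinner_scaleC_left distrib_left)

end


subsection \<open>Bounded operators\<close>

definition bounded_clinear :: "('a::complex_hilbert \<Rightarrow> 'b::complex_hilbert) \<Rightarrow> bool" where
  "bounded_clinear T \<longleftrightarrow> bounded_linear T \<and> (\<forall>c x. T (c *\<^sub>C x) = c *\<^sub>C T x)"

definition boundedly_invertible :: "('a::complex_hilbert \<Rightarrow> 'b::complex_hilbert) \<Rightarrow> bool" where
  "boundedly_invertible T \<longleftrightarrow> (\<exists>S. bounded_clinear S \<and> S \<circ> T = id \<and> T \<circ> S = id)"

definition cadjoint :: "('a::complex_hilbert \<Rightarrow> 'b::complex_hilbert) \<Rightarrow> 'b \<Rightarrow> 'a" where
  "cadjoint T = (THE S. \<forall>x y. cinner (T x) y = cinner x (S y))"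

definition selfadjoint :: "('a::complex_hilbert \<Rightarrow> 'a) \<Rightarrow> bool" where
  "selfadjoint T \<longleftrightarrow> bounded_clinear T \<and> cadjoint T = T"

text \<open>
  The strict order on bounded selfadjoint operators; the quadratic form is then real-valued, so
  taking the real part only serves to compare it with a real number.
\<close>

definition strictly_below :: "('a::complex_hilbert \<Rightarrow> 'a) \<Rightarrow> ('a \<Rightarrow> 'a) \<Rightarrow> bool"
    (infix \<open>\<prec>\<close> 50) where
  "X \<prec> Y \<longleftrightarrow> (\<exists>\<delta>>0. \<forall>v. Re (cinner (Y v - X v) v) \<ge> \<delta> * (norm v)\<^sup>2)"

definition block_op ::
  "('a::complex_hilbert \<Rightarrow> 'c::complex_hilbert) \<Rightarrow> ('b::complex_hilbert \<Rightarrow> 'c) \<Rightarrow>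
   ('a \<Rightarrow> 'd::complex_hilbert) \<Rightarrow> ('b \<Rightarrow> 'd) \<Rightarrow> 'a \<times> 'b \<Rightarrow> 'c \<times> 'd" where
  "block_op P Q R S = (\<lambda>(x, u). (P x + Q u, R x + S u))"

definition diag_op ::
  "('a::complex_hilbert \<Rightarrow> 'c::complex_hilbert) \<Rightarrow> ('b::complex_hilbert \<Rightarrow> 'd::complex_hilbert) \<Rightarrow>
   'a \<times> 'b \<Rightarrow> 'c \<times> 'd" where
  "diag_op P S = block_op P (\<lambda>_. 0) (\<lambda>_. 0) S"


subsection \<open>Spectrum and Riesz projections\<close>

definition spectrum :: "('a::complex_hilbert \<Rightarrow> 'a) \<Rightarrow> complex set" where
  "spectrum A = {z. \<not> boundedly_invertible (\<lambda>x. z *\<^sub>C x - A x)}"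

definition resolvent :: "('a::complex_hilbert \<Rightarrow> 'a) \<Rightarrow> complex \<Rightarrow> 'a \<Rightarrow> 'a" where
  "resolvent A z = inv (\<lambda>x. z *\<^sub>C x - A x)"

text \<open>
  The operator \<open>1/(2\<pi>i) \<integral>\<^sub>\<gamma> (zI - A)\<^sup>-\<^sup>1 dz\<close>, with the integral taken vector by vector.
\<close>

definition riesz_integral :: "('a::complex_hilbert \<Rightarrow> 'a) \<Rightarrow> (real \<Rightarrow> complex) \<Rightarrow> 'a \<Rightarrow> 'a" where
  "riesz_integral A \<gamma> x =
     (1 / (2 * complex_of_real pi * \<i>)) *\<^sub>C
       integral {0..1} (\<lambda>t. vector_derivative \<gamma> (at t within {0..1}) *\<^sub>C resolvent A (\<gamma> t) x)"

definition riesz_projection_disk :: "('a::complex_hilbert \<Rightarrow> 'a) \<Rightarrow> 'a \<Rightarrow> 'a" where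
  "riesz_projection_disk A = riesz_integral A (circlepath 0 1)"

text \<open>
  The spectrum lies in the closed disk of radius \<open>onorm A\<close>. Hence the outer circle below and the
  negatively oriented unit circle together wind once around every point of the spectrum outside
  the closed unit disk and zero times around every point of it inside the unit disk.
\<close>

definition riesz_projection_exterior :: "('a::complex_hilbert \<Rightarrow> 'a) \<Rightarrow> 'a \<Rightarrow> 'a" where
  "riesz_projection_exterior A x =
     riesz_integral A (circlepath 0 (2 + onorm A)) x - riesz_integral A (circlepath 0 1) x"


subsection \<open>Spectral projections of selfadjoint operators\<close>

definition orthogonal_projection :: "('a::complex_hilbert \<Rightarrow> 'a) \<Rightarrow> bool" where
  "orthogonal_projection P \<longleftrightarrow> selfadjoint P \<and> P \<circ> P = P"

definition projection_valued_measure :: "(real set \<Rightarrow> 'a::complex_hilbert \<Rightarrow> 'a) \<Rightarrow> bool" where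
  "projection_valued_measure E \<longleftrightarrow>
     (\<forall>S\<in>sets borel. orthogonal_projection (E S)) \<and> E UNIV = id \<and>
     (\<forall>S x. range S \<subseteq> sets borel \<longrightarrow> disjoint_family S \<longrightarrow>
        (\<lambda>n::nat. E (S n) x) sums E (\<Union>n. S n) x)"

text \<open>The scalar measure \<open>S \<mapsto> \<langle>E(S)x, x\<rangle> = \<parallel>E(S)x\<parallel>\<^sup>2\<close>.\<close>

definition scalar_measure :: "(real set \<Rightarrow> 'a::complex_hilbert \<Rightarrow> 'a) \<Rightarrow> 'a \<Rightarrow> real measure" where
  "scalar_measure E x = measure_of UNIV (sets borel) (\<lambda>S. ennreal ((norm (E S x))\<^sup>2))"

text \<open>
  \<open>H = \<integral> t dE(t)\<close>, expressed through quadratic forms, which determine the operator by polarization.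
\<close>

definition spectral_measure_of ::
  "('a::complex_hilbert \<Rightarrow> 'a) \<Rightarrow> (real set \<Rightarrow> 'a \<Rightarrow> 'a) \<Rightarrow> bool" where
  "spectral_measure_of H E \<longleftrightarrow> projection_valued_measure E \<and>
     (\<forall>x. integrable (scalar_measure E x) (\<lambda>t. t) \<and>
          cinner (H x) x = complex_of_real (\<integral>t. t \<partial>scalar_measure E x))"

text \<open>
  For bounded selfadjoint \<open>H\<close> and Borel \<open>S\<close> the description is proper, by the spectral theorem.
\<close>

definition spectral_projection :: "('a::complex_hilbert \<Rightarrow> 'a) \<Rightarrow> real set \<Rightarrow> 'a \<Rightarrow> 'a" where
  "spectral_projection H S = (THE P. \<exists>E. spectral_measure_of H E \<and> P = E S)"


subsection \<open>Hilbert space dimension of a closed subspace\<close>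

definition orthonormal_basis_of :: "'a::complex_hilbert set \<Rightarrow> 'a set \<Rightarrow> bool" where
  "orthonormal_basis_of V B \<longleftrightarrow>
     (\<forall>b\<in>B. \<forall>c\<in>B. cinner b c = (if b = c then 1 else 0)) \<and> closure (cspan B) = V"

text \<open>A cardinal, so that infinite dimensions are told apart; to be compared with \<open>=o\<close>.\<close>

definition hilbert_dim :: "'a::complex_hilbert set \<Rightarrow> 'a rel" where
  "hilbert_dim V = |SOME B. orthonormal_basis_of V B|"


subsection \<open>Linear systems\<close>

definition transfer_function ::
  "('x::complex_hilbert \<Rightarrow> 'x) \<Rightarrow> ('u::complex_hilbert \<Rightarrow> 'x) \<Rightarrow> ('x \<Rightarrow> 'y::complex_hilbert) \<Rightarrow>
   ('u \<Rightarrow> 'y) \<Rightarrow> complex \<Rightarrow> 'u \<Rightarrow> 'y" where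
  "transfer_function A B C D z = (\<lambda>u. D u + z *\<^sub>C C (inv (\<lambda>x. x - z *\<^sub>C A x) (B u)))"

definition has_dichotomy :: "('x::complex_hilbert \<Rightarrow> 'x) \<Rightarrow> bool" where
  "has_dichotomy A \<longleftrightarrow> spectrum A \<inter> sphere 0 1 = {}"

definition strict_KYP ::
  "('x::complex_hilbert \<Rightarrow> 'x) \<Rightarrow> ('u::complex_hilbert \<Rightarrow> 'x) \<Rightarrow> ('x \<Rightarrow> 'y::complex_hilbert) \<Rightarrow>
   ('u \<Rightarrow> 'y) \<Rightarrow> ('x \<Rightarrow> 'x) \<Rightarrow> bool" where
  "strict_KYP A B C D H \<longleftrightarrow>
     cadjoint (block_op A B C D) \<circ> diag_op H (id :: 'y \<Rightarrow> 'y) \<circ> block_op A B C D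
       \<prec> diag_op H (id :: 'u \<Rightarrow> 'u)"

end

theory Submission
  imports Defs "HOL-Probability.Probability"
begin

text \<open>
  Everything about the Riesz projection \<open>P\<close> of \<open>A\<close> over the unit disk follows from the fact that its
  Riemann sums over the \<open>N\<close>-th roots of unity equal \<open>(1 - A ^ N)\<^sup>-\<^sup>1\<close>. Iterating the strict Stein inequality
  contained in the KYP inequality along these vectors shows that \<open>H\<close> is positive definite on the range of
  \<open>P\<close> and negative definite on its kernel; hence \<open>H\<close> is invertible, and the spectral projections of
  \<open>H\<close> and the Riesz projections of \<open>A\<close> are injective on each other's ranges, which gives equal dimensions.

  The KYP inequality on the vectors \<open>x\<close> with \<open>z (A x + B u) = x\<close>, \<open>|z| = 1\<close>, loses its \<open>H\<close>-terms and becomes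
  the norm bound on the transfer function. Conversely the norm bound, with some slack and with a
  disturbance added to the state equation, gives a dissipation inequality on cyclic state sequences by
  the discrete Parseval identity, and the available storage of this relaxed problem is a bounded
  quadratic form, whose operator is \<open>H\<close>.

  The spectral theorem is obtained from the Hausdorff moment problem: the Bernstein polynomials of \<open>H\<close>
  are positive operators, so Helly's selection theorem yields the scalar spectral measures.
\<close>

subsection \<open>Complex Hilbert spaces\<close>

text \<open>Under a mere dichotomy \<open>H\<close> is indefinite and trajectories need not decay,
  so limits along single trajectories say nothing. Their place is taken by vectors \<open>v\<close>
  that \<open>N\<close> steps of \<open>A\<close> lead to \<open>v - x\<close>: the Stein inequality
  compares \<open>H\<close> at both ends, and \<open>v\<close> tends to \<open>P x\<close>. No
  controllability is assumed either. With the exact state equation a state need not be steerable to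
  0, and the available storage might fail to be finite. The added disturbance makes every transition
  possible at the price of a multiple \<open>L\<close> of its squared norm, and this price is zero
  on true trajectories. The slack \<open>\<epsilon>\<close> in the same inequality produces the
  strictness. The spectral projections of \<open>H\<close> are given by a definite description, so
  existence and uniqueness must both be settled. Uniqueness is shown for half-lines, where the sign
  of the quadratic form decides. Dimensions are cardinals and are compared through injective bounded
  maps in both directions; the two spectral subspaces are never identified.\<close>

lemma scaleC_zero_left [simp]: "0 *\<^sub>C (x::'a::complex_hilbert) = 0"
  by (rule complex_vector.scale_zero_left)

lemma scaleC_zero_right [simp]: "a *\<^sub>C (0::'a::complex_hilbert) = 0"
  by (rule complex_vector.scale_zero_right)

lemma scaleC_minus_left: "(- a) *\<^sub>C x = - (a *\<^sub>C (x::'a::complex_hilbert))"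
  by (rule complex_vector.scale_minus_left)

lemma scaleC_diff_right: "a *\<^sub>C (x - y) = a *\<^sub>C x - a *\<^sub>C (y::'a::complex_hilbert)"
  by (rule complex_vector.scale_right_diff_distrib)

lemma scaleC_diff_left: "(a - b) *\<^sub>C x = a *\<^sub>C x - b *\<^sub>C (x::'a::complex_hilbert)"
  by (rule complex_vector.scale_left_diff_distrib)

lemma scaleC_sum_right: "a *\<^sub>C (\<Sum>i\<in>I. f i) = (\<Sum>i\<in>I. a *\<^sub>C (f i::'a::complex_hilbert))"
  by (rule complex_vector.scale_sum_right)

lemma scaleC_sum_left: "(\<Sum>i\<in>I. f i) *\<^sub>C x = (\<Sum>i\<in>I. f i *\<^sub>C (x::'a::complex_hilbert))"
  by (rule complex_vector.scale_sum_left)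

lemma cinner_add_right: "cinner x (y + z) = cinner x y + cinner x (z::'a::complex_hilbert)"
  by (metis cinner_commute cinner_add_left complex_cnj_add)

lemma cinner_scaleC_right: "cinner x (a *\<^sub>C y) = cnj a * cinner x (y::'a::complex_hilbert)"
  by (metis cinner_commute cinner_scaleC_left complex_cnj_mult)

lemma cinner_zero_left [simp]: "cinner 0 (x::'a::complex_hilbert) = 0"
  using cinner_scaleC_left[of 0 0 x] by simp

lemma cinner_zero_right [simp]: "cinner (x::'a::complex_hilbert) 0 = 0"
  using cinner_scaleC_right[of x 0 0] by simp

lemma cinner_minus_left: "cinner (- x) y = - cinner x (y::'a::complex_hilbert)"
  using cinner_scaleC_left[of "-1" x y] by (simp add: scaleC_minus_left scaleC_one)

lemma cinner_minus_right: "cinner x (- y) = - cinner x (y::'a::complex_hilbert)"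
  using cinner_scaleC_right[of x "-1" y] by (simp add: scaleC_minus_left scaleC_one)

lemma cinner_diff_left: "cinner (x - y) z = cinner x z - cinner y (z::'a::complex_hilbert)"
  using cinner_add_left[of x "-y" z] by (simp add: cinner_minus_left)

lemma cinner_diff_right: "cinner x (y - z) = cinner x y - cinner x (z::'a::complex_hilbert)"
  using cinner_add_right[of x y "-z"] by (simp add: cinner_minus_right)

lemma cinner_sum_left: "cinner (\<Sum>i\<in>I. f i) y = (\<Sum>i\<in>I. cinner (f i) (y::'a::complex_hilbert))"
  by (induction I rule: infinite_finite_induct) (simp_all add: cinner_add_left)

lemma cinner_sum_right: "cinner x (\<Sum>i\<in>I. f i) = (\<Sum>i\<in>I. cinner x (f i::'a::complex_hilbert))"
  by (induction I rule: infinite_finite_induct) (simp_all add: cinner_add_right)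

lemma cinner_eq_zero_commute: "cinner x y = 0 \<longleftrightarrow> cinner y (x::'a::complex_hilbert) = 0"
  by (metis cinner_commute complex_cnj_zero)

lemma norm_scaleC: "norm (a *\<^sub>C x) = cmod a * norm (x::'a::complex_hilbert)"
proof -
  have "complex_of_real ((norm (a *\<^sub>C x))\<^sup>2) = a * cnj a * complex_of_real ((norm x)\<^sup>2)"
    by (simp only: cinner_self[symmetric] cinner_scaleC_left cinner_scaleC_right mult_ac)
  also have "\<dots> = complex_of_real ((cmod a * norm x)\<^sup>2)"
    by (simp only: complex_norm_square[symmetric] power_mult_distrib of_real_mult)
  finally have "(norm (a *\<^sub>C x))\<^sup>2 = (cmod a * norm x)\<^sup>2"
    using of_real_eq_iff by blast
  then show ?thesis
    by (simp add: power2_eq_iff_nonneg)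
qed

text \<open>The underlying real Hilbert space: \<open>Re \<langle>x, y\<rangle>\<close> carries all metric information, since
  \<open>Im \<langle>x, y\<rangle> = Re \<langle>x, iy\<rangle>\<close>.\<close>

definition rinner :: "'a::complex_hilbert \<Rightarrow> 'a \<Rightarrow> real" where
  "rinner x y = Re (cinner x y)"

lemma rinner_add_left: "rinner (x + y) z = rinner x z + rinner y z"
  and rinner_add_right: "rinner x (y + z) = rinner x y + rinner x z"
  and rinner_diff_left: "rinner (x - y) z = rinner x z - rinner y z"
  and rinner_diff_right: "rinner x (y - z) = rinner x y - rinner x z"
  and rinner_minus_left: "rinner (- x) z = - rinner x z"
  and rinner_minus_right: "rinner x (- z) = - rinner x z"
  and rinner_scaleR_left: "rinner (r *\<^sub>R x) y = r * rinner x y"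
  and rinner_scaleR_right: "rinner x (r *\<^sub>R y) = r * rinner x y"
  and rinner_zero_left [simp]: "rinner 0 x = 0"
  and rinner_zero_right [simp]: "rinner x 0 = 0"
  by (simp_all add: rinner_def cinner_add_left cinner_add_right cinner_diff_left cinner_diff_right
      cinner_minus_left cinner_minus_right scaleR_scaleC cinner_scaleC_left cinner_scaleC_right)

lemmas rinner_simps = rinner_add_left rinner_add_right rinner_diff_left rinner_diff_right
  rinner_minus_left rinner_minus_right rinner_scaleR_left rinner_scaleR_right

lemma rinner_commute: "rinner x y = rinner y x"
  by (metis rinner_def cinner_commute cnj.sel(1))

lemma rinner_sum_left: "rinner (\<Sum>i\<in>I. f i) y = (\<Sum>i\<in>I. rinner (f i) y)"
  by (simp add: rinner_def cinner_sum_left)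

lemma rinner_self: "rinner x x = (norm x)\<^sup>2"
  by (simp add: rinner_def cinner_self)

lemma rinner_ii_ii: "rinner (\<i> *\<^sub>C x) (\<i> *\<^sub>C y) = rinner x y"
  by (simp add: rinner_def cinner_scaleC_left cinner_scaleC_right)

lemma rinner_ii_left: "rinner (\<i> *\<^sub>C x) y = - rinner x (\<i> *\<^sub>C y)"
  by (simp add: rinner_def cinner_scaleC_left cinner_scaleC_right)

lemma cinner_conv_rinner: "cinner x y = Complex (rinner x y) (rinner x (\<i> *\<^sub>C y))"
  by (simp add: rinner_def cinner_scaleC_right complex_eq_iff)

lemma norm_add_sq: "(norm (x + y))\<^sup>2 = (norm x)\<^sup>2 + 2 * rinner x y + (norm (y::'a::complex_hilbert))\<^sup>2"
  using rinner_commute[of x y] by (simp add: rinner_self[symmetric] rinner_simps)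

lemma norm_diff_sq: "(norm (x - y))\<^sup>2 = (norm x)\<^sup>2 - 2 * rinner x y + (norm (y::'a::complex_hilbert))\<^sup>2"
  using rinner_commute[of x y] by (simp add: rinner_self[symmetric] rinner_simps)

lemma parallelogram_law:
  "(norm (x + y))\<^sup>2 + (norm (x - y))\<^sup>2 = 2 * (norm x)\<^sup>2 + 2 * (norm (y::'a::complex_hilbert))\<^sup>2"
  by (simp add: norm_add_sq norm_diff_sq)

lemma cmod_cinner_le: "cmod (cinner x y) \<le> norm x * norm (y::'a::complex_hilbert)"
proof (cases "x = 0 \<or> y = 0")
  case False
  have *: "Re (cinner x y) \<le> norm x * norm y" if "x \<noteq> 0" "y \<noteq> 0" for x y :: 'a
  proof -
    have "0 \<le> (norm (norm y *\<^sub>R x - norm x *\<^sub>R y))\<^sup>2"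
      by simp
    also have "\<dots> = 2 * (norm x * norm y) * (norm x * norm y - rinner x y)"
      by (simp only: norm_diff_sq norm_scaleR rinner_simps)
        (simp add: power2_eq_square algebra_simps)
    finally show ?thesis
      using that by (simp add: zero_le_mult_iff rinner_def) (metis mult_pos_pos not_le zero_less_norm_iff)
  qed
  show ?thesis
  proof (cases "cinner x y = 0")
    case False
    define c where "c = cnj (cinner x y) / cmod (cinner x y)"
    have c: "cmod c = 1"
      using False by (simp add: c_def norm_divide)
    have "c * cinner x y = cmod (cinner x y)"
      using False by (simp add: c_def mult.commute[of "cnj _"] complex_norm_square[symmetric]
          power2_eq_square)
    then have "cmod (cinner x y) = Re (cinner (c *\<^sub>C x) y)"
      by (simp add: cinner_scaleC_left)
    also have "\<dots> \<le> norm (c *\<^sub>C x) * norm y"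
      using * \<open>\<not> (x = 0 \<or> y = 0)\<close>
      by (metis cinner_zero_left mult_eq_0_iff norm_zero zero_complex.sel(1) order_refl mult_zero_left)
    finally show ?thesis
      using c by (simp add: norm_scaleC)
  qed simp
qed auto

lemma abs_rinner_le: "\<bar>rinner x y\<bar> \<le> norm x * norm y"
  unfolding rinner_def using abs_Re_le_cmod cmod_cinner_le order_trans by blast

lemma bounded_bilinear_rinner: "bounded_bilinear rinner"
  by unfold_locales (auto simp: rinner_simps intro!: exI[of _ 1] abs_rinner_le)

lemma bounded_bilinear_scaleC: "bounded_bilinear (scaleC :: complex \<Rightarrow> 'a \<Rightarrow> 'a::complex_hilbert)"
proof
  show "(r *\<^sub>R a) *\<^sub>C b = r *\<^sub>R (a *\<^sub>C b)" for r a and b :: 'a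
    by (simp add: scaleR_scaleC[where 'a='a] scaleR_conv_of_real scaleC_scaleC)
  show "a *\<^sub>C (r *\<^sub>R b) = r *\<^sub>R (a *\<^sub>C b)" for r a and b :: 'a
    by (simp add: scaleR_scaleC scaleC_scaleC mult.commute)
qed (auto simp: scaleC_add_left scaleC_add_right norm_scaleC intro!: exI[of _ 1])

lemmas tendsto_rinner = bounded_bilinear.tendsto[OF bounded_bilinear_rinner]
lemmas tendsto_scaleC = bounded_bilinear.tendsto[OF bounded_bilinear_scaleC]
lemmas continuous_on_scaleC = bounded_bilinear.continuous_on[OF bounded_bilinear_scaleC]
lemmas bounded_linear_rinner_left = bounded_bilinear.bounded_linear_left[OF bounded_bilinear_rinner]

lemma rinner_eqI: "(\<And>z. rinner z x = rinner z y) \<Longrightarrow> x = y"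
  using rinner_self[of "x - y"] by (simp add: rinner_simps)

subsection \<open>The projection theorem and the Riesz representation theorem\<close>

text \<open>By the parallelogram law the midpoint of two near-minimizers would be too close to
  \<open>x\<close> unless they are close to each other, so a minimizing sequence is Cauchy.
  \<open>V\<close> is a real subspace, so that kernels of real functionals qualify; hence
  orthogonality is stated with \<open>rinner\<close>.\<close>

lemma nearest_point_exists:
  fixes V :: "'a::complex_hilbert set"
  assumes V: "subspace V" "closed V"
  obtains p where "p \<in> V" "\<And>v. v \<in> V \<Longrightarrow> rinner (x - p) v = 0"
proof -
  define d where "d = (INF v\<in>V. (norm (x - v))\<^sup>2)"
  have ne: "V \<noteq> {}"
    using V(1) subspace_0 by blast
  have bdd: "bdd_below ((\<lambda>v. (norm (x - v))\<^sup>2) ` V)"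
    by (rule bdd_belowI[of _ 0]) auto
  have d_le: "d \<le> (norm (x - v))\<^sup>2" if "v \<in> V" for v
    unfolding d_def using bdd that by (rule cINF_lower)
  have "\<exists>v\<in>V. (norm (x - v))\<^sup>2 < d + 1 / real (Suc n)" for n
    using cInf_lessD[of "(\<lambda>v. (norm (x - v))\<^sup>2) ` V" "d + 1 / real (Suc n)"] ne
    by (auto simp: d_def)
  then obtain f where fV: "\<And>n. f n \<in> V" and f: "\<And>n. (norm (x - f n))\<^sup>2 < d + 1 / real (Suc n)"
    by metis
  have dist: "(norm (f m - f n))\<^sup>2 \<le> 4 / real (Suc N)" if "N \<le> m" "N \<le> n" for m n N
  proof -
    have mid: "d \<le> (norm (x - (1/2) *\<^sub>R (f m + f n)))\<^sup>2"
      using V fV by (intro d_le subspace_mul subspace_add)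
    have "(x - f m) + (x - f n) = 2 *\<^sub>R (x - (1/2) *\<^sub>R (f m + f n))"
      by (simp add: algebra_simps scaleR_2)
    then have "(norm ((x - f m) + (x - f n)))\<^sup>2 = 4 * (norm (x - (1/2) *\<^sub>R (f m + f n)))\<^sup>2"
      by (simp only: norm_scaleR power_mult_distrib) simp
    moreover have "(norm ((x - f m) - (x - f n)))\<^sup>2 = (norm (f m - f n))\<^sup>2"
      by (simp add: norm_minus_commute)
    ultimately have "(norm (f m - f n))\<^sup>2 \<le> 2 * (norm (x - f m))\<^sup>2 + 2 * (norm (x - f n))\<^sup>2 - 4 * d"
      using parallelogram_law[of "x - f m" "x - f n"] mid by linarith
    also have "\<dots> \<le> 2 / real (Suc m) + 2 / real (Suc n)"
      using f[of m] f[of n] by simp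
    also have "\<dots> \<le> 2 / real (Suc N) + 2 / real (Suc N)"
      using that by (intro add_mono divide_left_mono) auto
    finally show ?thesis by simp
  qed
  have "Cauchy f"
  proof (rule metric_CauchyI)
    fix e :: real assume "0 < e"
    then obtain N where N: "4 / e\<^sup>2 < real N"
      using reals_Archimedean2 by blast
    have "dist (f m) (f n) < e" if "m \<ge> N" "n \<ge> N" for m n
    proof -
      have "4 / real (Suc N) < e\<^sup>2"
        using N \<open>0 < e\<close> by (simp add: field_simps add_pos_pos add_strict_increasing)
      then have "(norm (f m - f n))\<^sup>2 < e\<^sup>2"
        using dist[OF that] by linarith
      then show ?thesis
        using \<open>0 < e\<close> by (simp add: dist_norm power2_less_imp_less)
    qed
    then show "\<exists>M. \<forall>m\<ge>M. \<forall>n\<ge>M. dist (f m) (f n) < e"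
      by blast
  qed
  then obtain p where p: "f \<longlonglongrightarrow> p"
    using Cauchy_convergent convergent_def by blast
  have pV: "p \<in> V"
    using V(2) fV p closed_sequentially by blast
  have "(\<lambda>n. (norm (x - f n))\<^sup>2) \<longlonglongrightarrow> (norm (x - p))\<^sup>2"
    by (intro tendsto_intros p)
  moreover have "(\<lambda>n. d + 1 / real (Suc n)) \<longlonglongrightarrow> d + 0"
    by (intro tendsto_intros LIMSEQ_Suc[OF lim_1_over_n])
  ultimately have pd: "(norm (x - p))\<^sup>2 \<le> d + 0"
    by (rule LIMSEQ_le) (use f less_imp_le in blast)
  have "rinner (x - p) v = 0" if v: "v \<in> V" for v
  proof (rule ccontr)
    define a where "a = rinner (x - p) v"
    assume "rinner (x - p) v \<noteq> 0"
    then have a: "a \<noteq> 0" "v \<noteq> 0"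
      by (auto simp: a_def)
    \<comment> \<open>The \<open>t\<close> that minimizes the norm of
      \<open>(x - p) - t *\<^sub>R v\<close>.\<close>
    define t where "t = a / (norm v)\<^sup>2"
    have "d \<le> (norm ((x - p) - t *\<^sub>R v))\<^sup>2"
      using d_le[of "p + t *\<^sub>R v"] V(1) pV v by (simp add: subspace_add subspace_mul diff_diff_add)
    also have "\<dots> = (norm (x - p))\<^sup>2 - a\<^sup>2 / (norm v)\<^sup>2"
    proof -
      have "(norm ((x - p) - t *\<^sub>R v))\<^sup>2 = (norm (x - p))\<^sup>2 - 2 * (t * a) + t\<^sup>2 * (norm v)\<^sup>2"
        unfolding norm_diff_sq[of "x - p"] rinner_scaleR_right a_def by (simp add: power_mult_distrib)
      then show ?thesis
        using a by (simp add: t_def power2_eq_square)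
    qed
    finally have "a\<^sup>2 / (norm v)\<^sup>2 \<le> 0"
      using pd by simp
    then show False
      using a by (simp add: field_simps)
  qed
  then show ?thesis
    using pV that by blast
qed

text \<open>A vector \<open>e\<close> orthogonal to the kernel determines \<open>f\<close>, because
  every \<open>y\<close> minus a suitable multiple of \<open>e\<close> lies in the kernel; the
  factor \<open>f e / (norm e)\<^sup>2\<close> calibrates the value at \<open>e\<close>.\<close>

theorem riesz_representation:
  fixes f :: "'a::complex_hilbert \<Rightarrow> real"
  assumes "bounded_linear f"
  obtains h where "\<And>x. f x = rinner x h"
proof (cases "\<forall>x. f x = 0")
  case True
  then show ?thesis
    using that[of 0] by simp
next
  case False
  interpret f: bounded_linear f by fact
  obtain x where x: "f x \<noteq> 0"
    using False by blast
  have "subspace {x. f x = 0}"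
    by (auto simp: subspace_def f.add f.scaleR)
  moreover have "closed {x. f x = 0}"
    by (intro closed_Collect_eq linear_continuous_on assms continuous_on_const)
  ultimately obtain p where p: "f p = 0" "\<And>v. f v = 0 \<Longrightarrow> rinner (x - p) v = 0"
    using nearest_point_exists[of "{x. f x = 0}" x] by auto
  define e where "e = x - p"
  have fe: "f e \<noteq> 0"
    using x p by (simp add: e_def f.diff)
  then have e0: "e \<noteq> 0"
    by (auto simp: f.zero)
  have "f y = rinner y ((f e / (norm e)\<^sup>2) *\<^sub>R e)" for y
  proof -
    have "f (y - (f y / f e) *\<^sub>R e) = 0"
      using fe by (simp add: f.diff f.scaleR)
    then have "rinner e (y - (f y / f e) *\<^sub>R e) = 0"
      using p(2) by (simp add: e_def)
    then have "rinner e y = (f y / f e) * (norm e)\<^sup>2"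
      by (simp add: rinner_simps rinner_self)
    then show ?thesis
      using fe e0 by (simp add: rinner_simps rinner_commute[of y])
  qed
  then show ?thesis
    by (rule that)
qed

subsection \<open>Bounded operators and adjoints\<close>

lemma bounded_clinearD:
  assumes "bounded_clinear T"
  shows bounded_clinear_imp_bounded_linear: "bounded_linear T"
    and bounded_clinear_scaleC: "T (c *\<^sub>C x) = c *\<^sub>C T x"
    and bounded_clinear_add: "T (x + y) = T x + T y"
    and bounded_clinear_diff: "T (x - y) = T x - T y"
    and bounded_clinear_minus: "T (- x) = - T x"
    and bounded_clinear_scaleR: "T (r *\<^sub>R x) = r *\<^sub>R T x"
    and bounded_clinear_zero: "T 0 = 0"
    and bounded_clinear_sum: "T (\<Sum>i\<in>I. g i) = (\<Sum>i\<in>I. T (g i))"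
proof -
  interpret bounded_linear T
    using assms by (simp add: bounded_clinear_def)
  show "bounded_linear T" "T (c *\<^sub>C x) = c *\<^sub>C T x" "T (x + y) = T x + T y" "T (x - y) = T x - T y"
    "T (- x) = - T x" "T (r *\<^sub>R x) = r *\<^sub>R T x" "T 0 = 0" "T (\<Sum>i\<in>I. g i) = (\<Sum>i\<in>I. T (g i))"
    using assms by (simp_all add: bounded_clinear_def add diff neg scaleR sum bounded_linear_axioms)
qed

lemma bounded_clinear_norm_le: "bounded_clinear T \<Longrightarrow> norm (T x) \<le> onorm T * norm x"
  using onorm bounded_clinear_imp_bounded_linear by blast

lemma bounded_clinear_onorm_nonneg: "bounded_clinear T \<Longrightarrow> 0 \<le> onorm T"
  using onorm_pos_le bounded_clinear_imp_bounded_linear by blast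

lemma bounded_clinear_tendsto:
  "bounded_clinear T \<Longrightarrow> (f \<longlongrightarrow> x) F \<Longrightarrow> ((\<lambda>n. T (f n)) \<longlongrightarrow> T x) F"
  using bounded_linear.tendsto bounded_clinear_imp_bounded_linear by blast

lemma bounded_clinearI:
  assumes "\<And>x y. T (x + y) = T x + T y" and "\<And>c x. T (c *\<^sub>C x) = c *\<^sub>C T x"
    and "\<And>x. norm (T x) \<le> K * norm x"
  shows "bounded_clinear T"
  unfolding bounded_clinear_def
  by (auto intro!: bounded_linear_intro[of _ K] assms(1) simp: assms(2) scaleR_scaleC)
    (metis assms(3) mult.commute)

lemma bounded_clinear_id [simp]: "bounded_clinear (\<lambda>x. x)" "bounded_clinear id"
  by (simp_all add: bounded_clinear_def id_def)

lemma bounded_clinear_compose: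
  "bounded_clinear S \<Longrightarrow> bounded_clinear T \<Longrightarrow> bounded_clinear (\<lambda>x. S (T x))"
  by (simp add: bounded_clinear_def bounded_linear_compose)

lemma bounded_clinear_plus:
  "bounded_clinear S \<Longrightarrow> bounded_clinear T \<Longrightarrow> bounded_clinear (\<lambda>x. S x + T x)"
  by (simp add: bounded_clinear_def bounded_linear_add scaleC_add_right)

lemma bounded_clinear_sub:
  "bounded_clinear S \<Longrightarrow> bounded_clinear T \<Longrightarrow> bounded_clinear (\<lambda>x. S x - T x)"
  by (simp add: bounded_clinear_def bounded_linear_sub scaleC_diff_right)

lemma bounded_clinear_scale: "bounded_clinear T \<Longrightarrow> bounded_clinear (\<lambda>x. c *\<^sub>C T x)"
  using bounded_linear_compose[OF bounded_bilinear.bounded_linear_right[OF bounded_bilinear_scaleC]]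
  by (auto simp add: bounded_clinear_def scaleC_scaleC mult.commute)

lemma bounded_clinear_scale_real: "bounded_clinear T \<Longrightarrow> bounded_clinear (\<lambda>x. c *\<^sub>R T x)"
  unfolding scaleR_scaleC by (rule bounded_clinear_scale)

lemma bounded_clinear_funpow:
  fixes T :: "'a::complex_hilbert \<Rightarrow> 'a"
  shows "bounded_clinear T \<Longrightarrow> bounded_clinear (T ^^ n)"
  by (induction n) (simp_all add: bounded_clinear_compose o_def)

lemma norm_funpow_le:
  fixes T :: "'a::complex_hilbert \<Rightarrow> 'a"
  assumes "bounded_clinear T"
  shows "norm ((T ^^ n) x) \<le> onorm T ^ n * norm x"
proof (induction n)
  case (Suc n)
  have "norm (T ((T ^^ n) x)) \<le> onorm T * norm ((T ^^ n) x)"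
    by (rule bounded_clinear_norm_le[OF assms])
  also have "\<dots> \<le> onorm T * (onorm T ^ n * norm x)"
    using Suc bounded_clinear_onorm_nonneg[OF assms] by (rule mult_left_mono)
  finally show ?case by (simp add: mult.assoc)
qed simp

text \<open>Riesz representation for the real form gives a candidate for each \<open>y\<close>;
  complex linearity of \<open>T\<close> lets \<open>\<i>\<close> be moved across, which recovers the
  imaginary part.\<close>

lemma adjoint_exists:
  fixes T :: "'a::complex_hilbert \<Rightarrow> 'b::complex_hilbert"
  assumes "bounded_clinear T"
  obtains S where "\<And>x y. cinner (T x) y = cinner x (S y)"
proof -
  have "\<exists>h. \<forall>x. rinner (T x) y = rinner x h" for y
    using riesz_representation[of "\<lambda>x. rinner (T x) y"]
      bounded_linear_compose[OF bounded_linear_rinner_left bounded_clinear_imp_bounded_linear[OF assms]]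
    by metis
  then obtain S where S: "\<And>x y. rinner (T x) y = rinner x (S y)"
    by metis
  have "rinner (T x) (\<i> *\<^sub>C y) = rinner x (\<i> *\<^sub>C S y)" for x y
    using S[of "\<i> *\<^sub>C x" y] by (simp add: bounded_clinear_scaleC[OF assms] rinner_ii_left)
  then have "cinner (T x) y = cinner x (S y)" for x y
    by (simp add: cinner_conv_rinner S)
  then show ?thesis
    by (rule that)
qed

lemma cinner_eqI: "(\<And>z. cinner z x = cinner z y) \<Longrightarrow> x = y"
  by (rule rinner_eqI) (simp add: rinner_def)

lemma cinner_cadjoint:
  assumes "bounded_clinear T"
  shows "cinner x (cadjoint T y) = cinner (T x) y"
proof -
  obtain S where S: "\<And>x y. cinner (T x) y = cinner x (S y)"
    using adjoint_exists[OF assms] by blast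
  have "S' = S" if "\<forall>x y. cinner (T x) y = cinner x (S' y)" for S'
    by (rule ext, rule cinner_eqI) (metis S that)
  then have "\<forall>x y. cinner (T x) y = cinner x (cadjoint T y)"
    unfolding cadjoint_def using S by (intro theI[of "\<lambda>S. \<forall>x y. cinner (T x) y = cinner x (S y)" S]) auto
  then show ?thesis by simp
qed

lemma rinner_cadjoint:
  "bounded_clinear T \<Longrightarrow> rinner x (cadjoint T y) = rinner (T x) y"
  by (simp add: rinner_def cinner_cadjoint)

lemma cadjoint_eqI:
  assumes "\<And>x y. cinner (T x) y = cinner x (S y)"
  shows "cadjoint T = S"
proof -
  have "S' = S" if "\<forall>x y. cinner (T x) y = cinner x (S' y)" for S'
    by (rule ext, rule cinner_eqI) (metis assms that)
  then show ?thesis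
    unfolding cadjoint_def using assms by (intro the_equality) auto
qed

lemma selfadjoint_iff:
  "selfadjoint T \<longleftrightarrow> bounded_clinear T \<and> (\<forall>x y. rinner (T x) y = rinner x (T y))"
proof
  assume "selfadjoint T"
  then show "bounded_clinear T \<and> (\<forall>x y. rinner (T x) y = rinner x (T y))"
    by (metis selfadjoint_def rinner_cadjoint)
next
  assume *: "bounded_clinear T \<and> (\<forall>x y. rinner (T x) y = rinner x (T y))"
  then have "cinner (T x) y = cinner x (T y)" for x y
    using bounded_clinear_scaleC[of T \<i> y] by (simp add: cinner_conv_rinner)
  then show "selfadjoint T"
    using * by (auto simp: selfadjoint_def intro: cadjoint_eqI)
qed

lemma selfadjointD:
  assumes "selfadjoint T"
  shows selfadjoint_bounded: "bounded_clinear T"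
    and selfadjoint_rinner: "rinner (T x) y = rinner x (T y)"
  using assms by (auto simp: selfadjoint_iff)

text \<open>The lower bound makes \<open>T\<close> injective with closed range, and the projection
  theorem turns a trivial orthogonal complement of the range into surjectivity. The same bound
  controls the inverse.\<close>

lemma bounded_below_imp_boundedly_invertible:
  fixes T :: "'a::complex_hilbert \<Rightarrow> 'b::complex_hilbert"
  assumes T: "bounded_clinear T" and c: "0 < c" "\<And>x. c * norm x \<le> norm (T x)"
    and inj: "\<And>y. (\<forall>x. rinner (T x) y = 0) \<Longrightarrow> y = 0"
  shows "boundedly_invertible T"
proof -
  interpret T: bounded_linear T
    by (rule bounded_clinear_imp_bounded_linear[OF T])
  have "closed (range T)"
    unfolding closed_sequential_limits
  proof (intro allI impI)
    fix f l assume "(\<forall>n. f n \<in> range T) \<and> f \<longlonglongrightarrow> l"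
    then have "\<forall>n. \<exists>x. f n = T x" and l: "f \<longlonglongrightarrow> l"
      by auto
    then obtain g where g: "\<And>n. f n = T (g n)"
      by metis
    have "Cauchy g"
    proof (rule metric_CauchyI)
      fix e :: real assume "0 < e"
      then obtain M where M: "\<forall>m\<ge>M. \<forall>n\<ge>M. dist (f m) (f n) < c * e"
        using LIMSEQ_imp_Cauchy[OF l] c unfolding Cauchy_def by (meson mult_pos_pos)
      have "dist (g m) (g n) < e" if "m \<ge> M" "n \<ge> M" for m n
      proof -
        have "c * dist (g m) (g n) \<le> dist (f m) (f n)"
          using c(2)[of "g m - g n"] by (simp add: dist_norm g T.diff)
        then show ?thesis
          using M that c(1) by (smt (verit) mult_less_cancel_left_pos)
      qed
      then show "\<exists>M. \<forall>m\<ge>M. \<forall>n\<ge>M. dist (g m) (g n) < e"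
        by blast
    qed
    then obtain x where "g \<longlonglongrightarrow> x"
      using Cauchy_convergent convergent_def by blast
    then have "f \<longlonglongrightarrow> T x"
      unfolding g by (rule T.tendsto)
    then show "l \<in> range T"
      using l LIMSEQ_unique by blast
  qed
  moreover have "subspace (range T)"
    by (intro linear_subspace_image T.linear_axioms) auto
  ultimately have surj: "y \<in> range T" for y
  proof -
    obtain p where p: "p \<in> range T" "\<And>v. v \<in> range T \<Longrightarrow> rinner (y - p) v = 0"
      using nearest_point_exists[OF \<open>subspace (range T)\<close> \<open>closed (range T)\<close>, of y] by blast
    have "rinner (T x) (y - p) = 0" for x
      using p(2)[of "T x"] by (simp add: rinner_commute)
    then have "y - p = 0"
      using inj by blast
    then show ?thesis
      using p(1) by simp
  qed
  have "inj T"
  proof (rule injI)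
    fix x y assume "T x = T y"
    then have "c * norm (x - y) \<le> 0"
      using c(2)[of "x - y"] by (simp add: T.diff)
    then show "x = y"
      using c(1) by (simp add: mult_le_0_iff)
  qed
  have TS: "T (inv T y) = y" for y
    using surj f_inv_into_f by metis
  have ST: "inv T (T x) = x" for x
    using \<open>inj T\<close> by simp
  have "bounded_clinear (inv T)"
  proof (rule bounded_clinearI[where K = "1 / c"])
    show "inv T (x + y) = inv T x + inv T y" for x y
      by (metis TS ST T.add)
    show "inv T (a *\<^sub>C x) = a *\<^sub>C inv T x" for a x
      by (metis TS ST bounded_clinear_scaleC[OF T])
    show "norm (inv T y) \<le> 1 / c * norm y" for y
      using c(2)[of "inv T y"] c(1) by (simp add: TS field_simps)
  qed
  then show ?thesis
    unfolding boundedly_invertible_def using TS ST by (auto intro!: exI[of _ "inv T"])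
qed

text \<open>The orthogonal complement of the range of a selfadjoint operator is its kernel, which
  the lower bound makes trivial.\<close>

lemma selfadjoint_bounded_below_imp_invertible:
  assumes "selfadjoint T" and c: "0 < c" "\<And>x. c * norm x \<le> norm (T x)"
  shows "boundedly_invertible T"
proof (rule bounded_below_imp_boundedly_invertible[OF selfadjoint_bounded[OF assms(1)] c])
  fix y assume "\<forall>x. rinner (T x) y = 0"
  then have "rinner (T y) (T y) = 0"
    using selfadjoint_rinner[OF assms(1)] by metis
  then have "T y = 0"
    by (simp add: rinner_self)
  then show "y = 0"
    using c by (metis less_le_not_le mult_pos_pos norm_zero zero_less_norm_iff)
qed

lemma boundedly_invertibleD:
  assumes "boundedly_invertible T"
  shows "bij T" "bounded_clinear (inv T)" "T (inv T y) = y" "inv T (T x) = x"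
proof -
  obtain S where S: "bounded_clinear S" "S \<circ> T = id" "T \<circ> S = id"
    using assms by (auto simp: boundedly_invertible_def)
  then show "bij T"
    using o_bij by blast
  have "inv T = S"
    using S by (metis inv_unique_comp)
  moreover have "S (T x) = x" "T (S y) = y"
    using S by (simp_all add: fun_eq_iff)
  ultimately show "bounded_clinear (inv T)" "T (inv T y) = y" "inv T (T x) = x"
    using S(1) by simp_all
qed

subsection \<open>Operators from quadratic forms\<close>

text \<open>The defect of homogeneity is additive and 1-periodic, hence bounded, hence zero.\<close>

lemma additive_bounded_imp_homogeneous:
  fixes f :: "real \<Rightarrow> real"
  assumes add: "\<And>s t. f (s + t) = f s + f t" and bound: "\<And>t. \<bar>t\<bar> \<le> 1 \<Longrightarrow> \<bar>f t\<bar> \<le> K"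
  shows "f t = t * f 1"
proof -
  define g where "g t = f t - t * f 1" for t
  have gadd: "g (s + t) = g s + g t" for s t
    by (simp add: g_def add algebra_simps)
  have g0: "g 0 = 0"
    using gadd[of 0 0] by simp
  have gnat: "g (real n * t) = real n * g t" for n t
    by (induction n) (simp_all add: g0 distrib_right gadd)
  have gneg: "g (- t) = - g t" for t
    using gadd[of t "- t"] g0 by simp
  have gint: "g (of_int k) = 0" for k
    using gnat[of "nat \<bar>k\<bar>" 1] gneg[of "of_int k"] by (cases "k \<ge> 0") (auto simp: g_def)
  have gK: "\<bar>g t\<bar> \<le> 2 * K" for t
  proof -
    have "g t = g (frac t)"
      using gadd[of "frac t" "of_int \<lfloor>t\<rfloor>"] gint by (simp add: frac_def)
    moreover have "\<bar>frac t * f 1\<bar> \<le> K"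
    proof -
      have "\<bar>frac t * f 1\<bar> \<le> 1 * K"
        unfolding abs_mult using bound[of 1] frac_lt_1[of t]
        by (intro mult_mono) auto
      then show ?thesis by simp
    qed
    moreover have "\<bar>f (frac t)\<bar> \<le> K"
      using bound[of "frac t"] frac_lt_1[of t] by auto
    ultimately show ?thesis
      by (simp add: g_def)
  qed
  have "g t = 0"
  proof (rule ccontr)
    assume "g t \<noteq> 0"
    then obtain n where n: "2 * K / \<bar>g t\<bar> < real n"
      using reals_Archimedean2 by blast
    then have "2 * K < \<bar>g (real n * t)\<bar>"
      using \<open>g t \<noteq> 0\<close> unfolding gnat abs_mult by (simp add: field_simps)
    then show False
      using gK[of "real n * t"] by simp
  qed
  then show ?thesis by (simp add: g_def)
qed

text \<open>The Jordan-von Neumann argument: polarization turns the parallelogram law into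
  additivity, the bound turns additivity into real homogeneity, and homogeneity under complex
  scalars makes the represented operator commute with \<open>\<i>\<close>.\<close>

theorem quadratic_form_operator:
  fixes q :: "'a::complex_hilbert \<Rightarrow> real"
  assumes hom: "\<And>c x. q (c *\<^sub>C x) = (cmod c)\<^sup>2 * q x"
    and par: "\<And>x y. q (x + y) + q (x - y) = 2 * q x + 2 * q y"
    and bound: "\<And>x. \<bar>q x\<bar> \<le> M * (norm x)\<^sup>2"
  obtains T where "selfadjoint T" "\<And>x. rinner (T x) x = q x"
    "\<And>x y. 4 * rinner (T x) y = q (x + y) - q (x - y)"
proof -
  define b where "b x y = (q (x + y) - q (x - y)) / 4" for x y
  have q0: "q 0 = 0"
    using hom[of 0 0] by simp
  have homR: "q (r *\<^sub>R x) = r\<^sup>2 * q x" for r x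
    by (simp add: scaleR_scaleC hom)
  have qneg: "q (- x) = q x" for x
    using homR[of "-1" x] by simp
  have bsym: "b x y = b y x" for x y
    using qneg[of "x - y"] by (simp add: b_def add.commute)
  have bii: "b (\<i> *\<^sub>C x) (\<i> *\<^sub>C y) = b x y" for x y
    using hom[of \<i> "x + y"] hom[of \<i> "x - y"] by (simp add: b_def scaleC_add_right scaleC_diff_right)
  have b0: "b 0 y = 0" for y
    using qneg[of y] by (simp add: b_def)
  have bmid: "b (x + y) z + b (x - y) z = 2 * b x z" for x y z
  proof -
    have "q (x + y + z) + q (x - y + z) = 2 * q (x + z) + 2 * q y"
      using par[of "x + z" y] by (simp add: algebra_simps)
    moreover have "q (x + y - z) + q (x - y - z) = 2 * q (x - z) + 2 * q y"
      using par[of "x - z" y] by (simp add: algebra_simps)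
    ultimately show ?thesis
      by (simp add: b_def field_simps)
  qed
  have b2: "b (x + x) z = 2 * b x z" for x z
    using bmid[of x x z] by (simp add: b0)
  have badd: "b (x + y) z = b x z + b y z" for x y z
  proof -
    define u where "u = (1/2) *\<^sub>R (x + y)"
    define v where "v = (1/2) *\<^sub>R (x - y)"
    have "u + v = x" "u - v = y" "u + u = x + y"
      by (simp_all add: u_def v_def algebra_simps flip: scaleR_add_left)
    then show ?thesis
      using bmid[of u v z] b2[of u z] by simp
  qed
  \<comment> \<open>In the zero space the bound on \<open>q\<close> also holds for negative
    \<open>M\<close>, hence the case distinction.\<close>
  have M: "0 \<le> M \<or> (\<forall>x::'a. x = 0)"
  proof (rule disjCI)
    assume "\<not> (\<forall>x::'a. x = 0)"
    then obtain x :: 'a where "x \<noteq> 0"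
      by blast
    then show "0 \<le> M"
      using bound[of x] abs_ge_zero[of "q x"]
      by (metis order_trans zero_le_mult_iff zero_less_norm_iff zero_less_power not_le)
  qed
  have bq: "\<bar>b x y\<bar> \<le> M * ((norm x)\<^sup>2 + (norm y)\<^sup>2) / 2" for x y
  proof -
    have "4 * \<bar>b x y\<bar> \<le> \<bar>q (x + y)\<bar> + \<bar>q (x - y)\<bar>"
      by (simp add: b_def)
    also have "\<dots> \<le> M * (norm (x + y))\<^sup>2 + M * (norm (x - y))\<^sup>2"
      by (intro add_mono bound)
    also have "\<dots> = M * (2 * (norm x)\<^sup>2 + 2 * (norm y)\<^sup>2)"
      by (simp only: parallelogram_law distrib_left[symmetric])
    finally show ?thesis by (simp add: field_simps)
  qed
  have bscale: "b (r *\<^sub>R x) z = r * b x z" for r x z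
  proof -
    have "b (r *\<^sub>R x) z = r * b (1 *\<^sub>R x) z"
    proof (rule additive_bounded_imp_homogeneous)
      show "b ((s + t) *\<^sub>R x) z = b (s *\<^sub>R x) z + b (t *\<^sub>R x) z" for s t
        by (simp add: scaleR_add_left badd)
      show "\<bar>b (t *\<^sub>R x) z\<bar> \<le> M * ((norm x)\<^sup>2 + (norm z)\<^sup>2) / 2" if "\<bar>t\<bar> \<le> 1" for t
      proof (cases "0 \<le> M")
        case True
        have "(norm (t *\<^sub>R x))\<^sup>2 \<le> (norm x)\<^sup>2"
          using that by (simp add: power_mult_distrib mult_left_le_one_le abs_square_le_1)
        then have "M * ((norm (t *\<^sub>R x))\<^sup>2 + (norm z)\<^sup>2) / 2 \<le> M * ((norm x)\<^sup>2 + (norm z)\<^sup>2) / 2"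
          using True by (intro divide_right_mono mult_left_mono add_mono) auto
        then show ?thesis
          using bq[of "t *\<^sub>R x" z] by linarith
      next
        case False
        then have "x = 0" "z = 0" using M by auto
        then show ?thesis by (simp add: b0)
      qed
    qed
    then show ?thesis by simp
  qed
  \<comment> \<open>Normalizing both arguments sharpens the sum of squares in \<open>bq\<close> to a
    product of norms.\<close>
  have bbound: "\<bar>b x y\<bar> \<le> M * norm x * norm y" for x y
  proof (cases "x = 0 \<or> y = 0")
    case True
    then show ?thesis using b0[of x] b0[of y] bsym[of x y] by auto
  next
    case False
    have "b ((1 / norm x) *\<^sub>R x) ((1 / norm y) *\<^sub>R y) = b x y / (norm x * norm y)"
      by (simp add: bscale) (metis bscale bsym divide_inverse_commute inverse_eq_divide mult.commute divide_divide_eq_left')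
    moreover have "\<bar>b ((1 / norm x) *\<^sub>R x) ((1 / norm y) *\<^sub>R y)\<bar> \<le> M"
      using bq[of "(1 / norm x) *\<^sub>R x" "(1 / norm y) *\<^sub>R y"] False by simp
    ultimately have "\<bar>b x y\<bar> / (norm x * norm y) \<le> M"
      by (simp add: abs_divide abs_mult)
    then show ?thesis
      using False by (simp add: pos_divide_le_eq mult.assoc)
  qed
  have "\<exists>h. \<forall>x. b x y = rinner x h" for y
  proof -
    have "bounded_linear (\<lambda>x. b x y)"
      by (rule bounded_linear_intro[where K = "M * norm y"])
        (use bbound in \<open>auto simp: badd bscale algebra_simps\<close>)
    then show ?thesis
      using riesz_representation by metis
  qed
  then obtain T where T: "\<And>x y. b x y = rinner x (T y)"
    by metis
  have sym: "rinner (T x) y = rinner x (T y)" for x y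
    using T bsym rinner_commute by metis
  have "bounded_clinear T"
  proof (rule bounded_clinearI)
    have T_add: "T (x + y) = T x + T y" for x y
      by (rule rinner_eqI) (metis T badd bsym rinner_add_right)
    then show "T (x + y) = T x + T y" for x y .
    have T_R: "T (r *\<^sub>R x) = r *\<^sub>R T x" for r x
      by (rule rinner_eqI) (metis T bscale bsym rinner_scaleR_right)
    have T_ii: "T (\<i> *\<^sub>C x) = \<i> *\<^sub>C T x" for x
    proof (rule rinner_eqI)
      fix z :: 'a
      have z: "z = \<i> *\<^sub>C ((-\<i>) *\<^sub>C z)"
        by (simp add: scaleC_scaleC scaleC_one)
      have "rinner z (T (\<i> *\<^sub>C x)) = b ((-\<i>) *\<^sub>C z) x"
        using bii[of "(-\<i>) *\<^sub>C z" x] z T by metis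
      also have "\<dots> = rinner (\<i> *\<^sub>C ((-\<i>) *\<^sub>C z)) (\<i> *\<^sub>C T x)"
        by (simp only: rinner_ii_ii T)
      finally show "rinner z (T (\<i> *\<^sub>C x)) = rinner z (\<i> *\<^sub>C T x)"
        using z by simp
    qed
    show "T (c *\<^sub>C x) = c *\<^sub>C T x" for c x
    proof -
      have dec: "c *\<^sub>C v = Re c *\<^sub>R v + Im c *\<^sub>R (\<i> *\<^sub>C v)" for v :: 'a
      proof -
        have "c *\<^sub>C v = (complex_of_real (Re c) + complex_of_real (Im c) * \<i>) *\<^sub>C v"
          by (metis complex_eq mult.commute)
        then show ?thesis
          by (simp add: scaleC_add_left scaleR_scaleC scaleC_scaleC)
      qed
      show ?thesis
        by (simp add: dec T_add T_R T_ii)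
    qed
    show "norm (T x) \<le> M * norm x" for x
    proof (cases "T x = 0")
      case False
      have "norm (T x) * norm (T x) = b (T x) x"
        by (simp add: T rinner_self power2_eq_square)
      also have "\<dots> \<le> M * norm (T x) * norm x"
        using bbound[of "T x" x] by linarith
      finally show ?thesis
        using False by (simp add: mult.commute mult.left_commute)
    next
      case True
      then show ?thesis
        using M by (cases "x = 0") auto
    qed
  qed
  then have "selfadjoint T"
    using sym by (simp add: selfadjoint_iff)
  moreover have "rinner (T x) x = q x" for x
    using homR[of 2 x] T[of x x] q0 by (simp add: b_def rinner_commute scaleR_2)
  moreover have "4 * rinner (T x) y = q (x + y) - q (x - y)" for x y
    using T[of x y] by (simp add: b_def sym)
  ultimately show ?thesis
    by (rule that)
qed

subsection \<open>Averages over roots of unity\<close>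

lemma sum_cis_eq_0:
  assumes "cis \<theta> \<noteq> 1" "cis (real N * \<theta>) = 1"
  shows "(\<Sum>k<N. cis (real k * \<theta>)) = 0"
proof -
  have "(\<Sum>k<N. cis (real k * \<theta>)) = (\<Sum>k<N. cis \<theta> ^ k)"
    by (intro sum.cong refl) (simp add: Complex.DeMoivre)
  also have "\<dots> = 0"
    using assms geometric_sum[of "cis \<theta>" N] by (simp add: Complex.DeMoivre)
  finally show ?thesis .
qed

lemma cis_two_pi_fraction_neq_1:
  assumes "j \<noteq> 0" "\<bar>j\<bar> < int N"
  shows "cis (2 * pi * of_int j / real N) \<noteq> 1"
proof
  assume "cis (2 * pi * of_int j / real N) = 1"
  then have "cos (2 * pi * of_int j / real N) = 1"
    by (metis cis.sel(1) one_complex.sel(1))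
  then obtain m where "2 * pi * of_int j / real N = of_int m * 2 * pi"
    using cos_one_2pi_int by auto
  moreover have "N \<noteq> 0"
    using assms by auto
  ultimately have "of_int j = (of_int (m * int N) :: real)"
    by (simp add: field_simps)
  then have "j = m * int N"
    by linarith
  then show False
    using assms by (auto simp: abs_mult mult_less_cancel_right1)
qed

lemma sum_cis_fraction:
  assumes "j \<noteq> 0" "\<bar>j\<bar> < int N"
  shows "(\<Sum>k<N. cis (real k * (2 * pi * of_int j / real N))) = 0"
proof (rule sum_cis_eq_0[OF cis_two_pi_fraction_neq_1[OF assms]])
  have "N \<noteq> 0"
    using assms by auto
  then show "cis (real N * (2 * pi * of_int j / real N)) = 1"
    by (simp add: cis_multiple_2pi)
qed

text \<open>Uniform continuity, piece by piece. The offset \<open>s\<close> of the sample points is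
  kept because the idempotence of the Riesz projection compares the sums for \<open>s = 0\<close>
  and \<open>s = 1/2\<close>.\<close>

lemma riemann_sum_tendsto_integral:
  fixes f :: "real \<Rightarrow> 'a::banach"
  assumes cont: "continuous_on {0..1} f" and s: "0 \<le> s" "s \<le> 1"
  shows "(\<lambda>n. (1 / real (Suc n)) *\<^sub>R (\<Sum>k<Suc n. f ((real k + s) / real (Suc n))))
    \<longlonglongrightarrow> integral {0..1} f"
proof (rule metric_LIMSEQ_I)
  fix e :: real assume "0 < e"
  have "uniformly_continuous_on {0..1} f"
    using cont by (rule compact_uniformly_continuous) auto
  then obtain d where d: "0 < d" "\<And>x y. x \<in> {0..1} \<Longrightarrow> y \<in> {0..1} \<Longrightarrow> dist x y < d \<Longrightarrow> dist (f x) (f y) < e / 2"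
    unfolding uniformly_continuous_on_def using \<open>0 < e\<close> by (metis half_gt_zero)
  obtain N where N: "1 / d < real N"
    using reals_Archimedean2 by blast
  have "dist ((1 / real (Suc n)) *\<^sub>R (\<Sum>k<Suc n. f ((real k + s) / real (Suc n)))) (integral {0..1} f) < e"
    if n: "n \<ge> N" for n
  proof -
    define M where "M = real (Suc n)"
    have M: "0 < M" "1 / M < d"
    proof -
      show "0 < M" by (simp add: M_def)
      have "real N < M"
        using n by (simp add: M_def)
      then have "1 / d < M"
        using N by linarith
      then show "1 / M < d"
        using d(1) \<open>0 < M\<close> by (simp add: field_simps)
    qed
    have int: "f integrable_on {a..b}" if "0 \<le> a" "b \<le> 1" for a b
      using that by (intro integrable_continuous_real continuous_on_subset[OF cont]) auto
    have split: "integral {0..real m / M} f = (\<Sum>k<m. integral {real k / M..real (Suc k) / M} f)"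
      if "m \<le> Suc n" for m
      using that
    proof (induction m)
      case (Suc m)
      have "integral {0..real (Suc m) / M} f
          = integral {0..real m / M} f + integral {real m / M..real (Suc m) / M} f"
        using Suc.prems M(1)
        by (intro Henstock_Kurzweil_Integration.integral_combine[symmetric] int)
          (auto simp: divide_right_mono M_def)
      then show ?case
        using Suc by simp
    qed simp
    have whole: "integral {0..1} f = (\<Sum>k<Suc n. integral {real k / M..real (Suc k) / M} f)"
      using split[of "Suc n"] by (simp only: M_def) simp
    have piece: "norm ((1 / M) *\<^sub>R f ((real k + s) / M) - integral {real k / M..real (Suc k) / M} f)
        \<le> e / 2 * (1 / M)" if k: "k < Suc n" for k
    proof -
      define a where "a = real k / M"
      define b where "b = real (Suc k) / M"
      define c where "c = (real k + s) / M"
      have ab: "0 \<le> a" "b \<le> 1" "b - a = 1 / M" "a \<le> c" "c \<le> b" "a \<le> b"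
        using k M(1) s by (auto simp: a_def b_def c_def M_def divide_simps intro!: divide_right_mono)
      have c1: "continuous_on {a..b} f"
        using ab by (intro continuous_on_subset[OF cont]) auto
      have "(1 / M) *\<^sub>R f c - integral {a..b} f = integral {a..b} (\<lambda>t. f c - f t)"
        using ab by (simp add: Henstock_Kurzweil_Integration.integral_diff[OF integrable_const_ivl int])
      also have "norm \<dots> \<le> e / 2 * (b - a)"
      proof (rule integral_bound)
        show "continuous_on {a..b} (\<lambda>t. f c - f t)"
          by (intro continuous_intros c1)
        show "norm (f c - f t) \<le> e / 2" if "t \<in> {a..b}" for t
        proof -
          have "a \<le> t" "t \<le> b"
            using that by auto
          then have "dist c t < d"
            unfolding dist_real_def using ab(3-5) M(2) by linarith
          then show ?thesis
            using d(2)[of c t] that ab by (auto simp: dist_norm)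
        qed
      qed (use ab in auto)
      finally show ?thesis
        using ab by (simp add: a_def b_def c_def)
    qed
    have "norm ((1 / M) *\<^sub>R (\<Sum>k<Suc n. f ((real k + s) / M)) - integral {0..1} f)
        = norm (\<Sum>k<Suc n. (1 / M) *\<^sub>R f ((real k + s) / M) - integral {real k / M..real (Suc k) / M} f)"
      by (simp only: whole scaleR_sum_right sum_subtractf)
    also have "\<dots> \<le> (\<Sum>k<Suc n. e / 2 * (1 / M))"
      by (intro sum_norm_le piece) auto
    also have "\<dots> = e / 2"
      using M(1) by (simp add: M_def[symmetric] del: of_nat_Suc)
    finally show ?thesis
      using \<open>0 < e\<close> by (simp add: dist_norm M_def)
  qed
  then show "\<exists>N. \<forall>n\<ge>N. dist ((1 / real (Suc n)) *\<^sub>R (\<Sum>k<Suc n. f ((real k + s) / real (Suc n)))) (integral {0..1} f) < e"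
    by blast
qed

subsection \<open>Resolvents on a circle and Riesz projections\<close>

text \<open>The radius stays a parameter because two circles occur: the unit circle, and a circle of
  radius above the norm of \<open>A\<close>, whose Riesz integral is the identity.\<close>

locale resolvent_circle =
  fixes A :: "'x::complex_hilbert \<Rightarrow> 'x" and r :: real
  assumes A: "bounded_clinear A" and r: "0 < r"
    and invertible: "\<And>z. cmod z = r \<Longrightarrow> boundedly_invertible (\<lambda>x. z *\<^sub>C x - A x)"
begin

lemma resolvent_left: "cmod z = r \<Longrightarrow> z *\<^sub>C resolvent A z x - A (resolvent A z x) = x"
  using boundedly_invertibleD(3)[OF invertible] by (simp add: resolvent_def)

lemma resolvent_right: "cmod z = r \<Longrightarrow> resolvent A z (z *\<^sub>C x - A x) = x"
  using boundedly_invertibleD(4)[OF invertible] by (simp add: resolvent_def)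

lemma resolvent_bounded: "cmod z = r \<Longrightarrow> bounded_clinear (resolvent A z)"
  using boundedly_invertibleD(2)[OF invertible] by (simp add: resolvent_def)

lemma resolvent_commute: "cmod z = r \<Longrightarrow> resolvent A z (A x) = A (resolvent A z x)"
  by (metis A bounded_clinear_diff bounded_clinear_scaleC resolvent_left resolvent_right)

text \<open>A lower bound \<open>e z\<close> at one point survives, halved, on the disk of radius
  \<open>e z / 2\<close> around it, and finitely many such disks cover the compact circle.\<close>

lemma uniform_lower_bound:
  obtains c where "0 < c" "\<And>z x. cmod z = r \<Longrightarrow> c * norm x \<le> norm (z *\<^sub>C x - A x)"
proof -
  have "\<exists>e>0. \<forall>x. e * norm x \<le> norm (z *\<^sub>C x - A x)" if z: "cmod z = r" for z
  proof -
    obtain K where K: "0 < K" "\<And>x. norm (resolvent A z x) \<le> norm x * K"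
      using bounded_linear.pos_bounded[OF bounded_clinear_imp_bounded_linear[OF resolvent_bounded[OF z]]]
      by blast
    have "(1 / K) * norm x \<le> norm (z *\<^sub>C x - A x)" for x
      using K(2)[of "z *\<^sub>C x - A x"] K(1) by (simp add: resolvent_right[OF z] field_simps)
    then show ?thesis
      using K(1) by (intro exI[of _ "1 / K"]) auto
  qed
  then obtain e where e: "\<And>z. cmod z = r \<Longrightarrow> 0 < e z"
    "\<And>z x. cmod z = r \<Longrightarrow> e z * norm x \<le> norm (z *\<^sub>C x - A x)"
    by metis
  have "compact (sphere (0::complex) r)"
    by simp
  then obtain D where D: "D \<subseteq> sphere 0 r" "finite D" "sphere 0 r \<subseteq> (\<Union>z\<in>D. ball z (e z / 2))"
    by (rule compactE_image[of _ "sphere 0 r" "\<lambda>z. ball z (e z / 2)"]) (use e(1) in force)+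
  have "complex_of_real r \<in> sphere 0 r"
    using r by simp
  then have "D \<noteq> {}"
    using D(3) by auto
  define c where "c = Min ((\<lambda>z. e z / 2) ` D)"
  have "0 < c"
    using D e \<open>D \<noteq> {}\<close> by (auto simp: c_def)
  moreover have "c * norm x \<le> norm (w *\<^sub>C x - A x)" if w: "cmod w = r" for w x
  proof -
    obtain z where z: "z \<in> D" "dist z w < e z / 2"
      using D(3) w by (auto simp: subset_iff)
    have zr: "cmod z = r"
      using z D(1) by auto
    have "z *\<^sub>C x - A x = (w *\<^sub>C x - A x) + (z - w) *\<^sub>C x"
      by (simp add: scaleC_diff_left)
    then have "norm (z *\<^sub>C x - A x) \<le> norm (w *\<^sub>C x - A x) + cmod (z - w) * norm x"
      by (metis norm_scaleC norm_triangle_ineq)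
    moreover have "cmod (z - w) * norm x \<le> e z / 2 * norm x"
      using z by (intro mult_right_mono) (auto simp: dist_norm)
    ultimately have "e z / 2 * norm x \<le> norm (w *\<^sub>C x - A x)"
      using e(2)[OF zr, of x] by (simp add: field_simps)
    moreover have "c \<le> e z / 2"
      unfolding c_def using D z by (intro Min_le) auto
    ultimately show ?thesis
      by (meson mult_right_mono norm_ge_zero order_trans)
  qed
  ultimately show ?thesis
    by (rule that)
qed

lemma uniform_resolvent_bound:
  obtains K where "0 < K" "\<And>z x. cmod z = r \<Longrightarrow> norm (resolvent A z x) \<le> K * norm x"
proof -
  obtain c where c: "0 < c" "\<And>z x. cmod z = r \<Longrightarrow> c * norm x \<le> norm (z *\<^sub>C x - A x)"
    using uniform_lower_bound by blast
  have "norm (resolvent A z x) \<le> (1 / c) * norm x" if "cmod z = r" for z x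
    using c(2)[OF that, of "resolvent A z x"] c(1) by (simp add: resolvent_left[OF that] field_simps)
  then show ?thesis
    using c(1) that[of "1 / c"] by simp
qed

text \<open>The resolvent identity combined with the uniform bound gives a Lipschitz
  estimate.\<close>

lemma continuous_on_resolvent: "continuous_on (sphere 0 r) (\<lambda>z. resolvent A z x)"
proof -
  obtain K where K: "0 < K" "\<And>z x. cmod z = r \<Longrightarrow> norm (resolvent A z x) \<le> K * norm x"
    using uniform_resolvent_bound by blast
  have lip: "dist (resolvent A z x) (resolvent A w x) \<le> (K * K * norm x) * dist z w"
    if z: "cmod z = r" and w: "cmod w = r" for z w
  proof -
    have "resolvent A z x - resolvent A w x = resolvent A z ((w - z) *\<^sub>C resolvent A w x)"
    proof -
      have "x - (z *\<^sub>C resolvent A w x - A (resolvent A w x)) = (w - z) *\<^sub>C resolvent A w x"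
        using resolvent_left[OF w, of x] by (simp add: scaleC_diff_left algebra_simps)
      then show ?thesis
        using bounded_clinear_diff[OF resolvent_bounded[OF z], of x] resolvent_right[OF z] by metis
    qed
    also have "norm \<dots> \<le> K * (cmod (w - z) * (K * norm x))"
      using K(2)[OF z, of "(w - z) *\<^sub>C resolvent A w x"] K(2)[OF w, of x] K(1)
      by (smt (verit) mult_left_mono norm_ge_zero norm_scaleC)
    finally show ?thesis
      by (simp add: dist_norm norm_minus_commute algebra_simps)
  qed
  have "(K * K * norm x)-lipschitz_on (sphere 0 r) (\<lambda>z. resolvent A z x)"
    by (rule lipschitz_onI) (use lip K(1) in auto)
  then show ?thesis
    by (rule lipschitz_on_continuous_on)
qed

text \<open>Riemann sums for the Riesz integral. The nodes are the solutions of
  \<open>z ^ N = r ^ N * cis (2 * pi * s)\<close>, which makes the sum equal to \<open>(1 - A ^ N / z ^ N)\<^sup>-\<^sup>1\<close>.\<close>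

definition node :: "real \<Rightarrow> nat \<Rightarrow> nat \<Rightarrow> complex" where
  "node s N k = complex_of_real r * cis (2 * pi * ((real k + s) / real N))"

definition riesz_sum :: "real \<Rightarrow> nat \<Rightarrow> 'x \<Rightarrow> 'x" where
  "riesz_sum s N x = (1 / real N) *\<^sub>R (\<Sum>k<N. node s N k *\<^sub>C resolvent A (node s N k) x)"

lemma norm_node [simp]: "cmod (node s N k) = r"
  using r by (simp add: node_def norm_mult)

lemma node_power: "N > 0 \<Longrightarrow> node s N k ^ N = complex_of_real (r ^ N) * cis (2 * pi * s)"
proof -
  assume N: "N > 0"
  have "cis (2 * pi * ((real k + s) / real N)) ^ N = cis (2 * pi * s + 2 * pi * real k)"
  proof -
    have "real N * (2 * pi * ((real k + s) / real N)) = 2 * pi * s + 2 * pi * real k"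
      using N by (simp add: field_simps)
    then show ?thesis
      by (simp only: Complex.DeMoivre)
  qed
  also have "\<dots> = cis (2 * pi * s)"
    by (simp add: cis_mult[symmetric] cis_multiple_2pi)
  finally show ?thesis
    by (simp add: node_def power_mult_distrib)
qed

lemma sum_node_power:
  assumes "0 < j" "j < N"
  shows "(\<Sum>k<N. node s N k ^ j) = 0"
proof -
  have "node s N k ^ j = complex_of_real (r ^ j) * cis (2 * pi * s * real j / real N)
      * cis (real k * (2 * pi * of_int (int j) / real N))" for k
  proof -
    have "real j * (2 * pi * ((real k + s) / real N))
        = 2 * pi * s * real j / real N + real k * (2 * pi * of_int (int j) / real N)"
      using assms by (simp add: field_simps)
    then show ?thesis
      by (simp only: node_def power_mult_distrib Complex.DeMoivre of_real_power mult.assoc[of "_ ^ _" "cis _"] cis_mult)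
  qed
  then have "(\<Sum>k<N. node s N k ^ j) = complex_of_real (r ^ j) * cis (2 * pi * s * real j / real N)
      * (\<Sum>k<N. cis (real k * (2 * pi * of_int (int j) / real N)))"
    by (simp only: sum_distrib_left)
  then show ?thesis
    using sum_cis_fraction[of "int j" N] assms by simp
qed

lemma riesz_sum_bounded: "bounded_clinear (riesz_sum s N)"
proof -
  have "bounded_clinear (\<lambda>x. \<Sum>k<m. node s N k *\<^sub>C resolvent A (node s N k) x)" for m
  proof (induction m)
    case 0
    then show ?case by (auto intro: bounded_clinearI[where K = 0])
  next
    case (Suc m)
    then show ?case
      by (simp add: bounded_clinear_plus bounded_clinear_scale resolvent_bounded)
  qed
  then show ?thesis
    unfolding riesz_sum_def[abs_def] by (rule bounded_clinear_scale_real)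
qed

lemma riesz_sum_commute: "riesz_sum s N (A x) = A (riesz_sum s N x)"
  by (simp add: riesz_sum_def resolvent_commute bounded_clinear_scaleR[OF A]
      bounded_clinear_sum[OF A] bounded_clinear_scaleC[OF A])

lemma riesz_sum_commute_funpow: "riesz_sum s N ((A ^^ m) x) = (A ^^ m) (riesz_sum s N x)"
  by (induction m) (simp_all add: riesz_sum_commute)

lemma norm_riesz_sum_le:
  obtains K where "0 < K" "\<And>s N x. norm (riesz_sum s N x) \<le> K * norm x"
proof -
  obtain K where K: "0 < K" "\<And>z x. cmod z = r \<Longrightarrow> norm (resolvent A z x) \<le> K * norm x"
    using uniform_resolvent_bound by blast
  have "norm (riesz_sum s N x) \<le> (r * K) * norm x" for s N x
  proof -
    have "norm (\<Sum>k<N. node s N k *\<^sub>C resolvent A (node s N k) x) \<le> (\<Sum>k<N. r * (K * norm x))"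
      using r by (intro sum_norm_le) (auto simp: norm_scaleC intro!: mult_left_mono K(2))
    then have "norm (riesz_sum s N x) \<le> (1 / real N) * (real N * (r * (K * norm x)))"
      unfolding riesz_sum_def norm_scaleR by (intro mult_mono) auto
    also have "\<dots> \<le> (r * K) * norm x"
      using r K(1) by (cases "N = 0") auto
    finally show ?thesis .
  qed
  then show ?thesis
    using that[of "r * K"] r K(1) by simp
qed

text \<open>The finite geometric series \<open>G N\<close> factors \<open>z ^ N - A ^ N\<close> as
  \<open>z - A\<close> times \<open>G N\<close>, and the resolvent cancels the first factor.\<close>

lemma resolvent_power_difference:
  assumes "cmod z = r"
  shows "z *\<^sub>C resolvent A z (z ^ N *\<^sub>C x - (A ^^ N) x) = (\<Sum>j<N. z ^ (N - j) *\<^sub>C (A ^^ j) x)"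
proof -
  define G where "G N = (\<Sum>j<N. z ^ (N - Suc j) *\<^sub>C (A ^^ j) x)" for N
  have rec: "G (Suc N) = z *\<^sub>C G N + (A ^^ N) x" for N
  proof -
    have "(\<Sum>j<N. z ^ (N - j) *\<^sub>C (A ^^ j) x) = (\<Sum>j<N. (z * z ^ (N - Suc j)) *\<^sub>C (A ^^ j) x)"
      by (rule sum.cong) (auto simp flip: power_Suc simp: Suc_diff_Suc)
    then show ?thesis
      by (simp add: G_def scaleC_one scaleC_sum_right scaleC_scaleC)
  qed
  have G: "z *\<^sub>C G N - A (G N) = z ^ N *\<^sub>C x - (A ^^ N) x" for N
  proof (induction N)
    case 0
    then show ?case by (simp add: G_def scaleC_one bounded_clinear_zero[OF A])
  next
    case (Suc N)
    have "z *\<^sub>C G (Suc N) - A (G (Suc N))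
        = z *\<^sub>C (z *\<^sub>C G N - A (G N)) + z *\<^sub>C (A ^^ N) x - A ((A ^^ N) x)"
      by (simp add: rec bounded_clinear_add[OF A] bounded_clinear_scaleC[OF A] scaleC_add_right
          scaleC_diff_right)
    then show ?case
      by (simp add: Suc scaleC_diff_right scaleC_scaleC)
  qed
  have "z *\<^sub>C resolvent A z (z ^ N *\<^sub>C x - (A ^^ N) x) = z *\<^sub>C G N"
    by (simp only: G[symmetric] resolvent_right[OF assms])
  also have "\<dots> = (\<Sum>j<N. z ^ (N - j) *\<^sub>C (A ^^ j) x)"
    unfolding G_def scaleC_sum_right scaleC_scaleC
    by (rule sum.cong) (auto simp flip: power_Suc simp: Suc_diff_Suc)
  finally show ?thesis .
qed

text \<open>All nodes share the \<open>N\<close>-th power \<open>\<tau>\<close>, so the previous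
  expansion applies with one and the same vector at every node. Summing over the nodes annihilates
  every power of the node except the \<open>N\<close>-th, which belongs to
  \<open>j = 0\<close>.\<close>

lemma riesz_sum_inverse_left:
  assumes N: "N > 0" and \<tau>: "\<tau> = complex_of_real (r ^ N) * cis (2 * pi * s)"
  shows "riesz_sum s N (\<tau> *\<^sub>C x - (A ^^ N) x) = \<tau> *\<^sub>C x"
proof -
  have "node s N k *\<^sub>C resolvent A (node s N k) (\<tau> *\<^sub>C x - (A ^^ N) x)
      = (\<Sum>j<N. node s N k ^ (N - j) *\<^sub>C (A ^^ j) x)" for k
    using resolvent_power_difference[of "node s N k" N x] node_power[OF N, of s k] by (simp add: \<tau>)
  then have "(\<Sum>k<N. node s N k *\<^sub>C resolvent A (node s N k) (\<tau> *\<^sub>C x - (A ^^ N) x))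
      = (\<Sum>k<N. \<Sum>j<N. node s N k ^ (N - j) *\<^sub>C (A ^^ j) x)"
    by simp
  also have "\<dots> = (\<Sum>j<N. (\<Sum>k<N. node s N k ^ (N - j)) *\<^sub>C (A ^^ j) x)"
    by (subst sum.swap) (simp add: scaleC_sum_left)
  also have "\<dots> = (\<Sum>j<N. if j = 0 then (of_nat N * \<tau>) *\<^sub>C x else 0)"
    using N by (intro sum.cong) (auto simp: sum_node_power node_power \<tau>)
  also have "\<dots> = real N *\<^sub>R (\<tau> *\<^sub>C x)"
    using N by (simp add: scaleR_scaleC scaleC_scaleC)
  finally show ?thesis
    using N by (simp add: riesz_sum_def)
qed

text \<open>The inverse relation solved for the \<open>N\<close>-th iterate. For
  \<open>\<tau> = 1\<close> it says that \<open>N\<close> steps of \<open>A\<close> lead from the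
  Riemann sum \<open>v\<close> to \<open>v - x\<close>; this is where the Riesz projection meets the
  Stein inequality.\<close>

lemma funpow_riesz_sum:
  assumes N: "N > 0" and \<tau>: "\<tau> = complex_of_real (r ^ N) * cis (2 * pi * s)"
  shows "(A ^^ N) (riesz_sum s N x) = \<tau> *\<^sub>C (riesz_sum s N x - x)"
  using riesz_sum_inverse_left[OF assms, of x]
  by (simp add: bounded_clinear_diff[OF riesz_sum_bounded] bounded_clinear_scaleC[OF riesz_sum_bounded]
      riesz_sum_commute_funpow scaleC_diff_right algebra_simps)

text \<open>The derivative of the path is \<open>2 * pi * \<i>\<close> times the point itself, which
  cancels the prefactor and leaves the plain average of \<open>z *\<^sub>C resolvent A z x\<close>.
  The limit does not depend on the offset \<open>s\<close>.\<close>

lemma riesz_sum_tendsto: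
  assumes s: "0 \<le> s" "s \<le> 1"
  shows "(\<lambda>n. riesz_sum s (Suc n) x) \<longlonglongrightarrow> riesz_integral A (circlepath 0 r) x"
proof -
  define z where "z t = complex_of_real r * cis (2 * pi * t)" for t
  have zr: "cmod (z t) = r" for t
    using r by (simp add: z_def norm_mult)
  have "continuous_on {0..1} z"
    unfolding z_def by (intro continuous_intros)
  then have "continuous_on {0..1} (\<lambda>t. resolvent A (z t) x)"
    by (rule continuous_on_compose2[OF continuous_on_resolvent]) (use zr in auto)
  then have cont: "continuous_on {0..1} (\<lambda>t. z t *\<^sub>C resolvent A (z t) x)"
    by (rule continuous_on_scaleC[OF \<open>continuous_on {0..1} z\<close>])
  have "riesz_sum s (Suc n) x = (1 / real (Suc n)) *\<^sub>R
      (\<Sum>k<Suc n. z ((real k + s) / real (Suc n)) *\<^sub>C resolvent A (z ((real k + s) / real (Suc n))) x)" for n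
    by (simp only: riesz_sum_def node_def z_def)
  moreover have "riesz_integral A (circlepath 0 r) x = integral {0..1} (\<lambda>t. z t *\<^sub>C resolvent A (z t) x)"
  proof -
    have cp: "circlepath 0 r t = z t" for t
      by (simp add: circlepath z_def cis_conv_exp algebra_simps)
    have "vector_derivative (circlepath 0 r) (at t within {0..1}) = (2 * complex_of_real pi * \<i>) * z t"
      if "t \<in> {0..1}" for t
      using that by (simp add: vector_derivative_circlepath01 z_def cis_conv_exp algebra_simps)
    then have "integral {0..1} (\<lambda>t. vector_derivative (circlepath 0 r) (at t within {0..1}) *\<^sub>C
        resolvent A (circlepath 0 r t) x)
        = integral {0..1} (\<lambda>t. (2 * complex_of_real pi * \<i>) *\<^sub>C (z t *\<^sub>C resolvent A (z t) x))"
      by (intro Henstock_Kurzweil_Integration.integral_cong) (simp add: cp scaleC_scaleC)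
    also have "\<dots> = (2 * complex_of_real pi * \<i>) *\<^sub>C integral {0..1} (\<lambda>t. z t *\<^sub>C resolvent A (z t) x)"
      using integral_linear[OF integrable_continuous_real[OF cont]
          bounded_bilinear.bounded_linear_right[OF bounded_bilinear_scaleC]]
      by (simp add: o_def)
    finally show ?thesis
      by (simp add: riesz_integral_def scaleC_scaleC scaleC_one)
  qed
  ultimately show ?thesis
    using riemann_sum_tendsto_integral[OF cont s] by simp
qed

lemma riesz_integral_bounded: "bounded_clinear (riesz_integral A (circlepath 0 r))"
proof -
  have lim: "(\<lambda>n. riesz_sum 0 (Suc n) x) \<longlonglongrightarrow> riesz_integral A (circlepath 0 r) x" for x
    by (rule riesz_sum_tendsto) auto
  obtain K where K: "0 < K" "\<And>s N x. norm (riesz_sum s N x) \<le> K * norm x"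
    using norm_riesz_sum_le by blast
  show ?thesis
  proof (rule bounded_clinearI[where K = K])
    fix x y :: 'x and c
    have "(\<lambda>n. riesz_sum 0 (Suc n) x + riesz_sum 0 (Suc n) y) \<longlonglongrightarrow> riesz_integral A (circlepath 0 r) (x + y)"
      using lim[of "x + y"] by (simp add: bounded_clinear_add[OF riesz_sum_bounded])
    then show "riesz_integral A (circlepath 0 r) (x + y)
        = riesz_integral A (circlepath 0 r) x + riesz_integral A (circlepath 0 r) y"
      by (rule LIMSEQ_unique) (intro tendsto_add lim)
    have "(\<lambda>n. c *\<^sub>C riesz_sum 0 (Suc n) x) \<longlonglongrightarrow> riesz_integral A (circlepath 0 r) (c *\<^sub>C x)"
      using lim[of "c *\<^sub>C x"] by (simp add: bounded_clinear_scaleC[OF riesz_sum_bounded])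
    then show "riesz_integral A (circlepath 0 r) (c *\<^sub>C x) = c *\<^sub>C riesz_integral A (circlepath 0 r) x"
      by (rule LIMSEQ_unique) (intro tendsto_scaleC tendsto_const lim)
    show "norm (riesz_integral A (circlepath 0 r) x) \<le> K * norm x"
      by (rule tendsto_upperbound[OF tendsto_norm[OF lim]]) (use K(2) in auto)
  qed
qed

text \<open>In the limit both \<open>(1 - (A/r) ^ N)\<^sup>-\<^sup>1\<close> and \<open>(1 + (A/r) ^ N)\<^sup>-\<^sup>1\<close> give the Riesz projection, and
  their product is \<open>(1 - (A/r) ^ (2 * N))\<^sup>-\<^sup>1\<close>.\<close>

lemma riesz_integral_idem:
  "riesz_integral A (circlepath 0 r) (riesz_integral A (circlepath 0 r) x)
    = riesz_integral A (circlepath 0 r) x"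
proof -
  define P where "P = riesz_integral A (circlepath 0 r)"
  have lim: "(\<lambda>n. riesz_sum s (Suc n) x) \<longlonglongrightarrow> P x" if "0 \<le> s" "s \<le> 1" for s x
    unfolding P_def using that by (rule riesz_sum_tendsto)
  obtain K where K: "0 < K" "\<And>s N x. norm (riesz_sum s N x) \<le> K * norm x"
    using norm_riesz_sum_le by blast
  have prod: "riesz_sum 0 N (riesz_sum (1/2) N x) = riesz_sum 0 (2 * N) x" if N: "N > 0" for N
  proof -
    define \<tau> where "\<tau> = complex_of_real (r ^ N)"
    define u where "u = riesz_sum (1/2) N x"
    define y where "y = riesz_sum 0 N u"
    have u: "(A ^^ N) u = (- \<tau>) *\<^sub>C (u - x)"
      unfolding u_def by (rule funpow_riesz_sum[OF N]) (simp add: \<tau>_def)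
    have y: "(A ^^ N) y = \<tau> *\<^sub>C (y - u)"
      unfolding y_def by (rule funpow_riesz_sum[OF N]) (simp add: \<tau>_def)
    have "(A ^^ (2 * N)) y = (A ^^ N) ((A ^^ N) y)"
      by (simp add: mult_2 funpow_add)
    also have "\<dots> = \<tau> *\<^sub>C (\<tau> *\<^sub>C (y - u) - (- \<tau>) *\<^sub>C (u - x))"
      using bounded_clinear_funpow[OF A, of N]
      by (simp add: y u bounded_clinear_scaleC bounded_clinear_diff)
    also have "\<dots> = \<tau>\<^sup>2 *\<^sub>C (y - x)"
      by (simp add: power2_eq_square scaleC_scaleC scaleC_minus_left scaleC_diff_right)
    finally have "\<tau>\<^sup>2 *\<^sub>C y - (A ^^ (2 * N)) y = \<tau>\<^sup>2 *\<^sub>C x"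
      by (simp only: scaleC_diff_right diff_diff_eq2 add_diff_cancel_left')
    then have "riesz_sum 0 (2 * N) (\<tau>\<^sup>2 *\<^sub>C x) = \<tau>\<^sup>2 *\<^sub>C y"
      using riesz_sum_inverse_left[of "2 * N" "\<tau>\<^sup>2" 0 y] N
      by (simp add: \<tau>_def power_mult[symmetric] mult.commute flip: of_real_power)
    then have "\<tau>\<^sup>2 *\<^sub>C riesz_sum 0 (2 * N) x = \<tau>\<^sup>2 *\<^sub>C y"
      by (simp add: bounded_clinear_scaleC[OF riesz_sum_bounded])
    then show ?thesis
      using r by (simp add: y_def u_def \<tau>_def)
  qed
  have "(\<lambda>n. riesz_sum 0 (Suc n) (riesz_sum (1/2) (Suc n) x)) \<longlonglongrightarrow> P (P x)"
  proof -
    \<comment> \<open>The argument of the outer sum moves with \<open>n\<close>; the bound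
      \<open>K\<close>, uniform in the number of nodes, absorbs the difference.\<close>
    have "(\<lambda>n. K * norm (riesz_sum (1/2) (Suc n) x - P x)) \<longlonglongrightarrow> K * norm (P x - P x)"
      by (intro tendsto_intros lim) auto
    then have null: "(\<lambda>n. K * norm (riesz_sum (1/2) (Suc n) x - P x)) \<longlonglongrightarrow> 0"
      by simp
    have "(\<lambda>n. riesz_sum 0 (Suc n) (riesz_sum (1/2) (Suc n) x - P x)) \<longlonglongrightarrow> 0"
      by (rule Lim_null_comparison[OF _ null]) (simp add: K(2))
    from tendsto_add[OF this lim[of 0 "P x"]] show ?thesis
      by (simp add: bounded_clinear_diff[OF riesz_sum_bounded])
  qed
  moreover have "(\<lambda>n. riesz_sum 0 (Suc n) (riesz_sum (1/2) (Suc n) x)) \<longlonglongrightarrow> P x"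
  proof -
    \<comment> \<open>The sums are indexed by \<open>Suc\<close>, and
      \<open>2 * Suc n = Suc (2 * n + 1)\<close>.\<close>
    have "filterlim (\<lambda>n. 2 * n + 1) sequentially sequentially"
      by (rule filterlim_subseq) (auto simp: strict_mono_def)
    from filterlim_compose[OF lim[of 0 x] this] show ?thesis
      by (simp add: prod)
  qed
  ultimately show ?thesis
    unfolding P_def by (rule LIMSEQ_unique)
qed

end

lemma resolvent_circle_large:
  assumes A: "bounded_clinear A" and r: "onorm A < r"
  shows "resolvent_circle A r"
proof
  have "0 \<le> onorm A"
    by (rule bounded_clinear_onorm_nonneg[OF A])
  then show "0 < r"
    using r by simp
  fix z assume z: "cmod z = r"
  show "boundedly_invertible (\<lambda>x. z *\<^sub>C x - A x)"
  proof (rule bounded_below_imp_boundedly_invertible)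
    show "bounded_clinear (\<lambda>x. z *\<^sub>C x - A x)"
      by (intro bounded_clinear_sub bounded_clinear_scale bounded_clinear_id A)
    show "0 < r - onorm A"
      using r by simp
    show "(r - onorm A) * norm x \<le> norm (z *\<^sub>C x - A x)" for x
      using norm_triangle_ineq2[of "z *\<^sub>C x" "A x"] bounded_clinear_norm_le[OF A, of x]
      by (simp add: norm_scaleC z algebra_simps)
    fix y assume y: "\<forall>x. rinner (z *\<^sub>C x - A x) y = 0"
    have zz: "z * cnj z = complex_of_real (r\<^sup>2)"
      using complex_norm_square[of z] z by simp
    \<comment> \<open>Testing the orthogonality with \<open>x = cnj z *\<^sub>C y\<close> makes the
      leading term \<open>r\<^sup>2\<close> times the squared norm of \<open>y\<close>, which
      dominates since \<open>onorm A < r\<close>.\<close>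
    have "rinner (z *\<^sub>C (cnj z *\<^sub>C y)) y = r\<^sup>2 * (norm y)\<^sup>2"
      by (simp only: scaleC_scaleC zz scaleR_scaleC[symmetric] rinner_scaleR_left rinner_self)
    moreover have "rinner (A (cnj z *\<^sub>C y)) y \<le> onorm A * (r * norm y) * norm y"
    proof -
      have "rinner (A (cnj z *\<^sub>C y)) y \<le> norm (A (cnj z *\<^sub>C y)) * norm y"
        using abs_rinner_le abs_le_D1 by blast
      also have "\<dots> \<le> onorm A * norm (cnj z *\<^sub>C y) * norm y"
        by (intro mult_right_mono bounded_clinear_norm_le A) auto
      finally show ?thesis
        by (simp add: norm_scaleC z)
    qed
    moreover have "rinner (z *\<^sub>C (cnj z *\<^sub>C y)) y = rinner (A (cnj z *\<^sub>C y)) y"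
      using y[rule_format, of "cnj z *\<^sub>C y"] by (simp add: rinner_diff_left)
    ultimately have "r * (r - onorm A) * (norm y)\<^sup>2 \<le> 0"
      by (simp add: power2_eq_square algebra_simps)
    then show "y = 0"
      using r \<open>0 < r\<close> by (auto simp: mult_le_0_iff)
  qed
qed (use A in auto)

text \<open>\<open>r ^ N\<close> times the error of the Riemann sum is the norm of an
  \<open>N\<close>-th iterate of \<open>A\<close> on a bounded sequence, so the error is of order
  \<open>(onorm A / r) ^ N\<close>.\<close>

lemma riesz_integral_large_circle:
  assumes A: "bounded_clinear A" and r: "onorm A < r"
  shows "riesz_integral A (circlepath 0 r) x = x"
proof -
  interpret resolvent_circle A r
    using assms by (rule resolvent_circle_large)
  obtain K where K: "0 < K" "\<And>s N x. norm (riesz_sum s N x) \<le> K * norm x"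
    using norm_riesz_sum_le by blast
  note r_large = assms(2)
  have A0: "0 \<le> onorm A" and "0 < r"
    using bounded_clinear_onorm_nonneg[OF A] r_large by auto
  have "norm (riesz_sum 0 (Suc n) x - x) \<le> (onorm A / r) ^ Suc n * (K * norm x)" for n
  proof -
    have "r ^ Suc n * norm (riesz_sum 0 (Suc n) x - x) = norm ((A ^^ Suc n) (riesz_sum 0 (Suc n) x))"
      using funpow_riesz_sum[of "Suc n" _ 0 x] \<open>0 < r\<close>
      by (simp add: norm_scaleC norm_mult norm_power del: funpow.simps)
    also have "\<dots> \<le> onorm A ^ Suc n * (K * norm x)"
      using norm_funpow_le[OF A] K(2) A0 by (meson mult_left_mono order_trans zero_le_power)
    finally show ?thesis
      using \<open>0 < r\<close> by (simp add: power_divide field_simps del: power_Suc)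
  qed
  then have bound: "eventually (\<lambda>n. norm (riesz_sum 0 (Suc n) x - x)
      \<le> (onorm A / r) ^ Suc n * (K * norm x)) sequentially"
    by (simp only: eventually_True)
  have "(\<lambda>n. (onorm A / r) ^ Suc n * (K * norm x)) \<longlonglongrightarrow> 0 * (K * norm x)"
    using A0 r_large \<open>0 < r\<close> by (intro tendsto_mult_right LIMSEQ_Suc LIMSEQ_realpow_zero) auto
  then have null: "(\<lambda>n. (onorm A / r) ^ Suc n * (K * norm x)) \<longlonglongrightarrow> 0"
    by (simp only: mult_zero_left)
  have "(\<lambda>n. riesz_sum 0 (Suc n) x - x) \<longlonglongrightarrow> 0"
    by (rule Lim_null_comparison[OF bound null])
  then have "(\<lambda>n. riesz_sum 0 (Suc n) x) \<longlonglongrightarrow> x"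
    by (rule LIM_zero_cancel)
  then show ?thesis
    using LIMSEQ_unique riesz_sum_tendsto[of 0 x] by auto
qed

lemma has_dichotomy_resolvent_circle:
  "bounded_clinear A \<Longrightarrow> has_dichotomy A \<Longrightarrow> resolvent_circle A 1"
  unfolding has_dichotomy_def spectrum_def
  by unfold_locales auto

lemma riesz_projection_exterior_eq:
  assumes "bounded_clinear A"
  shows "riesz_projection_exterior A x = x - riesz_projection_disk A x"
  by (simp add: riesz_projection_exterior_def riesz_projection_disk_def
      riesz_integral_large_circle[OF assms])

subsection \<open>The strict Stein inequality\<close>

text \<open>The gain of a single step is kept, the others are dropped. Keeping the first step serves
  the range of the Riesz projection, keeping the last step serves its kernel.\<close>

lemma strict_stein_iterate:
  assumes A: "bounded_clinear A"
    and stein: "\<And>x. rinner (H (A x)) (A x) + \<delta> * (norm x)\<^sup>2 \<le> rinner (H x) x" and \<delta>: "0 < \<delta>"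
  shows "rinner (H ((A ^^ Suc n) x)) ((A ^^ Suc n) x) + \<delta> * (norm x)\<^sup>2 \<le> rinner (H x) x"
    and "rinner (H ((A ^^ Suc n) x)) ((A ^^ Suc n) x) + \<delta> * (norm ((A ^^ n) x))\<^sup>2 \<le> rinner (H x) x"
proof -
  have dec: "rinner (H (A y)) (A y) \<le> rinner (H y) y" for y
    using stein[of y] \<delta> by (smt (verit) mult_nonneg_nonneg zero_le_power2)
  have mono: "rinner (H ((A ^^ n) y)) ((A ^^ n) y) \<le> rinner (H y) y" for n y
    by (induction n) (use dec order_trans in auto)
  show "rinner (H ((A ^^ Suc n) x)) ((A ^^ Suc n) x) + \<delta> * (norm x)\<^sup>2 \<le> rinner (H x) x"
    using mono[of n "A x"] stein[of x] by (simp only: funpow_Suc_right o_apply)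
  show "rinner (H ((A ^^ Suc n) x)) ((A ^^ Suc n) x) + \<delta> * (norm ((A ^^ n) x))\<^sup>2 \<le> rinner (H x) x"
    using mono[of n x] stein[of "(A ^^ n) x"] by simp
qed

context resolvent_circle
begin

text \<open>With \<open>v n\<close> the Riemann sums at \<open>x\<close>, the vector
  \<open>w n\<close> reached after \<open>Suc n\<close> steps is \<open>v n - x\<close>. In the
  limit the iterated inequality compares \<open>H\<close> at \<open>P x\<close> with
  \<open>H\<close> at \<open>P x - x\<close>; one of these vectors vanishes in either case, and the
  retained gain gives definiteness.\<close>

lemma strict_stein_definite:
  assumes r1: "r = 1" and H: "bounded_clinear H"
    and stein: "\<And>x. rinner (H (A x)) (A x) + \<delta> * (norm x)\<^sup>2 \<le> rinner (H x) x" and \<delta>: "0 < \<delta>"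
  defines "P \<equiv> riesz_integral A (circlepath 0 1)"
  shows "P x = x \<Longrightarrow> \<delta> * (norm x)\<^sup>2 \<le> rinner (H x) x"
    and "P x = 0 \<Longrightarrow> rinner (H x) x \<le> - (\<delta> / (onorm A + 1)\<^sup>2) * (norm x)\<^sup>2"
proof -
  define v where "v n = riesz_sum 0 (Suc n) x" for n
  define w where "w n = (A ^^ Suc n) (v n)" for n
  have w: "w n = v n - x" for n
    unfolding w_def v_def
    by (subst funpow_riesz_sum[where \<tau> = 1]) (simp_all add: r1 scaleC_one)
  have lim: "v \<longlonglongrightarrow> P x"
    unfolding v_def P_def using riesz_sum_tendsto[of 0 x] r1 by simp
  have limw: "w \<longlonglongrightarrow> P x - x"
    unfolding w by (intro tendsto_intros lim)
  have limH: "(\<lambda>n. rinner (H (f n)) (f n)) \<longlonglongrightarrow> rinner (H l) l" if "f \<longlonglongrightarrow> l" for f l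
    by (intro tendsto_rinner bounded_clinear_tendsto[OF H] that)
  show "\<delta> * (norm x)\<^sup>2 \<le> rinner (H x) x" if "P x = x"
  proof -
    have "(\<lambda>n. rinner (H (w n)) (w n) + \<delta> * (norm (v n))\<^sup>2)
        \<longlonglongrightarrow> rinner (H (P x - x)) (P x - x) + \<delta> * (norm (P x))\<^sup>2"
      by (intro tendsto_intros limH limw lim)
    moreover have "(\<lambda>n. rinner (H (v n)) (v n)) \<longlonglongrightarrow> rinner (H (P x)) (P x)"
      by (intro limH lim)
    moreover have "rinner (H (w n)) (w n) + \<delta> * (norm (v n))\<^sup>2 \<le> rinner (H (v n)) (v n)" for n
      using strict_stein_iterate(1)[OF A stein \<delta>, of n "v n"] by (simp only: w_def)
    ultimately have "rinner (H (P x - x)) (P x - x) + \<delta> * (norm (P x))\<^sup>2 \<le> rinner (H (P x)) (P x)"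
      by (intro LIMSEQ_le) auto
    then show ?thesis
      using that by (simp add: bounded_clinear_zero[OF H])
  qed
  show "rinner (H x) x \<le> - (\<delta> / (onorm A + 1)\<^sup>2) * (norm x)\<^sup>2" if "P x = 0"
  proof -
    \<comment> \<open>\<open>w n\<close> is \<open>A\<close> applied to the \<open>n\<close>-th
      iterate, so the gain of the last step controls \<open>norm (w n)\<close> up to the norm of
      \<open>A\<close>; adding 1 excludes a division by 0.\<close>
    define \<epsilon> where "\<epsilon> = \<delta> / (onorm A + 1)\<^sup>2"
    have A0: "0 \<le> onorm A"
      by (rule bounded_clinear_onorm_nonneg[OF A])
    have step: "rinner (H (w n)) (w n) + \<epsilon> * (norm (w n))\<^sup>2 \<le> rinner (H (v n)) (v n)" for n
    proof -
      have "norm (w n) \<le> (onorm A + 1) * norm ((A ^^ n) (v n))"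
        unfolding w_def using bounded_clinear_norm_le[OF A, of "(A ^^ n) (v n)"]
        by (simp add: distrib_right add_increasing2)
      then have "(norm (w n))\<^sup>2 \<le> ((onorm A + 1) * norm ((A ^^ n) (v n)))\<^sup>2"
        by (intro power_mono) auto
      then have "\<epsilon> * (norm (w n))\<^sup>2 \<le> \<epsilon> * ((onorm A + 1) * norm ((A ^^ n) (v n)))\<^sup>2"
        using \<delta> by (intro mult_left_mono) (auto simp: \<epsilon>_def)
      also have "\<dots> = \<delta> * (norm ((A ^^ n) (v n)))\<^sup>2"
        using A0 by (simp add: \<epsilon>_def power_mult_distrib)
      finally show ?thesis
        using strict_stein_iterate(2)[OF A stein \<delta>, of n "v n"] unfolding w_def by linarith
    qed
    have "(\<lambda>n. rinner (H (w n)) (w n) + \<epsilon> * (norm (w n))\<^sup>2)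
        \<longlonglongrightarrow> rinner (H (P x - x)) (P x - x) + \<epsilon> * (norm (P x - x))\<^sup>2"
      by (intro tendsto_intros limH limw)
    moreover have "(\<lambda>n. rinner (H (v n)) (v n)) \<longlonglongrightarrow> rinner (H (P x)) (P x)"
      by (intro limH lim)
    ultimately have "rinner (H (P x - x)) (P x - x) + \<epsilon> * (norm (P x - x))\<^sup>2 \<le> rinner (H (P x)) (P x)"
      using step by (intro LIMSEQ_le) auto
    then show ?thesis
      using that by (simp add: bounded_clinear_minus[OF H] rinner_simps \<epsilon>_def)
  qed
qed

text \<open>Testing \<open>H x\<close> against \<open>p - q\<close> instead of \<open>p + q\<close>
  cancels the mixed terms, because \<open>H\<close> is symmetric, and lets the two definite parts
  add up. \<open>P\<close> need not be an orthogonal projection, so \<open>norm p + norm q\<close>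
  replaces \<open>norm x\<close> in the estimates.\<close>

lemma strict_stein_invertible:
  assumes r1: "r = 1" and H: "selfadjoint H"
    and stein: "\<And>x. rinner (H (A x)) (A x) + \<delta> * (norm x)\<^sup>2 \<le> rinner (H x) x" and \<delta>: "0 < \<delta>"
  shows "boundedly_invertible H"
proof -
  define P where "P = riesz_integral A (circlepath 0 1)"
  define \<epsilon> where "\<epsilon> = \<delta> / (onorm A + 1)\<^sup>2"
  define m where "m = min \<delta> \<epsilon>"
  have bH: "bounded_clinear H"
    using H by (rule selfadjoint_bounded)
  have P: "bounded_clinear P" "\<And>x. P (P x) = P x"
    using riesz_integral_bounded riesz_integral_idem unfolding P_def r1 by auto
  note pos = strict_stein_definite(1)[OF r1 bH stein \<delta>, folded P_def]
  note neg = strict_stein_definite(2)[OF r1 bH stein \<delta>, folded P_def \<epsilon>_def]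
  have "0 < onorm A + 1"
    using bounded_clinear_onorm_nonneg[OF A] by simp
  then have m: "0 < m"
    using \<delta> by (simp add: m_def \<epsilon>_def)
  show ?thesis
  proof (rule selfadjoint_bounded_below_imp_invertible[OF H])
    show "0 < m / 4"
      using m by simp
    fix x
    define p where "p = P x"
    define q where "q = x - P x"
    have x: "x = p + q"
      by (simp add: p_def q_def)
    have "\<delta> * (norm p)\<^sup>2 \<le> rinner (H p) p"
      by (rule pos) (simp add: p_def P)
    moreover have "rinner (H q) q \<le> - \<epsilon> * (norm q)\<^sup>2"
      by (rule neg) (simp add: q_def P bounded_clinear_diff[OF P(1)])
    moreover have "rinner (H x) (p - q) = rinner (H p) p - rinner (H q) q"
      using selfadjoint_rinner[OF H, of q p] rinner_commute[of q "H p"]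
      by (simp add: x bounded_clinear_add[OF bH] rinner_simps)
    moreover have "m * (norm p)\<^sup>2 \<le> \<delta> * (norm p)\<^sup>2" "m * (norm q)\<^sup>2 \<le> \<epsilon> * (norm q)\<^sup>2"
      by (auto simp: m_def intro!: mult_right_mono)
    ultimately have low: "m * ((norm p)\<^sup>2 + (norm q)\<^sup>2) \<le> rinner (H x) (p - q)"
      by (simp add: distrib_left)
    define s where "s = norm p + norm q"
    have "s\<^sup>2 \<le> 2 * ((norm p)\<^sup>2 + (norm q)\<^sup>2)"
      using sum_squares_bound[of "norm p" "norm q"] by (simp add: s_def power2_sum)
    then have "m / 2 * s\<^sup>2 \<le> m * ((norm p)\<^sup>2 + (norm q)\<^sup>2)"
      using mult_left_mono[of "s\<^sup>2" _ "m / 2"] m by fastforce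
    also have "\<dots> \<le> norm (H x) * norm (p - q)"
      using low abs_rinner_le[of "H x" "p - q"] by linarith
    also have "\<dots> \<le> norm (H x) * s"
      unfolding s_def by (intro mult_left_mono norm_triangle_ineq4) auto
    finally have *: "(m / 2 * s) * s \<le> norm (H x) * s"
      by (simp add: power2_eq_square mult.assoc)
    have xs: "norm x \<le> s"
      unfolding x s_def by (rule norm_triangle_ineq)
    show "m / 4 * norm x \<le> norm (H x)"
    proof (cases "s = 0")
      case False
      then have "0 < s"
        by (simp add: s_def add_nonneg_eq_0_iff order_less_le)
      then have "m / 2 * s \<le> norm (H x)"
        using * by simp
      moreover have "m / 4 * norm x \<le> m / 2 * s"
        using xs m by (intro mult_mono) auto
      ultimately show ?thesis by linarith
    next
      case True
      then show ?thesis using xs by simp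
    qed
  qed
qed

end

subsection \<open>Discrete Parseval identity\<close>

lemma norm_sum_sq:
  fixes v :: "nat \<Rightarrow> 'a::complex_hilbert"
  shows "(norm (\<Sum>n<N. v n))\<^sup>2 = (\<Sum>n<N. \<Sum>m<N. rinner (v n) (v m))"
  unfolding rinner_self[symmetric] rinner_sum_left by (simp add: rinner_def cinner_sum_right)

text \<open>Expanding the squares and exchanging the sums leaves the inner products of the columns
  of the discrete Fourier matrix, which are orthogonal of squared length \<open>N\<close>.\<close>

lemma discrete_parseval:
  fixes v :: "nat \<Rightarrow> 'a::complex_hilbert"
  shows "(\<Sum>k<N. (norm (\<Sum>n<N. cis (2 * pi * real k / real N) ^ n *\<^sub>C v n))\<^sup>2)
    = real N * (\<Sum>n<N. (norm (v n))\<^sup>2)"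
proof -
  define c where "c k n = cis (2 * pi * real k / real N) ^ n" for k n :: nat
  have orth: "(\<Sum>k<N. c k n * cnj (c k m)) = (if n = m then of_nat N else 0)"
    if "n < N" "m < N" for n m
  proof -
    have "c k n * cnj (c k m) = cis (real k * (2 * pi * of_int (int n - int m) / real N))" for k
    proof -
      have "real n * (2 * pi * real k / real N) + - (real m * (2 * pi * real k / real N))
          = real k * (2 * pi * of_int (int n - int m) / real N)"
        using that by (simp add: field_simps)
      then show ?thesis
        by (simp only: c_def Complex.DeMoivre cis_cnj cis_mult)
    qed
    then show ?thesis
      using sum_cis_fraction[of "int n - int m" N] that by auto
  qed
  have "(\<Sum>k<N. (norm (\<Sum>n<N. c k n *\<^sub>C v n))\<^sup>2)
      = (\<Sum>k<N. \<Sum>n<N. \<Sum>m<N. Re ((c k n * cnj (c k m)) * cinner (v n) (v m)))"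
    by (simp only: norm_sum_sq rinner_def cinner_scaleC_left cinner_scaleC_right mult_ac)
  also have "\<dots> = (\<Sum>n<N. \<Sum>k<N. \<Sum>m<N. Re ((c k n * cnj (c k m)) * cinner (v n) (v m)))"
    by (rule sum.swap)
  also have "\<dots> = (\<Sum>n<N. \<Sum>m<N. \<Sum>k<N. Re ((c k n * cnj (c k m)) * cinner (v n) (v m)))"
    by (intro sum.cong refl sum.swap)
  also have "\<dots> = (\<Sum>n<N. \<Sum>m<N. Re ((\<Sum>k<N. c k n * cnj (c k m)) * cinner (v n) (v m)))"
    by (simp only: sum_distrib_right Re_sum)
  also have "\<dots> = (\<Sum>n<N. \<Sum>m<N. if n = m then real N * (norm (v n))\<^sup>2 else 0)"
    by (intro sum.cong refl) (simp add: orth cinner_self)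
  also have "\<dots> = real N * (\<Sum>n<N. (norm (v n))\<^sup>2)"
    by (simp add: sum_distrib_left)
  finally show ?thesis
    by (simp only: c_def)
qed

subsection \<open>Quadratic storage functions\<close>

text \<open>The available storage: the supremum of the total supply over all finitely supported state
  sequences starting at a given state. The cyclic inequality bounds it, since a sequence that starts
  at \<open>x\<close> and ends in \<open>0\<close> closes up to a cycle through the extra transition from \<open>0\<close> to \<open>x\<close>.\<close>

theorem quadratic_storage_exists:
  fixes q :: "'x::complex_hilbert \<Rightarrow> 'x \<Rightarrow> 'u::complex_hilbert \<Rightarrow> real"
  assumes hom: "\<And>c x x' u. q (c *\<^sub>C x) (c *\<^sub>C x') (c *\<^sub>C u) = (cmod c)\<^sup>2 * q x x' u"
    and par: "\<And>x x' u y y' v. q (x + y) (x' + y') (u + v) + q (x - y) (x' - y') (u - v)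
      = 2 * q x x' u + 2 * q y y' v"
    and bounds: "\<And>x. - M * (norm x)\<^sup>2 \<le> q x 0 0" "\<And>x. - M * (norm x)\<^sup>2 \<le> q 0 x 0"
    and cyc: "\<And>N X U. X N = X 0 \<Longrightarrow> (\<Sum>n<N. q (X n) (X (Suc n)) (U n)) \<le> 0"
  obtains H where "selfadjoint H" "\<And>x x' u. q x x' u + rinner (H x') x' \<le> rinner (H x) x"
proof -
  define cost where "cost X U N = (\<Sum>n<N. q (X n) (X (Suc n)) (U n))" for X U and N :: nat
  \<comment> \<open>State and input vanish from index \<open>N\<close> on, so the last of the
    \<open>N\<close> counted transitions ends in 0.\<close>
  define adm where "adm x X U N \<longleftrightarrow> X 0 = x \<and> (\<forall>n\<ge>N. X n = 0 \<and> U n = 0)"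
    for x :: 'x and X and U :: "nat \<Rightarrow> 'u" and N :: nat
  define V where "V x = {c. \<exists>X U N. adm x X U N \<and> c = cost X U N}" for x
  define S where "S x = Sup (V x)" for x
  have q0: "q 0 0 0 = 0"
    using hom[of 0 0 0 0] by simp
  \<comment> \<open>Transitions from 0 to 0 supply nothing, so two sequences can be padded to a
    common length.\<close>
  have extend: "cost X U N' = cost X U N" "adm x X U N'" if "adm x X U N" "N \<le> N'" for x X U N N'
  proof -
    have "cost X U N' = cost X U N + (\<Sum>n\<in>{N..<N'}. q (X n) (X (Suc n)) (U n))"
      unfolding cost_def
      using sum.atLeastLessThan_concat[of 0 N N' "\<lambda>n. q (X n) (X (Suc n)) (U n)"] that(2)
      by (simp add: lessThan_atLeast0)
    also have "(\<Sum>n\<in>{N..<N'}. q (X n) (X (Suc n)) (U n)) = 0"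
      using that q0 by (intro sum.neutral) (auto simp: adm_def)
    finally show "cost X U N' = cost X U N" by simp
    show "adm x X U N'"
      using that by (auto simp: adm_def)
  qed
  \<comment> \<open>The dynamic programming step. It yields the dissipation inequality at the end
    and, with a transition from 0 to \<open>x\<close> in front, the upper bound.\<close>
  have prepend: "q x x' u + c \<in> V x" if c: "c \<in> V x'" for x x' u c
  proof -
    obtain X U N where XU: "adm x' X U N" "c = cost X U N"
      using c by (auto simp: V_def)
    define X' where "X' = case_nat x X"
    define U' where "U' = case_nat u U"
    have "adm x X' U' (Suc N)"
      using XU(1) by (auto simp: adm_def X'_def U'_def split: nat.split)
    moreover have "cost X' U' (Suc N) = q x x' u + c"
      using XU by (simp add: cost_def sum.lessThan_Suc_shift X'_def U'_def adm_def del: sum.lessThan_Suc)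
    ultimately show ?thesis
      unfolding V_def by (intro CollectI exI[of _ X'] exI[of _ U'] exI[of _ "Suc N"]) simp
  qed
  have upper: "c \<le> M * (norm x)\<^sup>2" if c: "c \<in> V x" for x c
  proof -
    have "q 0 x 0 + c \<in> V 0"
      using c by (rule prepend)
    then obtain X U N where XU: "adm 0 X U N" "q 0 x 0 + c = cost X U N"
      by (auto simp: V_def)
    then have "q 0 x 0 + c \<le> 0"
      using cyc[of X N U] by (simp add: adm_def cost_def)
    then show ?thesis
      using bounds(2)[of x] by simp
  qed
  have zero: "0 \<in> V 0"
    unfolding V_def by (intro CollectI exI[of _ "\<lambda>_. 0"] exI[of _ 0]) (simp add: adm_def cost_def)
  \<comment> \<open>The direct transition from \<open>x\<close> to 0 is the competitor behind the
    lower bound.\<close>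
  have base: "q x 0 0 \<in> V x" for x
    using prepend[OF zero, of x 0] by simp
  have bdd: "bdd_above (V x)" for x
    by (rule bdd_aboveI[of _ "M * (norm x)\<^sup>2"]) (rule upper)
  have S_upper: "c \<le> S x" if "c \<in> V x" for c x
    unfolding S_def using that bdd by (rule cSup_upper)
  have S_least: "S x \<le> b" if "\<And>c. c \<in> V x \<Longrightarrow> c \<le> b" for b x
    unfolding S_def using base that by (intro cSup_least) auto
  have S_bound: "\<bar>S x\<bar> \<le> M * (norm x)\<^sup>2" for x
    using S_least[of x "M * (norm x)\<^sup>2", OF upper] S_upper[OF base, of x] bounds(1)[of x] by auto
  have S0: "S 0 = 0"
    using S_bound[of 0] by simp
  have S_hom1: "(cmod c)\<^sup>2 * S x \<le> S (c *\<^sub>C x)" for c x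
  proof (cases "c = 0")
    case False
    have "v \<le> S (c *\<^sub>C x) / (cmod c)\<^sup>2" if v: "v \<in> V x" for v
    proof -
      obtain X U N where XU: "adm x X U N" "v = cost X U N"
        using v by (auto simp: V_def)
      have "adm (c *\<^sub>C x) (\<lambda>n. c *\<^sub>C X n) (\<lambda>n. c *\<^sub>C U n) N"
        using XU(1) by (auto simp: adm_def)
      moreover have "cost (\<lambda>n. c *\<^sub>C X n) (\<lambda>n. c *\<^sub>C U n) N = (cmod c)\<^sup>2 * v"
        by (simp add: cost_def hom XU(2) sum_distrib_left)
      ultimately have "(cmod c)\<^sup>2 * v \<in> V (c *\<^sub>C x)"
        unfolding V_def by (intro CollectI exI conjI) (assumption, simp)
      then have "(cmod c)\<^sup>2 * v \<le> S (c *\<^sub>C x)"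
        by (rule S_upper)
      then show ?thesis
        using False by (simp add: field_simps)
    qed
    then have "S x \<le> S (c *\<^sub>C x) / (cmod c)\<^sup>2"
      by (rule S_least)
    then show ?thesis
      using False by (simp add: field_simps)
  qed (simp add: S0)
  have S_hom: "S (c *\<^sub>C x) = (cmod c)\<^sup>2 * S x" for c x
  proof (cases "c = 0")
    case False
    have "(cmod (inverse c))\<^sup>2 * S (c *\<^sub>C x) \<le> S x"
      using S_hom1[of "inverse c" "c *\<^sub>C x"] False by (simp add: scaleC_scaleC scaleC_one)
    then have "(cmod c)\<^sup>2 * ((cmod (inverse c))\<^sup>2 * S (c *\<^sub>C x)) \<le> (cmod c)\<^sup>2 * S x"
      by (rule mult_left_mono) simp
    moreover have "(cmod c)\<^sup>2 * ((cmod (inverse c))\<^sup>2 * t) = t" for t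
      using False by (simp add: norm_inverse power_mult_distrib[symmetric] mult.assoc[symmetric]
          del: power_mult_distrib)
    ultimately have "S (c *\<^sub>C x) \<le> (cmod c)\<^sup>2 * S x"
      by simp
    then show ?thesis
      using S_hom1[of c x] by simp
  qed (simp add: S0)
  \<comment> \<open>Sums and differences of two sequences compete at \<open>x + y\<close> and
    \<open>x - y\<close>, which gives this half of the parallelogram law. The other half is the same
    inequality at the pair \<open>x + y\<close>, \<open>x - y\<close>.\<close>
  have S_par1: "2 * S x + 2 * S y \<le> S (x + y) + S (x - y)" for x y
  proof -
    have vw: "2 * v + 2 * w \<le> S (x + y) + S (x - y)" if v: "v \<in> V x" and w: "w \<in> V y" for v w
    proof -
      obtain X U N where XU: "adm x X U N" "v = cost X U N"
        using v by (auto simp: V_def)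
      obtain Y W L where YW: "adm y Y W L" "w = cost Y W L"
        using w by (auto simp: V_def)
      define K where "K = max N L"
      have XU': "adm x X U K" "v = cost X U K" and YW': "adm y Y W K" "w = cost Y W K"
        using extend[OF XU(1), of K] extend[OF YW(1), of K] XU(2) YW(2) by (auto simp: K_def)
      have "cost (\<lambda>n. X n + Y n) (\<lambda>n. U n + W n) K + cost (\<lambda>n. X n - Y n) (\<lambda>n. U n - W n) K = 2 * v + 2 * w"
        unfolding XU' YW' cost_def by (simp add: par sum_distrib_left flip: sum.distrib)
      moreover have "cost (\<lambda>n. X n + Y n) (\<lambda>n. U n + W n) K \<le> S (x + y)"
        using XU'(1) YW'(1)
        by (intro S_upper) (auto simp: V_def adm_def intro!: exI[of _ "\<lambda>n. X n + Y n"] exI[of _ "\<lambda>n. U n + W n"] exI[of _ K])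
      moreover have "cost (\<lambda>n. X n - Y n) (\<lambda>n. U n - W n) K \<le> S (x - y)"
        using XU'(1) YW'(1)
        by (intro S_upper) (auto simp: V_def adm_def intro!: exI[of _ "\<lambda>n. X n - Y n"] exI[of _ "\<lambda>n. U n - W n"] exI[of _ K])
      ultimately show ?thesis by linarith
    qed
    have *: "S y \<le> (S (x + y) + S (x - y) - 2 * v) / 2" if "v \<in> V x" for v
    proof (rule S_least)
      show "w \<le> (S (x + y) + S (x - y) - 2 * v) / 2" if "w \<in> V y" for w
        using vw[OF \<open>v \<in> V x\<close> that] by simp
    qed
    have "v \<le> (S (x + y) + S (x - y) - 2 * S y) / 2" if "v \<in> V x" for v
      using *[OF that] by (simp add: field_simps)
    then have "S x \<le> (S (x + y) + S (x - y) - 2 * S y) / 2"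
      by (rule S_least)
    then show ?thesis by (simp add: field_simps)
  qed
  have S_par: "S (x + y) + S (x - y) = 2 * S x + 2 * S y" for x y
  proof -
    have "(x + y) + (x - y) = 2 *\<^sub>C x" "(x + y) - (x - y) = 2 *\<^sub>C y"
      by (simp_all add: scaleC_add_left[of 1 1, simplified] scaleC_one)
    then have "2 * S (x + y) + 2 * S (x - y) \<le> 4 * S x + 4 * S y"
      using S_par1[of "x + y" "x - y"] S_hom[of 2 x] S_hom[of 2 y] by simp
    then show ?thesis
      using S_par1[of x y] by linarith
  qed
  obtain H where H: "selfadjoint H" "\<And>x. rinner (H x) x = S x"
    using quadratic_form_operator[OF S_hom S_par S_bound] by metis
  have "q x x' u + rinner (H x') x' \<le> rinner (H x) x" for x x' u
  proof -
    have "S x' \<le> S x - q x x' u"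
      using S_upper[OF prepend, of _ x' x u] by (intro S_least) (simp add: field_simps)
    then show ?thesis
      by (simp add: H(2))
  qed
  then show ?thesis
    using H(1) that by blast
qed

subsection \<open>The strict bounded real lemma\<close>

lemma bounded_clinear_block_op:
  assumes "bounded_clinear A" "bounded_clinear B" "bounded_clinear C" "bounded_clinear D"
  shows "bounded_clinear (block_op A B C D)"
proof -
  have "bounded_linear (\<lambda>v. (A (fst v) + B (snd v), C (fst v) + D (snd v)))"
    by (intro bounded_linear_Pair bounded_linear_add
        bounded_linear_compose[OF bounded_clinear_imp_bounded_linear bounded_linear_fst]
        bounded_linear_compose[OF bounded_clinear_imp_bounded_linear bounded_linear_snd] assms)
  moreover have "block_op A B C D = (\<lambda>v. (A (fst v) + B (snd v), C (fst v) + D (snd v)))"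
    by (auto simp: block_op_def)
  ultimately show ?thesis
    using assms by (auto simp: bounded_clinear_def scaleC_prod_def scaleC_add_right)
qed

lemma rinner_prod: "rinner (x, u) (y, v) = rinner x y + rinner u v"
  by (simp add: rinner_def cinner_prod_def)

text \<open>Pairing with the vector moves the adjoint to the other side, so the operator inequality
  becomes a scalar one in which state and input are visible separately.\<close>

lemma strict_KYP_iff:
  assumes "bounded_clinear A" "bounded_clinear B" "bounded_clinear C" "bounded_clinear D"
  shows "strict_KYP A B C D H \<longleftrightarrow> (\<exists>\<delta>>0. \<forall>x u.
    rinner (H (A x + B u)) (A x + B u) + (norm (C x + D u))\<^sup>2 + \<delta> * ((norm x)\<^sup>2 + (norm u)\<^sup>2)
      \<le> rinner (H x) x + (norm u)\<^sup>2)"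
proof -
  define M where "M = block_op A B C D"
  have M: "bounded_clinear M"
    unfolding M_def by (rule bounded_clinear_block_op[OF assms])
  have "Re (cinner (diag_op H id (x, u) - cadjoint M (diag_op H id (M (x, u)))) (x, u))
      = rinner (H x) x + (norm u)\<^sup>2 - (rinner (H (A x + B u)) (A x + B u) + (norm (C x + D u))\<^sup>2)" for x u
  proof -
    have "rinner (cadjoint M (diag_op H id (M (x, u)))) (x, u) = rinner (M (x, u)) (diag_op H id (M (x, u)))"
      by (subst rinner_commute) (rule rinner_cadjoint[OF M])
    then show ?thesis
      unfolding rinner_def[symmetric]
      by (simp add: rinner_diff_left M_def block_op_def diag_op_def rinner_prod rinner_self
          rinner_commute[of "A x + B u"])
  qed
  then have eq: "\<delta> * (norm (x, u))\<^sup>2 \<le> Re (cinner (diag_op H id (x, u) - cadjoint M (diag_op H id (M (x, u)))) (x, u))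
      \<longleftrightarrow> rinner (H (A x + B u)) (A x + B u) + (norm (C x + D u))\<^sup>2 + \<delta> * ((norm x)\<^sup>2 + (norm u)\<^sup>2)
      \<le> rinner (H x) x + (norm u)\<^sup>2" for \<delta> x u
    by (simp add: norm_prod_def) linarith
  show ?thesis
    unfolding strict_KYP_def strictly_below_def M_def[symmetric] o_def split_paired_All eq ..
qed

section \<open>The transfer function on the unit circle and both directions of the
  equivalence\<close>

context resolvent_circle
begin

text \<open>On the unit circle \<open>cnj z\<close> is the inverse of \<open>z\<close>, so the
  operator to be inverted is \<open>z\<close> times the one inverted by the resolvent at
  \<open>cnj z\<close>.\<close>

lemma inv_eq_resolvent:
  assumes r1: "r = 1" and z: "cmod z = 1"
  shows "inv (\<lambda>x. x - z *\<^sub>C A x) b = cnj z *\<^sub>C resolvent A (cnj z) b"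
proof (rule inv_f_eq)
  have zz: "z * cnj z = 1" "cnj z * z = 1"
    using complex_norm_square[of z] z by (simp_all add: mult.commute)
  have cz: "cmod (cnj z) = r"
    using z r1 by simp
  show "inj (\<lambda>x. x - z *\<^sub>C A x)"
  proof (rule injI)
    fix x y assume "x - z *\<^sub>C A x = y - z *\<^sub>C A y"
    then have "cnj z *\<^sub>C (x - z *\<^sub>C A x) = cnj z *\<^sub>C (y - z *\<^sub>C A y)"
      by simp
    then have "cnj z *\<^sub>C x - A x = cnj z *\<^sub>C y - A y"
      by (simp add: scaleC_diff_right scaleC_scaleC zz scaleC_one)
    then show "x = y"
      using resolvent_right[OF cz] by metis
  qed
  show "cnj z *\<^sub>C resolvent A (cnj z) b - z *\<^sub>C A (cnj z *\<^sub>C resolvent A (cnj z) b) = b"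
    using resolvent_left[OF cz, of b]
    by (simp add: bounded_clinear_scaleC[OF A] scaleC_scaleC zz scaleC_one)
qed

lemma transfer_function_eq:
  assumes r1: "r = 1" and z: "cmod z = 1" and C: "bounded_clinear C"
  shows "transfer_function A B C D z u = D u + C (resolvent A (cnj z) (B u))"
proof -
  have "z * cnj z = 1"
    using complex_norm_square[of z] z by simp
  then show ?thesis
    by (simp add: transfer_function_def inv_eq_resolvent[OF r1 z] bounded_clinear_scaleC[OF C]
        scaleC_scaleC scaleC_one)
qed

text \<open>A real supremum is an upper bound only for a family known to be bounded above; the
  uniform resolvent bound supplies this before the hypothesis on the supremum can be used.\<close>

lemma norm_transfer_function_le:
  assumes r1: "r = 1" and B: "bounded_clinear B" and C: "bounded_clinear C" and D: "bounded_clinear D"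
    and \<gamma>: "(SUP z\<in>sphere 0 1. onorm (transfer_function A B C D z)) \<le> \<gamma>" and z: "cmod z = 1"
  shows "norm (transfer_function A B C D z u) \<le> \<gamma> * norm u"
proof -
  obtain K where K: "0 < K" "\<And>z x. cmod z = r \<Longrightarrow> norm (resolvent A z x) \<le> K * norm x"
    using uniform_resolvent_bound by blast
  have bF: "bounded_clinear (transfer_function A B C D w)" if "cmod w = 1" for w
  proof -
    have "transfer_function A B C D w = (\<lambda>u. D u + C (resolvent A (cnj w) (B u)))"
      using transfer_function_eq[OF r1 that C] by blast
    moreover have "bounded_clinear (resolvent A (cnj w))"
      using that r1 by (intro resolvent_bounded) simp
    ultimately show ?thesis
      using bounded_clinear_plus[OF D bounded_clinear_compose[OF C bounded_clinear_compose[OF _ B]]]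
      by simp
  qed
  have "onorm (transfer_function A B C D w) \<le> onorm D + onorm C * (K * onorm B)" if "cmod w = 1" for w
  proof (rule onorm_bound)
    show "0 \<le> onorm D + onorm C * (K * onorm B)"
      using K(1) bounded_clinear_onorm_nonneg[OF B] bounded_clinear_onorm_nonneg[OF C]
        bounded_clinear_onorm_nonneg[OF D] by simp
    fix u
    have "norm (C (resolvent A (cnj w) (B u))) \<le> onorm C * (K * (onorm B * norm u))"
    proof -
      have "norm (resolvent A (cnj w) (B u)) \<le> K * norm (B u)"
        using that r1 by (intro K(2)) simp
      also have "\<dots> \<le> K * (onorm B * norm u)"
        using K(1) by (intro mult_left_mono bounded_clinear_norm_le[OF B]) auto
      finally show ?thesis
        using bounded_clinear_norm_le[OF C] bounded_clinear_onorm_nonneg[OF C]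
        by (meson mult_left_mono order_trans)
    qed
    then show "norm (transfer_function A B C D w u) \<le> (onorm D + onorm C * (K * onorm B)) * norm u"
      using norm_triangle_ineq[of "D u" "C (resolvent A (cnj w) (B u))"] bounded_clinear_norm_le[OF D, of u]
      by (simp add: transfer_function_eq[OF r1 that C] algebra_simps)
  qed
  then have "bdd_above ((\<lambda>z. onorm (transfer_function A B C D z)) ` sphere 0 1)"
    by (intro bdd_aboveI2[where M = "onorm D + onorm C * (K * onorm B)"]) auto
  then have "onorm (transfer_function A B C D z) \<le> (SUP z\<in>sphere 0 1. onorm (transfer_function A B C D z))"
    using z by (intro cSUP_upper) auto
  then have "onorm (transfer_function A B C D z) \<le> \<gamma>"
    using \<gamma> by linarith
  then show ?thesis
    using bounded_clinear_norm_le[OF bF[OF z], of u]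
    by (meson mult_right_mono norm_ge_zero order_trans)
qed

lemma strict_KYP_imp_contractive:
  assumes r1: "r = 1" and B: "bounded_clinear B" and C: "bounded_clinear C" and D: "bounded_clinear D"
    and H: "bounded_clinear H" and kyp: "strict_KYP A B C D H"
  shows "(SUP z\<in>sphere 0 1. onorm (transfer_function A B C D z)) < 1"
proof -
  obtain \<delta> where \<delta>: "0 < \<delta>" and ineq: "\<And>x u.
    rinner (H (A x + B u)) (A x + B u) + (norm (C x + D u))\<^sup>2 + \<delta> * ((norm x)\<^sup>2 + (norm u)\<^sup>2)
      \<le> rinner (H x) x + (norm u)\<^sup>2"
    using kyp unfolding strict_KYP_iff[OF A B C D] by blast
  \<comment> \<open>The truncation at 0 covers \<open>\<delta> > 1\<close>, which can happen only
    for a trivial input space.\<close>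
  define \<gamma> where "\<gamma> = sqrt (max 0 (1 - \<delta>))"
  have \<gamma>: "0 \<le> \<gamma>" "\<gamma> < 1" "\<gamma>\<^sup>2 = max 0 (1 - \<delta>)"
    using \<delta> by (auto simp: \<gamma>_def)
  have "onorm (transfer_function A B C D z) \<le> \<gamma>" if z: "z \<in> sphere 0 1" for z
  proof (rule onorm_bound[OF \<gamma>(1)])
    fix u
    have z1: "cmod z = 1"
      using z by simp
    \<comment> \<open>The steady state: \<open>A x + B u\<close> is a unimodular multiple of
      \<open>x\<close>, so the two \<open>H\<close>-terms are equal and drop out.\<close>
    define x where "x = resolvent A (cnj z) (B u)"
    have x: "A x + B u = cnj z *\<^sub>C x"
      using resolvent_left[of "cnj z" "B u"] z1 r1 by (simp add: x_def algebra_simps)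
    have "rinner (H (A x + B u)) (A x + B u) = rinner (H x) x"
    proof -
      have "cinner (H (A x + B u)) (A x + B u) = (z * cnj z) * cinner (H x) x"
        by (simp only: x bounded_clinear_scaleC[OF H] cinner_scaleC_left cinner_scaleC_right
            complex_cnj_cnj mult_ac)
      moreover have "z * cnj z = 1"
        using complex_norm_square[of z] z1 by simp
      ultimately show ?thesis
        by (simp only: rinner_def mult_1)
    qed
    then have "(norm (C x + D u))\<^sup>2 + \<delta> * (norm u)\<^sup>2 \<le> (norm u)\<^sup>2"
      using ineq[of x u] \<delta> by (simp add: distrib_left) (smt (verit) mult_nonneg_nonneg zero_le_power2)
    then have "(norm (C x + D u))\<^sup>2 \<le> (1 - \<delta>) * (norm u)\<^sup>2"
      by (simp add: algebra_simps)
    also have "\<dots> \<le> (\<gamma> * norm u)\<^sup>2"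
      by (simp add: power_mult_distrib \<gamma>(3) mult_right_mono)
    finally have "norm (C x + D u) \<le> \<gamma> * norm u"
      by (rule power2_le_imp_le) (simp add: \<gamma>(1))
    then show "norm (transfer_function A B C D z u) \<le> \<gamma> * norm u"
      by (simp add: transfer_function_eq[OF r1 z1 C] x_def add.commute)
  qed
  then have "(SUP z\<in>sphere 0 1. onorm (transfer_function A B C D z)) \<le> \<gamma>"
    by (intro cSUP_least) auto
  then show ?thesis
    using \<gamma>(2) by simp
qed

text \<open>The state splits into a response \<open>x1\<close> to the input and a response
  \<open>x2\<close> to the disturbance. The first sees the transfer function, with gain below 1;
  whatever the second causes is charged to \<open>L\<close>.\<close>

lemma contractive_frequency_inequality:
  assumes r1: "r = 1" and B: "bounded_clinear B" and C: "bounded_clinear C" and D: "bounded_clinear D"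
    and contr: "(SUP z\<in>sphere 0 1. onorm (transfer_function A B C D z)) < 1"
  obtains \<epsilon> L where "0 < \<epsilon>" "0 \<le> L"
    "\<And>\<zeta> x u w. cmod \<zeta> = 1 \<Longrightarrow> \<zeta> *\<^sub>C x = A x + B u + w \<Longrightarrow>
      (norm (C x + D u))\<^sup>2 + \<epsilon> * ((norm x)\<^sup>2 + (norm u)\<^sup>2) \<le> (norm u)\<^sup>2 + L * (norm w)\<^sup>2"
proof -
  define \<gamma> where "\<gamma> = max 0 (SUP z\<in>sphere 0 1. onorm (transfer_function A B C D z))"
  have \<gamma>: "0 \<le> \<gamma>" "\<gamma> < 1" "(SUP z\<in>sphere 0 1. onorm (transfer_function A B C D z)) \<le> \<gamma>"
    using contr by (auto simp: \<gamma>_def)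
  obtain K where K: "0 < K" "\<And>z x. cmod z = r \<Longrightarrow> norm (resolvent A z x) \<le> K * norm x"
    using uniform_resolvent_bound by blast
  define \<beta> where "\<beta> = K * onorm B"
  define \<kappa> where "\<kappa> = onorm C * K"
  \<comment> \<open>The gap \<open>1 - \<gamma>\<^sup>2\<close> is spent in two halves
    \<open>\<eta>\<close>: one for the mixed term between input and disturbance, one for the slack.
    The denominator of \<open>\<epsilon>\<close> is the factor by which the input bounds
    \<open>(norm x)\<^sup>2 + (norm u)\<^sup>2\<close>, and \<open>L\<close> collects what depends
    on \<open>w\<close>.\<close>
  define \<eta> where "\<eta> = (1 - \<gamma>\<^sup>2) / 2"
  define \<epsilon> where "\<epsilon> = \<eta> / (2 * \<beta>\<^sup>2 + 1)"
  define L where "L = (1 + 1 / \<eta>) * \<kappa>\<^sup>2 + 2 * \<epsilon> * K\<^sup>2"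
  have "\<gamma>\<^sup>2 < 1"
    using \<gamma> by (simp add: power_less_one_iff abs_square_less_1)
  then have \<eta>: "0 < \<eta>"
    by (simp add: \<eta>_def)
  have den: "0 < 2 * \<beta>\<^sup>2 + 1"
    by (simp add: add_nonneg_pos)
  then have \<epsilon>: "0 < \<epsilon>" "\<epsilon> * (2 * \<beta>\<^sup>2 + 1) = \<eta>"
    using \<eta> by (auto simp: \<epsilon>_def)
  have L: "0 \<le> L"
    using \<eta> \<epsilon> by (simp add: L_def)
  have "(norm (C x + D u))\<^sup>2 + \<epsilon> * ((norm x)\<^sup>2 + (norm u)\<^sup>2) \<le> (norm u)\<^sup>2 + L * (norm w)\<^sup>2"
    if z: "cmod \<zeta> = 1" and eq: "\<zeta> *\<^sub>C x = A x + B u + w" for \<zeta> x u w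
  proof -
    have zr: "cmod \<zeta> = r"
      using z r1 by simp
    define x1 where "x1 = resolvent A \<zeta> (B u)"
    define x2 where "x2 = resolvent A \<zeta> w"
    have x: "x = x1 + x2"
    proof -
      have "x = resolvent A \<zeta> (\<zeta> *\<^sub>C x - A x)"
        by (rule resolvent_right[OF zr, symmetric])
      also have "\<zeta> *\<^sub>C x - A x = B u + w"
        using eq by simp
      finally show ?thesis
        by (simp add: x1_def x2_def bounded_clinear_add[OF resolvent_bounded[OF zr]])
    qed
    have n1: "norm x1 \<le> \<beta> * norm u"
    proof -
      have "norm x1 \<le> K * norm (B u)"
        unfolding x1_def by (rule K(2)[OF zr])
      also have "\<dots> \<le> K * (onorm B * norm u)"
        using K(1) by (intro mult_left_mono bounded_clinear_norm_le[OF B]) auto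
      finally show ?thesis
        by (simp add: \<beta>_def mult.assoc)
    qed
    have n2: "norm x2 \<le> K * norm w"
      unfolding x2_def by (rule K(2)[OF zr])
    have nC: "norm (C x2) \<le> \<kappa> * norm w"
    proof -
      have "norm (C x2) \<le> onorm C * norm x2"
        by (rule bounded_clinear_norm_le[OF C])
      also have "\<dots> \<le> onorm C * (K * norm w)"
        using n2 bounded_clinear_onorm_nonneg[OF C] by (rule mult_left_mono)
      finally show ?thesis
        by (simp add: \<kappa>_def mult.assoc)
    qed
    have F: "D u + C x1 = transfer_function A B C D (cnj \<zeta>) u"
      using transfer_function_eq[OF r1 _ C, of "cnj \<zeta>" B D u] z by (simp add: x1_def)
    have nF: "norm (D u + C x1) \<le> \<gamma> * norm u"
      unfolding F by (rule norm_transfer_function_le[OF r1 B C D \<gamma>(3)]) (simp add: z)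
    define a where "a = \<gamma> * norm u"
    define b where "b = \<kappa> * norm w"
    have "norm (C x + D u) \<le> norm (D u + C x1) + norm (C x2)"
      using norm_triangle_ineq[of "D u + C x1" "C x2"]
      by (simp add: x bounded_clinear_add[OF C] algebra_simps)
    also have "\<dots> \<le> a + b"
      unfolding a_def b_def by (intro add_mono nF nC)
    finally have y1: "(norm (C x + D u))\<^sup>2 \<le> (a + b)\<^sup>2"
      by (intro power_mono) auto
    \<comment> \<open>Young's inequality with weight \<open>\<eta>\<close>.\<close>
    have y2: "(a + b)\<^sup>2 \<le> (1 + \<eta>) * a\<^sup>2 + (1 + 1 / \<eta>) * b\<^sup>2"
    proof -
      have "0 \<le> (\<eta> * a - b)\<^sup>2 / \<eta>"
        using \<eta> by simp
      also have "\<dots> = \<eta> * a\<^sup>2 - 2 * a * b + b\<^sup>2 / \<eta>"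
        using \<eta> by (simp add: power2_diff field_simps power2_eq_square)
      finally show ?thesis
        by (simp add: power2_sum algebra_simps)
    qed
    have y3: "(1 + \<eta>) * a\<^sup>2 \<le> (\<gamma>\<^sup>2 + \<eta>) * (norm u)\<^sup>2"
    proof -
      have "(1 + \<eta>) * \<gamma>\<^sup>2 \<le> \<gamma>\<^sup>2 + \<eta>"
        using \<open>\<gamma>\<^sup>2 < 1\<close> \<eta> mult_left_mono[of "\<gamma>\<^sup>2" 1 \<eta>] by (simp add: algebra_simps)
      then show ?thesis
        by (simp add: a_def power_mult_distrib mult.assoc[symmetric] mult_right_mono)
    qed
    have "(1 + 1 / \<eta>) * b\<^sup>2 = (1 + 1 / \<eta>) * \<kappa>\<^sup>2 * (norm w)\<^sup>2"
      by (simp add: b_def power_mult_distrib mult.assoc)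
    then have Y: "(norm (C x + D u))\<^sup>2 \<le> (\<gamma>\<^sup>2 + \<eta>) * (norm u)\<^sup>2 + (1 + 1 / \<eta>) * \<kappa>\<^sup>2 * (norm w)\<^sup>2"
      using y1 y2 y3 by linarith
    have "(norm x)\<^sup>2 \<le> 2 * (norm x1)\<^sup>2 + 2 * (norm x2)\<^sup>2"
      using parallelogram_law[of x1 x2] zero_le_power2[of "norm (x1 - x2)"] unfolding x by linarith
    also have "\<dots> \<le> 2 * (\<beta> * norm u)\<^sup>2 + 2 * (K * norm w)\<^sup>2"
      using n1 n2 by (intro add_mono mult_left_mono power_mono) auto
    finally have "\<epsilon> * ((norm x)\<^sup>2 + (norm u)\<^sup>2)
        \<le> \<epsilon> * (2 * (\<beta> * norm u)\<^sup>2 + 2 * (K * norm w)\<^sup>2 + (norm u)\<^sup>2)"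
      using \<epsilon>(1) by (intro mult_left_mono) auto
    also have "\<dots> = \<epsilon> * (2 * \<beta>\<^sup>2 + 1) * (norm u)\<^sup>2 + 2 * \<epsilon> * K\<^sup>2 * (norm w)\<^sup>2"
      by (simp add: power_mult_distrib algebra_simps)
    finally have X: "\<epsilon> * ((norm x)\<^sup>2 + (norm u)\<^sup>2) \<le> \<eta> * (norm u)\<^sup>2 + 2 * \<epsilon> * K\<^sup>2 * (norm w)\<^sup>2"
      by (simp only: \<epsilon>(2))
    have "(\<gamma>\<^sup>2 + \<eta>) * (norm u)\<^sup>2 + \<eta> * (norm u)\<^sup>2 = (norm u)\<^sup>2"
      by (simp add: \<eta>_def field_simps)
    then show ?thesis
      using X Y unfolding L_def distrib_right by linarith
  qed
  then show ?thesis
    using that \<epsilon>(1) L by blast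
qed

text \<open>The supply \<open>q\<close> charges \<open>L\<close> for a failure of the state
  equation. At \<open>x' = A x + B u\<close> the charge is zero, and the storage inequality becomes
  the KYP inequality with \<open>\<delta> = \<epsilon>\<close>.\<close>

lemma contractive_imp_strict_KYP:
  fixes B :: "'u::complex_hilbert \<Rightarrow> 'x" and C :: "'x \<Rightarrow> 'y::complex_hilbert"
  assumes r1: "r = 1" and B: "bounded_clinear B" and C: "bounded_clinear C" and D: "bounded_clinear D"
    and contr: "(SUP z\<in>sphere 0 1. onorm (transfer_function A B C D z)) < 1"
  shows "\<exists>H. selfadjoint H \<and> strict_KYP A B C D H"
proof -
  obtain \<epsilon> L where \<epsilon>: "0 < \<epsilon>" and L: "0 \<le> L" and freq:
    "\<And>\<zeta> x u w. cmod \<zeta> = 1 \<Longrightarrow> \<zeta> *\<^sub>C x = A x + B u + w \<Longrightarrow>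
      (norm (C x + D u))\<^sup>2 + \<epsilon> * ((norm x)\<^sup>2 + (norm u)\<^sup>2) \<le> (norm u)\<^sup>2 + L * (norm w)\<^sup>2"
    using contractive_frequency_inequality[OF assms] by blast
  define q where "q x x' u = (norm (C x + D u))\<^sup>2 + \<epsilon> * ((norm x)\<^sup>2 + (norm u)\<^sup>2) - (norm u)\<^sup>2
    - L * (norm (x' - A x - B u))\<^sup>2" for x x' u
  have "\<exists>H. selfadjoint H \<and> (\<forall>x x' u. q x x' u + rinner (H x') x' \<le> rinner (H x) x)"
  proof (rule quadratic_storage_exists[of q "L * (1 + (onorm A)\<^sup>2)"])
    fix c x x' u
    have "C (c *\<^sub>C x) + D (c *\<^sub>C u) = c *\<^sub>C (C x + D u)"
      "c *\<^sub>C x' - A (c *\<^sub>C x) - B (c *\<^sub>C u) = c *\<^sub>C (x' - A x - B u)"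
      by (simp_all add: bounded_clinear_scaleC[OF A] bounded_clinear_scaleC[OF B]
          bounded_clinear_scaleC[OF C] bounded_clinear_scaleC[OF D] scaleC_add_right scaleC_diff_right)
    then have "q (c *\<^sub>C x) (c *\<^sub>C x') (c *\<^sub>C u) = (cmod c)\<^sup>2 * (norm (C x + D u))\<^sup>2
        + \<epsilon> * ((cmod c)\<^sup>2 * (norm x)\<^sup>2 + (cmod c)\<^sup>2 * (norm u)\<^sup>2) - (cmod c)\<^sup>2 * (norm u)\<^sup>2
        - L * ((cmod c)\<^sup>2 * (norm (x' - A x - B u))\<^sup>2)"
      by (simp only: q_def norm_scaleC power_mult_distrib)
    then show "q (c *\<^sub>C x) (c *\<^sub>C x') (c *\<^sub>C u) = (cmod c)\<^sup>2 * q x x' u"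
      unfolding q_def by algebra
  next
    fix x x' y y' :: 'x and u v :: 'u
    have eqs: "C (x + y) + D (u + v) = (C x + D u) + (C y + D v)"
      "C (x - y) + D (u - v) = (C x + D u) - (C y + D v)"
      "x' + y' - A (x + y) - B (u + v) = (x' - A x - B u) + (y' - A y - B v)"
      "x' - y' - A (x - y) - B (u - v) = (x' - A x - B u) - (y' - A y - B v)"
      by (simp_all add: bounded_clinear_add[OF A] bounded_clinear_add[OF B] bounded_clinear_add[OF C]
          bounded_clinear_add[OF D] bounded_clinear_diff[OF A] bounded_clinear_diff[OF B]
          bounded_clinear_diff[OF C] bounded_clinear_diff[OF D])
    have regroup: "(a + \<epsilon> * (b + c) - c - L * d) + (a' + \<epsilon> * (b' + c') - c' - L * d')
        = (a + a') + \<epsilon> * ((b + b') + (c + c')) - (c + c') - L * (d + d')" for a b c d a' b' c' d' :: real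
      by (simp add: algebra_simps)
    show "q (x + y) (x' + y') (u + v) + q (x - y) (x' - y') (u - v) = 2 * q x x' u + 2 * q y y' v"
      unfolding q_def eqs regroup parallelogram_law by (simp only: distrib_left right_diff_distrib mult_ac)
  next
    \<comment> \<open>The direct transitions from \<open>x\<close> to 0 and from 0 to
      \<open>x\<close> are charged \<open>L * (norm (A x))\<^sup>2\<close> and
      \<open>L * (norm x)\<^sup>2\<close>; the constant \<open>L * (1 + (onorm A)\<^sup>2)\<close>
      covers both.\<close>
    fix x
    have A2: "(norm (A x))\<^sup>2 \<le> (onorm A)\<^sup>2 * (norm x)\<^sup>2"
      using power_mono[OF bounded_clinear_norm_le[OF A, of x] norm_ge_zero, of 2]
      by (simp add: power_mult_distrib)
    then have "L * (norm (A x))\<^sup>2 \<le> L * (1 + (onorm A)\<^sup>2) * (norm x)\<^sup>2"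
      unfolding mult.assoc using L by (intro mult_left_mono) (auto simp: distrib_right add_increasing)
    moreover have "q x 0 0 \<ge> - (L * (norm (A x))\<^sup>2)"
      using \<epsilon> by (simp add: q_def bounded_clinear_zero[OF B] bounded_clinear_zero[OF D])
    ultimately show "- (L * (1 + (onorm A)\<^sup>2)) * (norm x)\<^sup>2 \<le> q x 0 0"
      by simp
    have "L * (norm x)\<^sup>2 \<le> L * (1 + (onorm A)\<^sup>2) * (norm x)\<^sup>2"
      unfolding mult.assoc using L by (intro mult_left_mono) (auto simp: distrib_right)
    then show "- (L * (1 + (onorm A)\<^sup>2)) * (norm x)\<^sup>2 \<le> q 0 x 0"
      by (simp add: q_def bounded_clinear_zero[OF A] bounded_clinear_zero[OF B]
          bounded_clinear_zero[OF C] bounded_clinear_zero[OF D])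
  next
    fix N :: nat and X :: "nat \<Rightarrow> 'x" and U :: "nat \<Rightarrow> 'u"
    assume X: "X N = X 0"
    \<comment> \<open>The defect of the state equation acts as the disturbance; after the discrete
      Fourier transform each frequency \<open>k\<close> satisfies the stationary equation that
      \<open>freq\<close> requires.\<close>
    define w where "w n = X (Suc n) - A (X n) - B (U n)" for n
    define z where "z k = cis (2 * pi * real k / real N)" for k
    define x' where "x' k = (\<Sum>n<N. z k ^ n *\<^sub>C X n)" for k
    define u' where "u' k = (\<Sum>n<N. z k ^ n *\<^sub>C U n)" for k
    define w' where "w' k = (\<Sum>n<N. z k ^ n *\<^sub>C w n)" for k
    have zN: "z k ^ N = 1" if "0 < N" for k
    proof -
      have "real N * (2 * pi * real k / real N) = 2 * pi * real k"
        using that by simp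
      then show ?thesis
        unfolding z_def Complex.DeMoivre by (simp only: cis_multiple_2pi Ints_of_nat)
    qed
    have y': "C (x' k) + D (u' k) = (\<Sum>n<N. z k ^ n *\<^sub>C (C (X n) + D (U n)))" for k
      by (simp add: x'_def u'_def bounded_clinear_sum[OF C] bounded_clinear_sum[OF D]
          bounded_clinear_scaleC[OF C] bounded_clinear_scaleC[OF D] scaleC_add_right sum.distrib)
    \<comment> \<open>Cyclicity enters here: \<open>X N = X 0\<close> and \<open>z k ^ N = 1\<close>
      let the index shift wrap around, so it becomes multiplication by
      \<open>cnj (z k)\<close>.\<close>
    have shift: "cnj (z k) *\<^sub>C x' k = A (x' k) + B (u' k) + w' k" if N: "0 < N" for k
    proof -
      have cz: "cnj (z k) * z k = 1"
        by (simp add: z_def cis_cnj cis_mult)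
      obtain m where m: "N = Suc m"
        using N gr0_implies_Suc by blast
      have "x' k = X 0 + (\<Sum>n<m. z k ^ Suc n *\<^sub>C X (Suc n))"
        unfolding x'_def m by (subst sum.lessThan_Suc_shift) (simp add: scaleC_one)
      also have "X 0 = z k ^ Suc m *\<^sub>C X (Suc m)"
        using X zN[OF N, of k] by (simp add: m scaleC_one)
      finally have "x' k = (\<Sum>n<N. z k ^ Suc n *\<^sub>C X (Suc n))"
        by (simp add: m add.commute)
      then have "cnj (z k) *\<^sub>C x' k = (\<Sum>n<N. z k ^ n *\<^sub>C X (Suc n))"
        by (simp add: scaleC_sum_right scaleC_scaleC cz mult.assoc[symmetric])
      also have "\<dots> = A (x' k) + B (u' k) + w' k"
        by (simp add: x'_def u'_def w'_def w_def bounded_clinear_sum[OF A] bounded_clinear_sum[OF B]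
            bounded_clinear_scaleC[OF A] bounded_clinear_scaleC[OF B] scaleC_diff_right sum_subtractf)
      finally show ?thesis .
    qed
    have pars: "(\<Sum>k<N. (norm (x' k))\<^sup>2) = real N * (\<Sum>n<N. (norm (X n))\<^sup>2)"
      "(\<Sum>k<N. (norm (u' k))\<^sup>2) = real N * (\<Sum>n<N. (norm (U n))\<^sup>2)"
      "(\<Sum>k<N. (norm (w' k))\<^sup>2) = real N * (\<Sum>n<N. (norm (w n))\<^sup>2)"
      "(\<Sum>k<N. (norm (C (x' k) + D (u' k)))\<^sup>2) = real N * (\<Sum>n<N. (norm (C (X n) + D (U n)))\<^sup>2)"
      unfolding y' unfolding x'_def u'_def w'_def z_def by (rule discrete_parseval)+
    show "(\<Sum>n<N. q (X n) (X (Suc n)) (U n)) \<le> 0"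
    proof (cases "N = 0")
      case False
      then have N: "0 < N" by simp
      have "real N * (\<Sum>n<N. q (X n) (X (Suc n)) (U n)) = (\<Sum>k<N. (norm (C (x' k) + D (u' k)))\<^sup>2
          + \<epsilon> * ((norm (x' k))\<^sup>2 + (norm (u' k))\<^sup>2) - (norm (u' k))\<^sup>2 - L * (norm (w' k))\<^sup>2)"
        unfolding q_def w_def[symmetric]
        by (simp add: sum.distrib sum_subtractf sum_distrib_left[symmetric] pars algebra_simps)
      also have "\<dots> \<le> 0"
      proof (rule sum_nonpos)
        fix k assume "k \<in> {..<N}"
        have "cmod (cnj (z k)) = 1"
          by (simp add: z_def)
        from freq[OF this shift[OF N]]
        show "(norm (C (x' k) + D (u' k)))\<^sup>2 + \<epsilon> * ((norm (x' k))\<^sup>2 + (norm (u' k))\<^sup>2)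
            - (norm (u' k))\<^sup>2 - L * (norm (w' k))\<^sup>2 \<le> 0"
          by simp
      qed
      finally show ?thesis
        using N by (simp add: mult_le_0_iff)
    qed simp
  qed blast
  then obtain H where H: "selfadjoint H" "\<And>x x' u. q x x' u + rinner (H x') x' \<le> rinner (H x) x"
    by blast
  have "rinner (H (A x + B u)) (A x + B u) + (norm (C x + D u))\<^sup>2 + \<epsilon> * ((norm x)\<^sup>2 + (norm u)\<^sup>2)
      \<le> rinner (H x) x + (norm u)\<^sup>2" for x u
    using H(2)[of x "A x + B u" u] by (simp add: q_def)
  then have "strict_KYP A B C D H"
    unfolding strict_KYP_iff[OF A B C D] using \<epsilon> by blast
  then show ?thesis
    using H(1) by blast
qed

lemma strict_KYP_imp_strict_stein:
  assumes B: "bounded_clinear B" and C: "bounded_clinear C" and D: "bounded_clinear D"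
    and kyp: "strict_KYP A B C D H"
  obtains \<delta> where "0 < \<delta>" "\<And>x. rinner (H (A x)) (A x) + \<delta> * (norm x)\<^sup>2 \<le> rinner (H x) x"
proof -
  obtain \<delta> where \<delta>: "0 < \<delta>" and ineq: "\<And>x u.
    rinner (H (A x + B u)) (A x + B u) + (norm (C x + D u))\<^sup>2 + \<delta> * ((norm x)\<^sup>2 + (norm u)\<^sup>2)
      \<le> rinner (H x) x + (norm u)\<^sup>2"
    using kyp unfolding strict_KYP_iff[OF A B C D] by blast
  have "rinner (H (A x)) (A x) + \<delta> * (norm x)\<^sup>2 \<le> rinner (H x) x" for x
    using ineq[of x 0] zero_le_power2[of "norm (C x)"]
    unfolding bounded_clinear_zero[OF B] bounded_clinear_zero[OF D] add_0_right norm_zero zero_power2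
    by linarith
  then show ?thesis
    using \<delta> that by blast
qed

end

subsection \<open>Orthonormal bases and Hilbert dimension\<close>

lemma closure_cspan_subspace: "subspace (closure (cspan B) :: 'a::complex_hilbert set)"
proof -
  have sub: "subspace (cspan B)"
    by (auto simp: subspace_def scaleR_scaleC complex_vector.span_zero complex_vector.span_add
        complex_vector.span_scale)
  show ?thesis
  proof (rule subspaceI)
    show "0 \<in> closure (cspan B)"
      using closure_subset complex_vector.span_zero by blast
  next
    fix x y assume "x \<in> closure (cspan B)" "y \<in> closure (cspan B)"
    then obtain f g where "\<forall>n. f n \<in> cspan B" "f \<longlonglongrightarrow> x" "\<forall>n. g n \<in> cspan B" "g \<longlonglongrightarrow> y"
      by (auto simp: closure_sequential)
    then have "\<forall>n. f n + g n \<in> cspan B" "(\<lambda>n. f n + g n) \<longlonglongrightarrow> x + y"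
      by (auto intro: tendsto_add complex_vector.span_add)
    then show "x + y \<in> closure (cspan B)"
      unfolding closure_sequential by (intro exI conjI)
  next
    fix x :: 'a and c assume "x \<in> closure (cspan B)"
    then obtain f where "\<forall>n. f n \<in> cspan B" "f \<longlonglongrightarrow> x"
      by (auto simp: closure_sequential)
    then have "\<forall>n. c *\<^sub>R f n \<in> cspan B" "(\<lambda>n. c *\<^sub>R f n) \<longlonglongrightarrow> c *\<^sub>R x"
      using sub by (auto intro: tendsto_scaleR simp: subspace_mul)
    then show "c *\<^sub>R x \<in> closure (cspan B)"
      unfolding closure_sequential by (intro exI conjI)
  qed
qed

lemma continuous_on_cinner_left: "continuous_on S (\<lambda>x. cinner x (y::'a::complex_hilbert))"
proof -
  have "bounded_linear (\<lambda>x. cinner x y)"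
    by (rule bounded_linear_intro[where K = "norm y"])
      (auto simp: cinner_add_left scaleR_scaleC[where 'a='a] cinner_scaleC_left scaleR_conv_of_real cmod_cinner_le)
  then show ?thesis
    by (rule linear_continuous_on)
qed

lemma orthogonal_closure_cspan:
  assumes "\<And>b. b \<in> B \<Longrightarrow> cinner b y = 0" and "x \<in> closure (cspan B)"
  shows "cinner x (y::'a::complex_hilbert) = 0"
proof -
  have "complex_vector.subspace {x. cinner x y = 0}"
    by (auto simp: complex_vector.subspace_def cinner_add_left cinner_scaleC_left)
  then have "cspan B \<subseteq> {x. cinner x y = 0}"
    using assms(1) by (intro complex_vector.span_minimal) auto
  moreover have "closed {x. cinner x y = 0}"
    by (intro closed_Collect_eq continuous_on_cinner_left continuous_on_const)
  ultimately have "closure (cspan B) \<subseteq> {x. cinner x y = 0}"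
    by (rule closure_minimal)
  then show ?thesis
    using assms(2) by blast
qed

text \<open>A maximal orthonormal subset of \<open>V\<close> from Zorn's lemma; the normalized
  residual of a vector outside its closed span would enlarge it.\<close>

lemma orthonormal_basis_exists:
  fixes V :: "'a::complex_hilbert set"
  assumes V: "complex_vector.subspace V" "closed V"
  shows "\<exists>B. orthonormal_basis_of V B"
proof -
  define ON where "ON = {B. B \<subseteq> V \<and> (\<forall>b\<in>B. \<forall>c\<in>B. cinner b c = (if b = c then 1 else 0))}"
  have "\<exists>M\<in>ON. \<forall>X\<in>ON. M \<subseteq> X \<longrightarrow> X = M"
  proof (rule subset_Zorn')
    fix C assume C: "subset.chain ON C"
    have "cinner b c = (if b = c then 1 else 0)" if bc: "b \<in> \<Union>C" "c \<in> \<Union>C" for b c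
    proof -
      obtain X Y where XY: "b \<in> X" "X \<in> C" "c \<in> Y" "Y \<in> C"
        using bc by auto
      then have "X \<subseteq> Y \<or> Y \<subseteq> X"
        using C unfolding subset_chain_def by auto
      then obtain Z where "Z \<in> C" "b \<in> Z" "c \<in> Z"
        using XY by auto
      moreover from this have "Z \<in> ON"
        using C unfolding subset_chain_def by auto
      ultimately show ?thesis
        unfolding ON_def by auto
    qed
    moreover have "\<Union>C \<subseteq> V"
      using C unfolding subset_chain_def ON_def by auto
    ultimately show "\<Union>C \<in> ON"
      unfolding ON_def by blast
  qed
  then obtain B where B: "B \<in> ON" and max: "\<And>X. X \<in> ON \<Longrightarrow> B \<subseteq> X \<Longrightarrow> X = B"
    by blast
  have BV: "B \<subseteq> V" and orth: "\<And>b c. b \<in> B \<Longrightarrow> c \<in> B \<Longrightarrow> cinner b c = (if b = c then 1 else 0)"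
    using B by (auto simp: ON_def)
  have "closure (cspan B) = V"
  proof
    have "cspan B \<subseteq> V"
      using BV V(1) by (rule complex_vector.span_minimal)
    then show "closure (cspan B) \<subseteq> V"
      using V(2) by (rule closure_minimal)
    show "V \<subseteq> closure (cspan B)"
    proof
      fix x assume x: "x \<in> V"
      obtain p where p: "p \<in> closure (cspan B)" "\<And>v. v \<in> closure (cspan B) \<Longrightarrow> rinner (x - p) v = 0"
        using nearest_point_exists[OF closure_cspan_subspace, of B x] by auto
      define e where "e = x - p"
      have eV: "e \<in> V"
        unfolding e_def using V(1) x p(1) \<open>closure (cspan B) \<subseteq> V\<close>
        by (intro complex_vector.subspace_diff) auto
      have eb: "cinner e b = 0" if "b \<in> B" for b
      proof -
        \<comment> \<open>The projection theorem gives real orthogonality only, so both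
          \<open>b\<close> and \<open>\<i> *\<^sub>C b\<close> are tested.\<close>
        have "b \<in> closure (cspan B)" "\<i> *\<^sub>C b \<in> closure (cspan B)"
          using that by (auto intro!: subsetD[OF closure_subset] complex_vector.span_scale
              intro: complex_vector.span_base)
        then show ?thesis
          using p(2) by (simp add: cinner_conv_rinner e_def Complex_eq_0)
      qed
      have "e = 0"
      proof (rule ccontr)
        assume e: "e \<noteq> 0"
        define e' where "e' = complex_of_real (1 / norm e) *\<^sub>C e"
        have e'b: "cinner e' b = 0" "cinner b e' = 0" if "b \<in> B" for b
          using eb[OF that] cinner_eq_zero_commute[of e b]
          by (simp_all add: e'_def cinner_scaleC_left cinner_scaleC_right)
        have e'e': "cinner e' e' = 1"
        proof -
          have "norm e' = 1"
            using e by (simp add: e'_def norm_scaleC norm_divide)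
          then show ?thesis
            by (simp add: cinner_self)
        qed
        have "insert e' B \<in> ON"
          unfolding ON_def
        proof (intro CollectI conjI ballI)
          show "insert e' B \<subseteq> V"
            using BV V(1) eV by (auto simp: e'_def complex_vector.subspace_scale)
          show "cinner b c = (if b = c then 1 else 0)" if "b \<in> insert e' B" "c \<in> insert e' B" for b c
            using that e'b e'e' orth by auto
        qed
        then have "e' \<in> B"
          using max[of "insert e' B"] by blast
        then show False
          using e'b e'e' by force
      qed
      then show "x \<in> closure (cspan B)"
        using p(1) by (simp add: e_def)
    qed
  qed
  then show ?thesis
    using orth unfolding orthonormal_basis_of_def by blast
qed

section \<open>Bessel's inequality and the cardinality of orthonormal bases\<close>

lemma bessel_residual:
  fixes y :: "'a::complex_hilbert"
  assumes "finite F" and orth: "\<And>b c. b \<in> F \<Longrightarrow> c \<in> F \<Longrightarrow> cinner b c = (if b = c then 1 else 0)"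
    and "c \<in> F"
  shows "cinner (y - (\<Sum>b\<in>F. cinner y b *\<^sub>C b)) c = 0"
proof -
  have "(\<Sum>b\<in>F. cinner y b * cinner b c) = (\<Sum>b\<in>F. if b = c then cinner y c else 0)"
    using assms by (intro sum.cong) auto
  then show ?thesis
    using assms by (simp add: cinner_diff_left cinner_sum_left cinner_scaleC_left)
qed

lemma bessel_inequality:
  fixes y :: "'a::complex_hilbert"
  assumes F: "finite F" and orth: "\<And>b c. b \<in> F \<Longrightarrow> c \<in> F \<Longrightarrow> cinner b c = (if b = c then 1 else 0)"
  shows "(\<Sum>b\<in>F. (cmod (cinner y b))\<^sup>2) \<le> (norm y)\<^sup>2"
proof -
  define p where "p = (\<Sum>b\<in>F. cinner y b *\<^sub>C b)"
  have sq: "cinner v p = (\<Sum>b\<in>F. cnj (cinner y b) * cinner v b)" for v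
    by (simp add: p_def cinner_sum_right cinner_scaleC_right)
  have "cinner (y - p) p = 0"
    unfolding sq using bessel_residual[OF F orth] by (simp add: p_def)
  then have "cinner p p = cinner y p"
    by (simp add: cinner_diff_left)
  also have "\<dots> = complex_of_real (\<Sum>b\<in>F. (cmod (cinner y b))\<^sup>2)"
    unfolding sq by (simp add: complex_norm_square mult.commute del: of_real_power)
  finally have "(norm p)\<^sup>2 = (\<Sum>b\<in>F. (cmod (cinner y b))\<^sup>2)"
    by (simp only: cinner_self of_real_eq_iff)
  moreover have "rinner y p = (norm p)\<^sup>2"
    unfolding rinner_self[symmetric] rinner_def using \<open>cinner p p = cinner y p\<close> by simp
  ultimately show ?thesis
    using norm_diff_sq[of y p] zero_le_power2[of "norm (y - p)"] by linarith
qed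

text \<open>By Bessel's inequality only finitely many \<open>b\<close> have a squared coefficient
  above \<open>1 / Suc n\<close>.\<close>

lemma countable_nonorthogonal:
  fixes y :: "'a::complex_hilbert"
  assumes orth: "\<And>b c. b \<in> B \<Longrightarrow> c \<in> B \<Longrightarrow> cinner b c = (if b = c then 1 else 0)"
  shows "countable {b \<in> B. cinner b y \<noteq> 0}"
proof -
  define S where "S n = {b \<in> B. 1 / real (Suc n) < (cmod (cinner y b))\<^sup>2}" for n
  have "finite (S n)" for n
  proof -
    have "card F \<le> nat \<lfloor>real (Suc n) * (norm y)\<^sup>2\<rfloor>" if F: "F \<subseteq> S n" "finite F" for F
    proof -
      have "real (card F) * (1 / real (Suc n)) = (\<Sum>b\<in>F. 1 / real (Suc n))"
        by simp
      also have "\<dots> \<le> (\<Sum>b\<in>F. (cmod (cinner y b))\<^sup>2)"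
        using F(1) by (intro sum_mono) (auto simp: S_def less_imp_le)
      also have "\<dots> \<le> (norm y)\<^sup>2"
      proof (rule bessel_inequality[OF F(2)])
        fix b c assume "b \<in> F" "c \<in> F"
        then show "cinner b c = (if b = c then 1 else 0)"
          using F(1) by (intro orth) (auto simp: S_def)
      qed
      finally have "real (card F) \<le> real (Suc n) * (norm y)\<^sup>2"
        by (simp add: field_simps)
      then show ?thesis
        by linarith
    qed
    then show ?thesis
      using finite_if_finite_subsets_card_bdd by blast
  qed
  moreover have "{b \<in> B. cinner b y \<noteq> 0} \<subseteq> (\<Union>n. S n)"
  proof
    fix b assume b: "b \<in> {b \<in> B. cinner b y \<noteq> 0}"
    then have "0 < (cmod (cinner y b))\<^sup>2"
      using cinner_eq_zero_commute[of b y] by simp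
    then obtain n where "1 / real (Suc n) < (cmod (cinner y b))\<^sup>2"
      using nat_approx_posE by blast
    then show "b \<in> (\<Union>n. S n)"
      using b by (auto simp: S_def)
  qed
  moreover have "countable (\<Union>n. S n)"
    by (rule countable_UN) (simp_all add: countable_finite \<open>\<And>n. finite (S n)\<close>)
  ultimately show ?thesis
    by (simp add: countable_subset)
qed

lemma finite_orthonormal_basis_span:
  assumes B: "orthonormal_basis_of V B" "finite B" and x: "x \<in> V"
  shows "x \<in> cspan B"
proof -
  have orth: "\<And>b c. b \<in> B \<Longrightarrow> c \<in> B \<Longrightarrow> cinner b c = (if b = c then 1 else 0)"
    and V: "closure (cspan B) = V"
    using B(1) by (auto simp: orthonormal_basis_of_def)
  define p where "p = (\<Sum>b\<in>B. cinner x b *\<^sub>C b)"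
  have p: "p \<in> cspan B"
    unfolding p_def by (intro complex_vector.span_sum complex_vector.span_scale complex_vector.span_base)
  have "cinner b (x - p) = 0" if "b \<in> B" for b
    using bessel_residual[OF B(2) orth that, of x] cinner_eq_zero_commute unfolding p_def by blast
  moreover have "x - p \<in> closure (cspan B)"
    using x p closure_subset[of "cspan B"] closure_cspan_subspace V by (intro subspace_diff) auto
  ultimately have "cinner (x - p) (x - p) = 0"
    by (rule orthogonal_closure_cspan)
  then have "x = p"
    by (simp add: cinner_self)
  then show ?thesis
    using p by simp
qed

text \<open>For finite \<open>BW\<close> this is linear algebra: \<open>T\<close> keeps finite
  subsets of \<open>BV\<close> independent inside the span of \<open>BW\<close>. For infinite
  \<open>BW\<close>, every \<open>b\<close> has \<open>T b\<close> non-orthogonal to some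
  \<open>c\<close> in \<open>BW\<close>, each \<open>c\<close> accounts for countably many
  \<open>b\<close>, and countable multiples do not enlarge an infinite cardinal.\<close>

lemma orthonormal_basis_card_le:
  fixes T :: "'a::complex_hilbert \<Rightarrow> 'a"
  assumes BV: "orthonormal_basis_of V BV" and BW: "orthonormal_basis_of W BW"
    and T: "bounded_clinear T" and TV: "\<And>v. v \<in> V \<Longrightarrow> T v \<in> W" and inj: "\<And>v. v \<in> V \<Longrightarrow> T v = 0 \<Longrightarrow> v = 0"
  shows "|BV| \<le>o |BW|"
proof -
  have orth: "\<And>b c. b \<in> BV \<Longrightarrow> c \<in> BV \<Longrightarrow> cinner b c = (if b = c then 1 else 0)"
    and V: "closure (cspan BV) = V" and W: "closure (cspan BW) = W"
    using BV BW by (auto simp: orthonormal_basis_of_def)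
  have spanV: "cspan BV \<subseteq> V"
    using V closure_subset by blast
  have BVV: "b \<in> V" if "b \<in> BV" for b
    using spanV that complex_vector.span_base by blast
  show ?thesis
  proof (cases "finite BW")
    case True
    have fin: "card F \<le> card BW" if F: "F \<subseteq> BV" "finite F" for F
    proof -
      have zero: "u b = 0" if s: "(\<Sum>b\<in>F. u b *\<^sub>C T b) = 0" and b: "b \<in> F" for u b
      proof -
        have "(\<Sum>b\<in>F. u b *\<^sub>C b) \<in> V"
          using F(1) by (intro subsetD[OF spanV] complex_vector.span_sum complex_vector.span_scale
              complex_vector.span_base) auto
        moreover have "T (\<Sum>b\<in>F. u b *\<^sub>C b) = 0"
          using s by (simp add: bounded_clinear_sum[OF T] bounded_clinear_scaleC[OF T])
        ultimately have "(\<Sum>b\<in>F. u b *\<^sub>C b) = 0"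
          by (rule inj)
        then have "(\<Sum>c\<in>F. u c * cinner c b) = 0"
          using cinner_sum_left[of "\<lambda>b. u b *\<^sub>C b" F b] by (simp add: cinner_scaleC_left)
        moreover have "(\<Sum>c\<in>F. u c * cinner c b) = (\<Sum>c\<in>F. if c = b then u b else 0)"
        proof (rule sum.cong[OF refl])
          fix c assume "c \<in> F"
          then have "cinner c b = (if c = b then 1 else 0)"
            using F(1) b by (intro orth) auto
          then show "u c * cinner c b = (if c = b then u b else 0)"
            by simp
        qed
        ultimately show ?thesis
          using b F(2) by simp
      qed
      \<comment> \<open>If \<open>T\<close> identified two basis vectors, the coefficients 1 and -1
        would contradict \<open>zero\<close>. This permits reindexing sums over the image of
        \<open>F\<close> as sums over \<open>F\<close>.\<close>
      have injF: "inj_on T F"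
      proof (rule inj_onI, rule ccontr)
        fix b c assume bc: "b \<in> F" "c \<in> F" "T b = T c" "b \<noteq> c"
        have "(\<Sum>d\<in>F. (if d = b then 1 else if d = c then - 1 else 0) *\<^sub>C T d)
            = (\<Sum>d\<in>{b, c}. (if d = b then 1 else if d = c then - 1 else 0) *\<^sub>C T d)"
          using bc F(2) by (intro sum.mono_neutral_right) auto
        also have "\<dots> = 0"
          using bc by (simp add: scaleC_minus_left scaleC_one)
        finally show False
          using zero[OF _ bc(1)] by fastforce
      qed
      have "\<not> complex_vector.dependent (T ` F)"
      proof
        assume "complex_vector.dependent (T ` F)"
        then obtain u v where uv: "v \<in> T ` F" "u v \<noteq> 0" "(\<Sum>v\<in>T ` F. u v *\<^sub>C v) = 0"
          using complex_vector.dependent_finite[of "T ` F"] F(2) by auto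
        then have "(\<Sum>b\<in>F. u (T b) *\<^sub>C T b) = 0"
          using sum.reindex[OF injF, of "\<lambda>v. u v *\<^sub>C v"] by (simp add: o_def)
        then show False
          using zero[of "\<lambda>b. u (T b)"] uv by auto
      qed
      moreover have "T ` F \<subseteq> cspan BW"
        using F(1) BVV TV finite_orthonormal_basis_span[OF BW True] by blast
      ultimately have "card (T ` F) \<le> card BW"
        using complex_vector.independent_span_bound[OF True] by blast
      then show ?thesis
        by (simp add: card_image[OF injF])
    qed
    then have "finite BV \<and> card BV \<le> card BW"
      by (rule finite_if_finite_subsets_card_bdd)
    then show ?thesis
      using True inj_on_iff_card_le[of BV BW] card_of_ordLeq[of BV BW] by blast
  next
    case False
    have "BV \<subseteq> (\<Union>c\<in>BW. {b \<in> BV. cinner b (cadjoint T c) \<noteq> 0})"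
    proof
      fix b assume b: "b \<in> BV"
      have "T b \<noteq> 0"
        using inj[OF BVV[OF b]] orth[OF b b] by auto
      have "\<exists>c\<in>BW. cinner (T b) c \<noteq> 0"
      proof (rule ccontr)
        assume "\<not> (\<exists>c\<in>BW. cinner (T b) c \<noteq> 0)"
        then have "cinner c (T b) = 0" if "c \<in> BW" for c
          using cinner_eq_zero_commute[of "T b" c] that by auto
        moreover have "T b \<in> closure (cspan BW)"
          unfolding W by (rule TV[OF BVV[OF b]])
        ultimately have "cinner (T b) (T b) = 0"
          by (rule orthogonal_closure_cspan)
        then show False
          using \<open>T b \<noteq> 0\<close> by (simp add: cinner_self)
      qed
      then show "b \<in> (\<Union>c\<in>BW. {b \<in> BV. cinner b (cadjoint T c) \<noteq> 0})"
        using b by (simp add: cinner_cadjoint[OF T])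
    qed
    then have "|BV| \<le>o |\<Union>c\<in>BW. {b \<in> BV. cinner b (cadjoint T c) \<noteq> 0}|"
      by (rule card_of_mono1)
    also have "|\<Union>c\<in>BW. {b \<in> BV. cinner b (cadjoint T c) \<noteq> 0}| \<le>o |BW|"
    proof (rule card_of_UNION_ordLeq_infinite[OF False])
      show "|BW| \<le>o |BW|"
        by (rule card_of_mono1) simp
      have nat: "|UNIV :: nat set| \<le>o |BW|"
        using False infinite_iff_card_of_nat by blast
      have "|{b \<in> BV. cinner b (cadjoint T c) \<noteq> 0}| \<le>o |UNIV :: nat set|" for c
        using countable_nonorthogonal[OF orth, of BV "cadjoint T c"]
        unfolding countable_def card_of_ordLeq[symmetric] by auto
      then show "\<forall>c\<in>BW. |{b \<in> BV. cinner b (cadjoint T c) \<noteq> 0}| \<le>o |BW|"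
        by (intro ballI) (rule ordLeq_transitive[OF _ nat])
    qed
    finally show ?thesis .
  qed
qed

text \<open>\<open>hilbert_dim\<close> picks an arbitrary basis, so cardinalities of any two bases
  are compared; the injections in both directions then give equality by antisymmetry of the cardinal
  order.\<close>

lemma hilbert_dim_eqI:
  fixes S T :: "'a::complex_hilbert \<Rightarrow> 'a"
  assumes V: "complex_vector.subspace V" "closed V" and W: "complex_vector.subspace W" "closed W"
    and T: "bounded_clinear T" "\<And>v. v \<in> V \<Longrightarrow> T v \<in> W" "\<And>v. v \<in> V \<Longrightarrow> T v = 0 \<Longrightarrow> v = 0"
    and S: "bounded_clinear S" "\<And>w. w \<in> W \<Longrightarrow> S w \<in> V" "\<And>w. w \<in> W \<Longrightarrow> S w = 0 \<Longrightarrow> w = 0"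
  shows "hilbert_dim V =o hilbert_dim W"
proof -
  have BV: "orthonormal_basis_of V (SOME B. orthonormal_basis_of V B)"
    by (rule someI_ex[OF orthonormal_basis_exists[OF V]])
  have BW: "orthonormal_basis_of W (SOME B. orthonormal_basis_of W B)"
    by (rule someI_ex[OF orthonormal_basis_exists[OF W]])
  show ?thesis
    unfolding hilbert_dim_def ordIso_iff_ordLeq
    using orthonormal_basis_card_le[OF BV BW T] orthonormal_basis_card_le[OF BW BV S] by blast
qed

lemma range_idempotent:
  assumes P: "bounded_clinear P" and idem: "\<And>x. P (P x) = P x"
  shows "range P = {x. P x = x}" "complex_vector.subspace (range P)" "closed (range P)"
proof -
  show eq: "range P = {x. P x = x}"
    using idem by auto (metis rangeI)
  show "complex_vector.subspace (range P)"
    unfolding eq by (auto simp: complex_vector.subspace_def bounded_clinearD[OF P])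
  show "closed (range P)"
    unfolding eq
    by (intro closed_Collect_eq linear_continuous_on bounded_clinear_imp_bounded_linear[OF P]
        continuous_on_id)
qed

subsection \<open>Measures on a compact interval and their moments\<close>

text \<open>The compact support is imposed almost everywhere, on Borel measures of the whole line,
  so that these measures can be equated with \<open>scalar_measure\<close>.\<close>

definition supported :: "real \<Rightarrow> real measure \<Rightarrow> bool" where
  "supported M \<mu> \<longleftrightarrow> finite_measure \<mu> \<and> sets \<mu> = sets borel \<and> (AE t in \<mu>. \<bar>t\<bar> \<le> M)"

lemma supportedD:
  assumes "supported M \<mu>"
  shows "finite_measure \<mu>" "sets \<mu> = sets borel" "space \<mu> = UNIV" "AE t in \<mu>. \<bar>t\<bar> \<le> M"
  using assms sets_eq_imp_space_eq[of \<mu> borel] by (auto simp: supported_def)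

lemma supported_integrable:
  assumes \<mu>: "supported M \<mu>" and f: "continuous_on UNIV (f :: real \<Rightarrow> real)"
  shows "integrable \<mu> f"
proof -
  have "compact (f ` {-M..M})"
    by (intro compact_continuous_image continuous_on_subset[OF f]) auto
  then obtain B where B: "\<And>t. t \<in> {-M..M} \<Longrightarrow> norm (f t) \<le> B"
    using compact_imp_bounded bounded_iff by (metis imageI)
  have "AE t in \<mu>. norm (f t) \<le> B"
    using supportedD(4)[OF \<mu>]
  proof eventually_elim
    case (elim t)
    then show ?case
      using B[of t] by (simp add: abs_le_iff)
  qed
  moreover have "f \<in> borel_measurable \<mu>"
    using borel_measurable_continuous_onI[OF f] supportedD(2)[OF \<mu>]
    by (simp cong: measurable_cong_sets)
  ultimately show ?thesis
    by (intro finite_measure.integrable_const_bound[OF supportedD(1)[OF \<mu>]])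
qed

text \<open>Reweighting stays inside the class, so the uniqueness from moments below also applies to
  measures with squared polynomials or indicators as densities.\<close>

lemma supported_density:
  assumes \<mu>: "supported M \<mu>" and g: "g \<in> borel_measurable borel" "integrable \<mu> g" "\<And>t. 0 \<le> g t"
  shows "supported M (density \<mu> (\<lambda>t. ennreal (g t)))"
    and "S \<in> sets borel \<Longrightarrow> measure (density \<mu> (\<lambda>t. ennreal (g t))) S = (\<integral>t. g t * indicator S t \<partial>\<mu>)"
    and "f \<in> borel_measurable borel \<Longrightarrow> integral\<^sup>L (density \<mu> (\<lambda>t. ennreal (g t))) f = (\<integral>t. g t * f t \<partial>\<mu>)"
proof -
  note s = supportedD[OF \<mu>]
  have gm: "g \<in> borel_measurable \<mu>"
    using g(1) s(2) by (simp cong: measurable_cong_sets)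
  have em: "emeasure (density \<mu> (\<lambda>t. ennreal (g t))) S = ennreal (\<integral>t. g t * indicator S t \<partial>\<mu>)"
    if S: "S \<in> sets borel" for S
  proof -
    have "S \<in> sets \<mu>"
      using S s(2) by simp
    then have int: "integrable \<mu> (\<lambda>t. g t * indicator S t)"
      using g(2) by (rule integrable_real_mult_indicator)
    have "emeasure (density \<mu> (\<lambda>t. ennreal (g t))) S = (\<integral>\<^sup>+t. ennreal (g t) * indicator S t \<partial>\<mu>)"
      using gm \<open>S \<in> sets \<mu>\<close> by (subst emeasure_density) auto
    also have "\<dots> = (\<integral>\<^sup>+t. ennreal (g t * indicator S t) \<partial>\<mu>)"
      by (intro nn_integral_cong) (auto split: split_indicator)
    also have "\<dots> = ennreal (\<integral>t. g t * indicator S t \<partial>\<mu>)"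
      using int g(3) by (intro nn_integral_eq_integral) auto
    finally show ?thesis .
  qed
  show "measure (density \<mu> (\<lambda>t. ennreal (g t))) S = (\<integral>t. g t * indicator S t \<partial>\<mu>)"
    if "S \<in> sets borel"
    unfolding measure_def em[OF that] using g(3)
    by (intro enn2real_ennreal integral_nonneg_AE) auto
  have "emeasure (density \<mu> (\<lambda>t. ennreal (g t))) UNIV \<noteq> \<infinity>"
    using em[of UNIV] by simp
  then have "finite_measure (density \<mu> (\<lambda>t. ennreal (g t)))"
    using s(3) by (intro finite_measureI) simp
  moreover have "AE t in density \<mu> (\<lambda>t. ennreal (g t)). \<bar>t\<bar> \<le> M"
    using s(4) gm by (subst AE_density) auto
  ultimately show "supported M (density \<mu> (\<lambda>t. ennreal (g t)))"
    using s(2) by (simp add: supported_def)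
  show "integral\<^sup>L (density \<mu> (\<lambda>t. ennreal (g t))) f = (\<integral>t. g t * f t \<partial>\<mu>)"
    if "f \<in> borel_measurable borel"
  proof -
    have "f \<in> borel_measurable \<mu>"
      using that s(2) by (simp cong: measurable_cong_sets)
    then show ?thesis
      using gm g(3) by (subst integral_density) auto
  qed
qed

text \<open>Weierstrass approximation passes from moments to continuous functions, ramps lead to
  half-lines, and Dynkin's theorem to Borel sets. Finite combinations with real coefficients stand
  in for signed measures, so that linear identities between several scalar measures can be proved in
  one go.\<close>

lemma signed_moments_unique:
  fixes \<mu> :: "'i \<Rightarrow> real measure" and c :: "'i \<Rightarrow> real"
  assumes I: "finite I" and \<mu>: "\<And>i. i \<in> I \<Longrightarrow> supported M (\<mu> i)"
    and mom: "\<And>n. (\<Sum>i\<in>I. c i * (\<integral>t. t ^ n \<partial>\<mu> i)) = 0"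
    and S: "S \<in> sets borel"
  shows "(\<Sum>i\<in>I. c i * measure (\<mu> i) S) = 0"
proof -
  have cont: "(\<Sum>i\<in>I. c i * (\<integral>t. f t \<partial>\<mu> i)) = 0" if f: "continuous_on UNIV f" for f :: "real \<Rightarrow> real"
  proof (rule ccontr)
    define A where "A = \<bar>\<Sum>i\<in>I. c i * (\<integral>t. f t \<partial>\<mu> i)\<bar>"
    define K where "K = (\<Sum>i\<in>I. \<bar>c i\<bar> * measure (\<mu> i) UNIV)"
    assume "(\<Sum>i\<in>I. c i * (\<integral>t. f t \<partial>\<mu> i)) \<noteq> 0"
    then have A: "0 < A"
      by (simp add: A_def)
    have K: "0 \<le> K"
      unfolding K_def by (intro sum_nonneg) simp
    \<comment> \<open>Small enough that the error \<open>e * K\<close> stays below \<open>A\<close>;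
      the added 1 covers \<open>K = 0\<close>.\<close>
    define e where "e = A / (2 * (K + 1))"
    have e: "0 < e"
      using A K by (simp add: e_def)
    have "continuous_on {-M..M} f"
      by (rule continuous_on_subset[OF f]) simp
    then obtain g where g: "real_polynomial_function g" "\<And>t. t \<in> {-M..M} \<Longrightarrow> \<bar>f t - g t\<bar> < e"
      using Stone_Weierstrass_real_polynomial_function[of "{-M..M}" f e] e by auto
    obtain a n where gsum: "g = (\<lambda>t. \<Sum>k\<le>n. a k * t ^ k)"
      using g(1) real_polynomial_function_iff_sum by blast
    have gc: "continuous_on UNIV g"
      unfolding gsum by (intro continuous_intros)
    have gint: "(\<integral>t. g t \<partial>\<mu> i) = (\<Sum>k\<le>n. a k * (\<integral>t. t ^ k \<partial>\<mu> i))" if "i \<in> I" for i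
    proof -
      have "integrable (\<mu> i) (\<lambda>t. a k * t ^ k)" for k
        by (intro supported_integrable[OF \<mu>[OF that]] continuous_intros)
      then show ?thesis
        unfolding gsum by (subst Bochner_Integration.integral_sum) simp_all
    qed
    have "(\<Sum>i\<in>I. c i * (\<integral>t. g t \<partial>\<mu> i)) = (\<Sum>i\<in>I. \<Sum>k\<le>n. a k * (c i * (\<integral>t. t ^ k \<partial>\<mu> i)))"
      by (intro sum.cong refl) (simp add: gint sum_distrib_left mult_ac)
    also have "\<dots> = (\<Sum>k\<le>n. a k * (\<Sum>i\<in>I. c i * (\<integral>t. t ^ k \<partial>\<mu> i)))"
      by (subst sum.swap) (simp add: sum_distrib_left)
    also have "\<dots> = 0"
      by (simp add: mom)
    finally have g0: "(\<Sum>i\<in>I. c i * (\<integral>t. g t \<partial>\<mu> i)) = 0" .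
    have diff: "\<bar>(\<integral>t. f t \<partial>\<mu> i) - (\<integral>t. g t \<partial>\<mu> i)\<bar> \<le> e * measure (\<mu> i) UNIV" if i: "i \<in> I" for i
    proof -
      interpret finite_measure "\<mu> i"
        using supportedD(1)[OF \<mu>[OF i]] .
      have ints: "integrable (\<mu> i) f" "integrable (\<mu> i) g"
        using supported_integrable[OF \<mu>[OF i]] f gc by auto
      have "AE t in \<mu> i. norm (f t - g t) \<le> e"
        using supportedD(4)[OF \<mu>[OF i]]
      proof eventually_elim
        case (elim t)
        then show ?case
          using g(2)[of t] by (simp add: abs_le_iff less_imp_le)
      qed
      then have "(\<integral>t. norm (f t - g t) \<partial>\<mu> i) \<le> (\<integral>t. e \<partial>\<mu> i)"
        using ints by (intro integral_mono_AE integrable_norm Bochner_Integration.integrable_diff) auto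
      then have "norm (\<integral>t. f t - g t \<partial>\<mu> i) \<le> (\<integral>t. e \<partial>\<mu> i)"
        using integral_norm_bound[of "\<mu> i" "\<lambda>t. f t - g t"] by linarith
      then show ?thesis
        using ints supportedD(3)[OF \<mu>[OF i]] by (simp add: mult.commute)
    qed
    have "A = \<bar>\<Sum>i\<in>I. c i * ((\<integral>t. f t \<partial>\<mu> i) - (\<integral>t. g t \<partial>\<mu> i))\<bar>"
      using g0 by (simp add: A_def right_diff_distrib sum_subtractf)
    also have "\<dots> \<le> (\<Sum>i\<in>I. \<bar>c i\<bar> * (e * measure (\<mu> i) UNIV))"
      by (rule order_trans[OF sum_abs]) (auto simp: abs_mult intro!: sum_mono mult_left_mono diff)
    also have "\<dots> = e * K"
      by (simp add: K_def sum_distrib_left mult_ac)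
    also have "\<dots> \<le> A / 2"
      using A K by (simp add: e_def field_simps)
    finally show False
      using A by simp
  qed
  have half: "(\<Sum>i\<in>I. c i * measure (\<mu> i) {..a}) = 0" for a
  proof -
    \<comment> \<open>For \<open>k > 0\<close> a ramp that falls from 1 at \<open>a\<close> to 0 at
      \<open>a + 1 / k\<close>.\<close>
    define f where "f k t = max 0 (min 1 (1 - real k * (t - a)))" for k :: nat and t :: real
    have fc: "continuous_on UNIV (f k)" for k
      unfolding f_def by (intro continuous_intros)
    have flim: "(\<lambda>k. f k t) \<longlonglongrightarrow> indicator {..a} t" for t
    proof (cases "t \<le> a")
      case True
      then have "f k t = 1" for k
        by (simp add: f_def mult_nonneg_nonpos min_def max_def)
      then show ?thesis
        using True by simp
    next
      case False
      then obtain N where N: "1 / (t - a) < real N"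
        using reals_Archimedean2 by blast
      have "f k t = 0" if "k \<ge> N" for k
      proof -
        have "1 / (t - a) < real k"
          using N that by (meson less_le_trans of_nat_le_iff)
        then have "1 < real k * (t - a)"
          using False by (simp add: field_simps)
        then show ?thesis
          by (simp add: f_def)
      qed
      then have "(\<lambda>k. f k t) \<longlonglongrightarrow> 0"
        by (intro tendsto_eventually) (auto simp: eventually_sequentially)
      then show ?thesis
        using False by simp
    qed
    have "(\<lambda>k. \<Sum>i\<in>I. c i * (\<integral>t. f k t \<partial>\<mu> i)) \<longlonglongrightarrow> (\<Sum>i\<in>I. c i * measure (\<mu> i) {..a})"
    proof (intro tendsto_sum tendsto_mult_left)
      fix i assume i: "i \<in> I"
      interpret finite_measure "\<mu> i"
        using supportedD(1)[OF \<mu>[OF i]] .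
      note s = supportedD(2,3)[OF \<mu>[OF i]]
      have "(\<lambda>k. \<integral>t. f k t \<partial>\<mu> i) \<longlonglongrightarrow> (\<integral>t. indicator {..a} t \<partial>\<mu> i)"
      proof (rule integral_dominated_convergence[where w = "\<lambda>_. 1"])
        show "f k \<in> borel_measurable (\<mu> i)" for k
          using borel_measurable_continuous_onI[OF fc] s(1) by (simp cong: measurable_cong_sets)
        show "(indicator {..a} :: real \<Rightarrow> real) \<in> borel_measurable (\<mu> i)"
          by (intro borel_measurable_indicator) (simp add: s(1))
        show "AE t in \<mu> i. (\<lambda>k. f k t) \<longlonglongrightarrow> indicator {..a} t"
          by (simp add: flim)
      qed (auto simp: f_def)
      then show "(\<lambda>k. \<integral>t. f k t \<partial>\<mu> i) \<longlonglongrightarrow> measure (\<mu> i) {..a}"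
        using s by simp
    qed
    moreover have "(\<lambda>k. \<Sum>i\<in>I. c i * (\<integral>t. f k t \<partial>\<mu> i)) = (\<lambda>_. 0)"
      using cont[OF fc] by simp
    ultimately show ?thesis
      by (simp add: LIMSEQ_const_iff)
  qed
  have whole: "(\<Sum>i\<in>I. c i * measure (\<mu> i) UNIV) = 0"
  proof -
    have "(\<integral>t. t ^ 0 \<partial>\<mu> i) = measure (\<mu> i) UNIV" if "i \<in> I" for i
      using supportedD(3)[OF \<mu>[OF that]] by simp
    then show ?thesis
      using mom[of 0] by simp
  qed
  have "Int_stable (range (\<lambda>a::real. {..a}))" "range (\<lambda>a::real. {..a}) \<subseteq> Pow UNIV"
    by (auto simp: Int_stable_def)
  moreover have "S \<in> sigma_sets UNIV (range (\<lambda>a::real. {..a}))"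
    using S by (simp add: borel_eq_atMost)
  ultimately show ?thesis
  proof (induction rule: sigma_sets_induct_disjoint)
    case (basic A)
    then show ?case using half by auto
  next
    case (compl A)
    then have "A \<in> sets borel"
      by (simp add: borel_eq_atMost)
    then have "measure (\<mu> i) (UNIV - A) = measure (\<mu> i) UNIV - measure (\<mu> i) A" if "i \<in> I" for i
      using finite_measure.finite_measure_compl[OF supportedD(1)[OF \<mu>[OF that]], of A]
        supportedD(2,3)[OF \<mu>[OF that]] by simp
    then have "(\<Sum>i\<in>I. c i * measure (\<mu> i) (UNIV - A))
        = (\<Sum>i\<in>I. c i * measure (\<mu> i) UNIV) - (\<Sum>i\<in>I. c i * measure (\<mu> i) A)"
      by (simp add: right_diff_distrib sum_subtractf)
    then show ?case
      using compl whole by simp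
  next
    case (union A)
    then have A: "range A \<subseteq> sets borel"
      by (auto simp: borel_eq_atMost)
    have "(\<lambda>n. \<Sum>i\<in>I. c i * measure (\<mu> i) (A n)) sums (\<Sum>i\<in>I. c i * measure (\<mu> i) (\<Union>n. A n))"
      using A union(1) supportedD(1,2)[OF \<mu>]
      by (intro sums_sum sums_mult finite_measure.finite_measure_UNION) auto
    then have "(\<lambda>n. 0) sums (\<Sum>i\<in>I. c i * measure (\<mu> i) (\<Union>n. A n))"
      by (simp only: union)
    then show ?case
      by (rule sums_unique2[OF _ sums_zero])
  qed auto
qed

text \<open>The form used in the applications: an explicit short list of measures, which
  simplification unfolds into a plain equation.\<close>

lemma signed_moments_unique_list:
  assumes \<mu>: "\<And>c \<mu>. (c, \<mu>) \<in> set xs \<Longrightarrow> supported M \<mu>"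
    and mom: "\<And>n. (\<Sum>(c, \<mu>)\<leftarrow>xs. c * (\<integral>t. t ^ n \<partial>\<mu>)) = 0"
    and S: "S \<in> sets borel"
  shows "(\<Sum>(c, \<mu>)\<leftarrow>xs. c * measure \<mu> S) = 0"
proof -
  have conv: "(\<Sum>(c, \<mu>)\<leftarrow>xs. c * F \<mu>) = (\<Sum>i<length xs. fst (xs ! i) * F (snd (xs ! i)))" for F
    by (simp add: sum_list_sum_nth lessThan_atLeast0 case_prod_beta)
  have "(\<Sum>i<length xs. fst (xs ! i) * measure (snd (xs ! i)) S) = 0"
  proof (rule signed_moments_unique[OF _ _ _ S])
    show "supported M (snd (xs ! i))" if "i \<in> {..<length xs}" for i
      using that nth_mem[of i xs] by (intro \<mu>[of "fst (xs ! i)"]) simp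
    show "(\<Sum>i<length xs. fst (xs ! i) * (\<integral>t. t ^ n \<partial>snd (xs ! i))) = 0" for n
      using mom[of n] conv[of "\<lambda>\<mu>. \<integral>t. t ^ n \<partial>\<mu>"] by simp
  qed simp
  then show ?thesis
    by (simp add: conv)
qed

subsection \<open>Polynomials of an operator\<close>

definition polyop :: "real poly \<Rightarrow> ('a::complex_hilbert \<Rightarrow> 'a) \<Rightarrow> 'a \<Rightarrow> 'a" where
  "polyop p H x = (\<Sum>i\<le>degree p. coeff p i *\<^sub>R (H ^^ i) x)"

lemma polyop_altdef:
  assumes "degree p \<le> n"
  shows "polyop p H x = (\<Sum>i\<le>n. coeff p i *\<^sub>R (H ^^ i) x)"
  unfolding polyop_def using assms
  by (intro sum.mono_neutral_left) (auto simp: coeff_eq_0)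

lemma polyop_add: "polyop (p + q) H x = polyop p H x + polyop q H x"
proof -
  define n where "n = max (degree p) (degree q)"
  have "degree (p + q) \<le> n" "degree p \<le> n" "degree q \<le> n"
    by (auto simp: n_def degree_add_le_max)
  then show ?thesis
    by (simp add: polyop_altdef scaleR_add_left sum.distrib)
qed

lemma polyop_smult: "polyop (smult a p) H x = a *\<^sub>R polyop p H x"
proof -
  have "degree (smult a p) \<le> degree p"
    by simp
  then show ?thesis
    by (simp add: polyop_altdef[of _ "degree p"] scaleR_sum_right)
qed

lemma polyop_0 [simp]: "polyop 0 H x = 0"
  by (simp add: polyop_def)

lemma polyop_1 [simp]: "polyop 1 H x = x"
  by (simp add: polyop_def)

lemma polyop_sum: "polyop (\<Sum>i\<in>I. p i) H x = (\<Sum>i\<in>I. polyop (p i) H x)"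
  by (induction I rule: infinite_finite_induct) (simp_all add: polyop_add)

lemma polyop_pCons:
  assumes H: "bounded_clinear H"
  shows "polyop (pCons a p) H x = a *\<^sub>R x + H (polyop p H x)"
proof -
  have "degree (pCons a p) \<le> Suc (degree p)"
    by (rule degree_pCons_le)
  then have "polyop (pCons a p) H x = (\<Sum>i\<le>Suc (degree p). coeff (pCons a p) i *\<^sub>R (H ^^ i) x)"
    by (rule polyop_altdef)
  also have "\<dots> = a *\<^sub>R x + (\<Sum>i\<le>degree p. coeff p i *\<^sub>R H ((H ^^ i) x))"
    by (subst sum.atMost_Suc_shift) simp
  finally show ?thesis
    by (simp add: polyop_def bounded_clinear_sum[OF H] bounded_clinear_scaleR[OF H])
qed

lemma polyop_mult:
  assumes H: "bounded_clinear H"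
  shows "polyop (p * q) H x = polyop p H (polyop q H x)"
  by (induction p) (simp_all add: polyop_add polyop_smult polyop_pCons[OF H])

lemma polyop_monom: "polyop (monom 1 n) H x = (H ^^ n) x"
  by (cases "n = 0") (simp_all add: polyop_altdef[OF degree_monom_le] if_distrib[of "\<lambda>c. c *\<^sub>R _"] cong: if_cong)

lemma bounded_clinear_polyop:
  assumes H: "bounded_clinear H"
  shows "bounded_clinear (polyop p H)"
proof (induction p)
  case 0
  then show ?case
    by (auto intro: bounded_clinearI[where K = 0])
next
  case (pCons a p)
  have "polyop (pCons a p) H = (\<lambda>x. a *\<^sub>R x + H (polyop p H x))"
    by (rule ext) (rule polyop_pCons[OF H])
  then show ?case
    using bounded_clinear_plus[OF bounded_clinear_scale_real[OF bounded_clinear_id(1)]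
        bounded_clinear_compose[OF H pCons(2)]] by simp
qed

lemma selfadjoint_polyop:
  assumes H: "selfadjoint H"
  shows "rinner (polyop p H x) y = rinner x (polyop p H y)"
proof (induction p arbitrary: x y)
  case (pCons a p)
  have comm: "polyop p H (H y) = H (polyop p H y)" for y
    using polyop_mult[OF selfadjoint_bounded[OF H], of p "[:0, 1:]" y]
      polyop_mult[OF selfadjoint_bounded[OF H], of "[:0, 1:]" p y]
    by (simp add: mult.commute[of p] polyop_pCons[OF selfadjoint_bounded[OF H]]
        bounded_clinear_zero[OF selfadjoint_bounded[OF H]])
  show ?case
    by (simp add: polyop_pCons[OF selfadjoint_bounded[OF H]] rinner_simps selfadjoint_rinner[OF H]
        pCons comm)
qed simp

lemma selfadjoint_funpow:
  assumes "selfadjoint H"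
  shows "rinner ((H ^^ n) x) y = rinner x ((H ^^ n) y)"
  using selfadjoint_polyop[OF assms, of "monom 1 n"] by (simp add: polyop_monom)

lemma polyop_pcompose_power:
  assumes H: "bounded_clinear H"
  shows "polyop (pcompose p q) H x = (\<Sum>i\<le>degree p. coeff p i *\<^sub>R polyop (q ^ i) H x)"
proof -
  have "pcompose p q = (\<Sum>i\<le>degree p. smult (coeff p i) (q ^ i))"
    by (simp add: pcompose_altdef poly_altdef coeff_map_poly degree_map_poly)
  then show ?thesis
    by (simp add: polyop_sum polyop_smult)
qed

subsection \<open>The scalar spectral measures of a selfadjoint operator\<close>

text \<open>Both numbers are products of \<open>m\<close> factors of modulus at most 1, so they
  differ by at most the sum of the differences of the factors, each at most
  \<open>m / (n - m)\<close>.\<close>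

lemma binomial_ratio_close:
  assumes k: "k \<le> n" and n: "2 * m < n"
  shows "\<bar>real (k choose m) / real (n choose m) - (real k / real n) ^ m\<bar> \<le> real m * real m / real (n - m)"
proof -
  have nm: "m \<le> n" "0 < real n" "0 < real (n - m)" "\<And>i. i < m \<Longrightarrow> 0 < real n - real i"
    using n by auto
  have ratio: "real (k choose m) / real (n choose m) = (\<Prod>i<m. (real k - real i) / (real n - real i))"
    by (simp add: binomial_gbinomial gbinomial_prod_rev prod_dividef lessThan_atLeast0)
  have pw: "(real k / real n) ^ m = (\<Prod>i<m. real k / real n)"
    by simp
  have "norm ((\<Prod>i<m. (real k - real i) / (real n - real i)) - (\<Prod>i<m. real k / real n))
      \<le> (\<Sum>i<m. norm ((real k - real i) / (real n - real i) - real k / real n))"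
  proof (rule norm_prod_diff)
    fix i assume "i \<in> {..<m}"
    \<comment> \<open>For \<open>k < i\<close> the left-hand side is \<open>i - k\<close>, and
      \<open>2 * m < n\<close> keeps it below \<open>n - i\<close>.\<close>
    then have "\<bar>real k - real i\<bar> \<le> real n - real i"
      using k n by auto
    then show "norm ((real k - real i) / (real n - real i)) \<le> 1"
      using nm(4)[of i] \<open>i \<in> {..<m}\<close> by (simp add: abs_divide divide_le_eq_1)
    show "norm (real k / real n) \<le> 1"
      using k nm(2) by (simp add: divide_le_eq_1)
  qed
  also have "\<dots> \<le> (\<Sum>i<m. real m / real (n - m))"
  proof (rule sum_mono)
    fix i assume i: "i \<in> {..<m}"
    have pos: "0 < real n - real i"
      using nm(4) i by simp
    have "(real k - real i) / (real n - real i) - real k / real n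
        = real i * (real k - real n) / (real n * (real n - real i))"
      using pos nm(2) by (simp add: field_simps)
    then have "norm ((real k - real i) / (real n - real i) - real k / real n)
        = (real i / (real n - real i)) * ((real n - real k) / real n)"
      using pos nm(2) k by (simp add: abs_mult abs_divide)
    also have "\<dots> \<le> (real i / (real n - real i)) * 1"
      using pos nm(2) k by (intro mult_left_mono) (auto simp: divide_le_eq_1)
    also have "\<dots> \<le> real m / real (n - m)"
      using i nm by (simp, intro frac_le) auto
    finally show "norm ((real k - real i) / (real n - real i) - real k / real n) \<le> real m / real (n - m)" .
  qed
  finally show ?thesis
    unfolding ratio pw by simp
qed

text \<open>The binomial moments of the binomial distribution, by \<open>choose_mult\<close> and the
  binomial theorem; the commutative ring allows \<open>\<alpha>\<close> and \<open>\<beta>\<close>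
  to be polynomials.\<close>

lemma bernstein_binomial_moment:
  fixes \<alpha> \<beta> :: "'a::comm_ring_1"
  assumes m: "m \<le> n" and sum1: "\<alpha> + \<beta> = 1"
  shows "(\<Sum>k\<le>n. of_nat ((n choose k) * (k choose m)) * \<alpha> ^ k * \<beta> ^ (n - k)) = of_nat (n choose m) * \<alpha> ^ m"
proof -
  have "(\<Sum>k\<le>n. of_nat ((n choose k) * (k choose m)) * \<alpha> ^ k * \<beta> ^ (n - k))
      = (\<Sum>k\<in>{m..n}. of_nat ((n choose k) * (k choose m)) * \<alpha> ^ k * \<beta> ^ (n - k))"
    using m by (intro sum.mono_neutral_right) (auto simp: not_le binomial_eq_0)
  also have "\<dots> = (\<Sum>k\<in>{m..n}. of_nat (n choose m) * \<alpha> ^ m * (of_nat ((n - m) choose (k - m)) * \<alpha> ^ (k - m) * \<beta> ^ (n - m - (k - m))))"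
  proof (rule sum.cong[OF refl])
    fix k assume k: "k \<in> {m..n}"
    then have "\<alpha> ^ k = \<alpha> ^ m * \<alpha> ^ (k - m)"
      by (simp flip: power_add)
    moreover have "n - m - (k - m) = n - k"
      using k by auto
    ultimately show "of_nat ((n choose k) * (k choose m)) * \<alpha> ^ k * \<beta> ^ (n - k)
        = of_nat (n choose m) * \<alpha> ^ m * (of_nat ((n - m) choose (k - m)) * \<alpha> ^ (k - m) * \<beta> ^ (n - m - (k - m)))"
      using k choose_mult[of m k n] by (simp only: atLeastAtMost_iff of_nat_mult) (simp add: mult_ac)
  qed
  also have "\<dots> = (\<Sum>j\<le>n - m. of_nat (n choose m) * \<alpha> ^ m * (of_nat ((n - m) choose j) * \<alpha> ^ j * \<beta> ^ (n - m - j)))"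
    using m by (intro sum.reindex_bij_witness[of _ "\<lambda>j. j + m" "\<lambda>k. k - m"]) auto
  also have "\<dots> = of_nat (n choose m) * \<alpha> ^ m * (\<alpha> + \<beta>) ^ (n - m)"
    by (simp only: binomial_ring sum_distrib_left)
  finally show ?thesis
    by (simp add: sum1)
qed

text \<open>A solution of the Hausdorff moment problem: the Bernstein weights of \<open>\<phi>\<close> are distributions on
  \<open>[0, 1]\<close>, and a weak limit of them represents \<open>\<phi>\<close>.\<close>

lemma hausdorff_moment_measure:
  fixes \<phi> :: "real poly \<Rightarrow> real" and \<alpha> \<beta> :: "real poly"
  assumes add: "\<And>p q. \<phi> (p + q) = \<phi> p + \<phi> q" and smult: "\<And>a p. \<phi> (smult a p) = a * \<phi> p"
    and one: "\<phi> 1 = 1" and sum1: "\<alpha> + \<beta> = 1"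
    and pos: "\<And>k l. 0 \<le> \<phi> (\<alpha> ^ k * \<beta> ^ l)"
  obtains \<nu> where "real_distribution \<nu>" "\<And>m. (\<integral>t. (max 0 (min 1 t)) ^ m \<partial>\<nu>) = \<phi> (\<alpha> ^ m)"
proof -
  have \<phi>0: "\<phi> 0 = 0"
    using smult[of 0 0] by simp
  have \<phi>sum: "\<phi> (\<Sum>i\<in>I. p i) = (\<Sum>i\<in>I. \<phi> (p i))" for I :: "nat set" and p
    by (induction I rule: infinite_finite_induct) (simp_all add: \<phi>0 add)
  have \<phi>nat: "\<phi> (of_nat a * p) = real a * \<phi> p" for a p
    by (simp add: of_nat_poly smult)
  \<comment> \<open>The values of \<open>\<phi>\<close> on the Bernstein polynomials. Their binomial
    moments are exact, and \<open>binomial_ratio_close\<close> turns these into ordinary moments in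
    the limit.\<close>
  define w where "w n k = real (n choose k) * \<phi> (\<alpha> ^ k * \<beta> ^ (n - k))" for n k
  have w0: "0 \<le> w n k" for n k
    by (simp add: w_def pos)
  have wmom: "(\<Sum>k\<le>n. w n k * (real (k choose m) / real (n choose m))) = \<phi> (\<alpha> ^ m)" if m: "m \<le> n" for m n
  proof -
    have "(\<Sum>k\<le>n. w n k * real (k choose m)) = \<phi> (\<Sum>k\<le>n. of_nat ((n choose k) * (k choose m)) * \<alpha> ^ k * \<beta> ^ (n - k))"
      by (simp only: \<phi>sum mult.assoc \<phi>nat w_def) (simp add: mult_ac)
    also have "\<dots> = real (n choose m) * \<phi> (\<alpha> ^ m)"
      by (simp only: bernstein_binomial_moment[OF m sum1] \<phi>nat)
    finally have "(\<Sum>k\<le>n. w n k * real (k choose m)) = real (n choose m) * \<phi> (\<alpha> ^ m)" .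
    then show ?thesis
      using m by (simp add: sum_divide_distrib[symmetric])
  qed
  have w1: "(\<Sum>k\<le>n. w n k) = 1" for n
    using wmom[of 0 n] one by simp
  \<comment> \<open>Degree \<open>Suc n\<close> keeps the nodes free of division by 0.\<close>
  define \<nu> where "\<nu> n = distr (point_measure {..Suc n} (\<lambda>k. ennreal (w (Suc n) k))) borel (\<lambda>k. real k / real (Suc n))" for n
  have meas: "(\<lambda>k. real k / real (Suc n)) \<in> point_measure {..Suc n} (\<lambda>k. ennreal (w (Suc n) k)) \<rightarrow>\<^sub>M borel" for n
    by (simp add: measurable_point_measure_eq1)
  have prob: "prob_space (point_measure {..Suc n} (\<lambda>k. ennreal (w (Suc n) k)))" for n
    by (rule prob_spaceI) (simp only: space_point_measure emeasure_point_measure_finite finite_atMost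
        order_refl sum_ennreal w0 w1 ennreal_1)
  have rd: "real_distribution (\<nu> n)" for n
    unfolding \<nu>_def real_distribution_def real_distribution_axioms_def
    by (simp add: prob_space.prob_space_distr[OF prob meas] del: of_nat_Suc)
  have \<nu>int: "(\<integral>t. g t \<partial>\<nu> n) = (\<Sum>k\<le>Suc n. w (Suc n) k * g (real k / real (Suc n)))"
    if g: "g \<in> borel_measurable borel" for g :: "real \<Rightarrow> real" and n
    unfolding \<nu>_def
    by (subst integral_distr[OF meas g])
      (simp only: lebesgue_integral_point_measure_finite[OF finite_atMost w0] real_scaleR_def)
  have "tight \<nu>"
    unfolding tight_def
  proof (intro conjI allI impI rd)
    fix \<epsilon> :: real assume "0 < \<epsilon>"
    have "measure (\<nu> n) {-1<..1} = 1" for n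
    proof -
      interpret real_distribution "\<nu> n" by (rule rd)
      have "measure (\<nu> n) {-1<..1} = (\<integral>t. indicator {-1<..1} t \<partial>\<nu> n)"
        by simp
      also have "\<dots> = (\<Sum>k\<le>Suc n. w (Suc n) k * indicator {-1<..1} (real k / real (Suc n)))"
        by (rule \<nu>int) simp
      also have "\<dots> = (\<Sum>k\<le>Suc n. w (Suc n) k)"
      proof (rule sum.cong[OF refl])
        fix k assume "k \<in> {..Suc n}"
        then have "real k / real (Suc n) \<le> 1"
          by (simp add: divide_le_eq_1)
        moreover have "0 \<le> real k / real (Suc n)"
          by simp
        ultimately have "real k / real (Suc n) \<in> {-1<..1}"
          unfolding greaterThanAtMost_iff by linarith
        then show "w (Suc n) k * indicator {-1<..1} (real k / real (Suc n)) = w (Suc n) k"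
          by simp
      qed
      finally show ?thesis
        by (simp only: w1)
    qed
    then show "\<exists>a b. a < b \<and> (\<forall>n. 1 - \<epsilon> < measure (\<nu> n) {a<..b})"
      using \<open>0 < \<epsilon>\<close> by (intro exI[of _ "-1"] exI[of _ 1]) auto
  qed
  then obtain s \<nu>' where s: "strict_mono (s :: nat \<Rightarrow> nat)" and rd': "real_distribution \<nu>'"
    and conv: "weak_conv_m (\<nu> \<circ> id \<circ> s) \<nu>'"
    using tight_imp_convergent_subsubsequence[of \<nu> id] strict_mono_id by blast
  \<comment> \<open>Clamping changes nothing on \<open>[0, 1]\<close>, where the
    \<open>\<nu> n\<close> live, and makes the power bounded and continuous, as weak convergence
    demands.\<close>
  define h where "h m t = (max 0 (min 1 t)) ^ m" for m and t :: real
  have "(\<integral>t. h m t \<partial>\<nu>') = \<phi> (\<alpha> ^ m)" for m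
  proof -
    have hm: "h m \<in> borel_measurable borel"
      unfolding h_def by measurable
    have "(\<lambda>n. \<integral>t. h m t \<partial>(\<nu> \<circ> id \<circ> s) n) \<longlonglongrightarrow> (\<integral>t. h m t \<partial>\<nu>')"
    proof (rule weak_conv_imp_integral_bdd_continuous_conv[OF _ rd' conv, where B = 1])
      show "real_distribution ((\<nu> \<circ> id \<circ> s) n)" for n
        by (simp add: rd)
      show "isCont (h m) t" for t
        unfolding h_def by (intro continuous_intros)
      show "norm (h m t) \<le> 1" for t
        unfolding h_def by (simp add: power_le_one)
    qed
    moreover have "(\<lambda>n. \<integral>t. h m t \<partial>\<nu> n) \<longlonglongrightarrow> \<phi> (\<alpha> ^ m)"
    proof (rule LIM_zero_cancel, rule Lim_null_comparison)
      show "eventually (\<lambda>n. norm ((\<integral>t. h m t \<partial>\<nu> n) - \<phi> (\<alpha> ^ m)) \<le> real m * real m / real (Suc n - m)) sequentially"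
        using eventually_ge_at_top[of "2 * m"]
      proof eventually_elim
        case (elim n)
        have "(\<integral>t. h m t \<partial>\<nu> n) = (\<Sum>k\<le>Suc n. w (Suc n) k * (real k / real (Suc n)) ^ m)"
        proof -
          have "h m (real k / real (Suc n)) = (real k / real (Suc n)) ^ m" if "k \<in> {..Suc n}" for k
          proof -
            have "real k / real (Suc n) \<le> 1"
              using that by (simp add: divide_le_eq_1)
            then show ?thesis
              by (simp add: h_def min_absorb2 max_absorb2 del: of_nat_Suc)
          qed
          then show ?thesis
            unfolding \<nu>int[OF hm] by (intro sum.cong) auto
        qed
        then have "(\<integral>t. h m t \<partial>\<nu> n) - \<phi> (\<alpha> ^ m) = (\<Sum>k\<le>Suc n. w (Suc n) k *
            ((real k / real (Suc n)) ^ m - real (k choose m) / real (Suc n choose m)))"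
          using wmom[of m "Suc n"] elim by (simp only: right_diff_distrib sum_subtractf)
        also have "norm \<dots> \<le> (\<Sum>k\<le>Suc n. w (Suc n) k * (real m * real m / real (Suc n - m)))"
        proof (rule sum_norm_le)
          fix k assume "k \<in> {..Suc n}"
          then have "\<bar>(real k / real (Suc n)) ^ m - real (k choose m) / real (Suc n choose m)\<bar>
              \<le> real m * real m / real (Suc n - m)"
            using binomial_ratio_close[of k "Suc n" m] elim by (simp only: abs_minus_commute) auto
          then show "norm (w (Suc n) k * ((real k / real (Suc n)) ^ m - real (k choose m) / real (Suc n choose m)))
              \<le> w (Suc n) k * (real m * real m / real (Suc n - m))"
            using w0 by (simp only: real_norm_def abs_mult abs_of_nonneg) (intro mult_left_mono, auto)
        qed
        also have "\<dots> = real m * real m / real (Suc n - m)"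
          by (simp only: sum_distrib_right[symmetric] w1 mult_1)
        finally show ?case .
      qed
      show "(\<lambda>n. real m * real m / real (Suc n - m)) \<longlonglongrightarrow> 0"
        by real_asymp
    qed
    from LIMSEQ_subseq_LIMSEQ[OF this s]
    have "(\<lambda>n. \<integral>t. h m t \<partial>(\<nu> \<circ> id \<circ> s) n) \<longlonglongrightarrow> \<phi> (\<alpha> ^ m)"
      by (simp add: o_def)
    ultimately show ?thesis
      by (rule LIMSEQ_unique)
  qed
  then show ?thesis
    using that[OF rd'] by (simp add: h_def)
qed

text \<open>Squares can be split off, because the operator of a real polynomial is symmetric. This
  leaves \<open>1\<close>, \<open>\<alpha>\<close>, \<open>\<beta>\<close> and
  \<open>\<alpha> * \<beta>\<close>, and since \<open>\<alpha> + \<beta> = 1\<close> the last one is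
  the sum of a square times \<open>\<beta>\<close> and a square times
  \<open>\<alpha>\<close>.\<close>

lemma polyop_bernstein_nonneg:
  assumes H: "selfadjoint H" and sum1: "\<alpha> + \<beta> = 1"
    and \<alpha>: "\<And>x. 0 \<le> rinner (polyop \<alpha> H x) x" and \<beta>: "\<And>x. 0 \<le> rinner (polyop \<beta> H x) x"
  shows "0 \<le> rinner (polyop (\<alpha> ^ k * \<beta> ^ l) H x) x"
proof -
  define nonneg where "nonneg p \<longleftrightarrow> (\<forall>x. 0 \<le> rinner (polyop p H x) x)" for p
  have bH: "bounded_clinear H"
    using H by (rule selfadjoint_bounded)
  have sq: "nonneg (s * s * p)" if "nonneg p" for s p
  proof -
    have "rinner (polyop (s * s * p) H x) x = rinner (polyop p H (polyop s H x)) (polyop s H x)" for x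
    proof -
      have "s * s * p = s * (p * s)"
        by (simp add: mult_ac)
      then show ?thesis
        by (simp only: polyop_mult[OF bH] selfadjoint_polyop[OF H, of s])
    qed
    then show ?thesis
      using that by (simp add: nonneg_def)
  qed
  have add: "nonneg (p + q)" if "nonneg p" "nonneg q" for p q
    using that by (simp add: nonneg_def polyop_add rinner_add_left)
  have n1: "nonneg 1"
    by (simp add: nonneg_def rinner_self)
  have na: "nonneg \<alpha>" and nb: "nonneg \<beta>"
    using \<alpha> \<beta> by (auto simp: nonneg_def)
  have nab: "nonneg (\<alpha> * \<beta>)"
  proof -
    have "\<alpha> * \<beta> = \<alpha> * \<alpha> * \<beta> + \<beta> * \<beta> * \<alpha>"
    proof -
      have "\<alpha> * \<beta> = \<alpha> * \<beta> * (\<alpha> + \<beta>)"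
        by (simp add: sum1)
      then show ?thesis
        by (simp add: algebra_simps)
    qed
    then show ?thesis
      using add[OF sq[OF nb, of \<alpha>] sq[OF na, of \<beta>]] by simp
  qed
  have small: "nonneg (\<alpha> ^ i * \<beta> ^ j)" if "i < 2" "j < 2" for i j
  proof -
    have "i = 0 \<or> i = 1" "j = 0 \<or> j = 1"
      using that by auto
    then show ?thesis
      using n1 na nb nab by auto
  qed
  have "\<alpha> ^ k * \<beta> ^ l = (\<alpha> ^ (k div 2) * \<beta> ^ (l div 2)) * (\<alpha> ^ (k div 2) * \<beta> ^ (l div 2))
      * (\<alpha> ^ (k mod 2) * \<beta> ^ (l mod 2))"
  proof -
    have "\<alpha> ^ k = \<alpha> ^ (k div 2 + k div 2 + k mod 2)" "\<beta> ^ l = \<beta> ^ (l div 2 + l div 2 + l mod 2)"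
      by (simp_all add: mult_2[symmetric])
    then show ?thesis
      by (simp only: power_add mult_ac)
  qed
  then have "nonneg (\<alpha> ^ k * \<beta> ^ l)"
    using sq[OF small] by simp
  then show ?thesis
    by (simp add: nonneg_def)
qed

text \<open>\<open>\<alpha>\<close> and \<open>\<beta>\<close> are the two affine maps of
  \<open>[-M, M]\<close> onto \<open>[0, 1]\<close>; the bound on the form says that both have
  nonnegative operators. The moment problem is solved on \<open>[0, 1]\<close> and carried back by
  \<open>\<tau>\<close>.\<close>

lemma scalar_spectral_measure_unit:
  assumes H: "selfadjoint H" and M: "0 < M" "\<And>x. \<bar>rinner (H x) x\<bar> \<le> M * (norm x)\<^sup>2" and x: "norm x = 1"
  obtains \<mu> where "supported M \<mu>" "\<And>p. (\<integral>t. poly p t \<partial>\<mu>) = rinner (polyop p H x) x"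
proof -
  have bH: "bounded_clinear H"
    using H by (rule selfadjoint_bounded)
  define \<alpha> where "\<alpha> = [:1/2, 1 / (2 * M):]"
  define \<beta> where "\<beta> = [:1/2, - 1 / (2 * M):]"
  define \<phi> where "\<phi> p = rinner (polyop p H x) x" for p
  have sum1: "\<alpha> + \<beta> = 1"
    by (simp add: \<alpha>_def \<beta>_def one_pCons)
  have \<alpha>x: "rinner (polyop \<alpha> H y) y = (norm y)\<^sup>2 / 2 + rinner (H y) y / (2 * M)" for y
    by (simp add: \<alpha>_def polyop_pCons[OF bH] rinner_simps rinner_self bounded_clinear_scaleR[OF bH]
        bounded_clinear_zero[OF bH] bounded_clinear_add[OF bH])
  have \<beta>x: "rinner (polyop \<beta> H y) y = (norm y)\<^sup>2 / 2 - rinner (H y) y / (2 * M)" for y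
    by (simp add: \<beta>_def polyop_pCons[OF bH] rinner_simps rinner_self bounded_clinear_scaleR[OF bH]
        bounded_clinear_zero[OF bH] bounded_clinear_add[OF bH] bounded_clinear_minus[OF bH])
  have small: "\<bar>rinner (H y) y / (2 * M)\<bar> \<le> (norm y)\<^sup>2 / 2" for y
    using M(1) M(2)[of y] by (simp add: abs_divide field_simps)
  obtain \<nu> where \<nu>: "real_distribution \<nu>" and mom: "\<And>m. (\<integral>t. (max 0 (min 1 t)) ^ m \<partial>\<nu>) = \<phi> (\<alpha> ^ m)"
  proof (rule hausdorff_moment_measure[of \<phi> \<alpha> \<beta>])
    show "0 \<le> \<phi> (\<alpha> ^ k * \<beta> ^ l)" for k l
      unfolding \<phi>_def
    proof (rule polyop_bernstein_nonneg[OF H sum1])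
      show "0 \<le> rinner (polyop \<alpha> H y) y" "0 \<le> rinner (polyop \<beta> H y) y" for y
        unfolding \<alpha>x \<beta>x using small[of y] by linarith+
    qed
  qed (simp_all add: \<phi>_def polyop_add polyop_smult rinner_simps rinner_self x sum1)
  interpret \<nu>: real_distribution \<nu> by (rule \<nu>)
  define \<tau> where "\<tau> t = M * (2 * max 0 (min 1 t) - 1)" for t
  have \<tau>m: "\<tau> \<in> \<nu> \<rightarrow>\<^sub>M borel"
    unfolding \<tau>_def by measurable
  define \<mu> where "\<mu> = distr \<nu> borel \<tau>"
  have "prob_space \<mu>"
    unfolding \<mu>_def by (rule \<nu>.prob_space_distr[OF \<tau>m])
  moreover have "AE t in \<mu>. \<bar>t\<bar> \<le> M"
  proof -
    have "\<bar>\<tau> t\<bar> \<le> M" for t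
    proof -
      have "\<bar>2 * max 0 (min 1 t) - 1\<bar> \<le> 1"
        by auto
      then have "\<bar>M\<bar> * \<bar>2 * max 0 (min 1 t) - 1\<bar> \<le> \<bar>M\<bar> * 1"
        by (intro mult_left_mono) auto
      then show ?thesis
        using M(1) by (simp add: \<tau>_def abs_mult)
    qed
    then show ?thesis
      unfolding \<mu>_def by (subst AE_distr_iff[OF \<tau>m]) auto
  qed
  ultimately have sup: "supported M \<mu>"
    unfolding supported_def using prob_space.finite_measure by (auto simp: \<mu>_def)
  have "(\<integral>t. poly p t \<partial>\<mu>) = rinner (polyop p H x) x" for p
  proof -
    \<comment> \<open>\<open>p\<close> rewritten as a polynomial in \<open>\<alpha>\<close>, whose
      moments are known.\<close>
    define q where "q = pcompose p [:- M, 2 * M:]"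
    have qa: "pcompose q \<alpha> = p"
    proof -
      have "pcompose [:- M, 2 * M:] \<alpha> = [:0, 1:]"
        using M(1) by (simp add: \<alpha>_def pcompose_pCons)
      then show ?thesis
        by (simp add: q_def pcompose_assoc[symmetric])
    qed
    have "(\<integral>t. poly p t \<partial>\<mu>) = (\<integral>t. poly p (\<tau> t) \<partial>\<nu>)"
      unfolding \<mu>_def by (subst integral_distr[OF \<tau>m]) (auto intro!: borel_measurable_continuous_onI continuous_intros)
    also have "\<dots> = (\<integral>t. (\<Sum>i\<le>degree q. coeff q i * (max 0 (min 1 t)) ^ i) \<partial>\<nu>)"
    proof -
      have "poly p (\<tau> t) = poly q (max 0 (min 1 t))" for t
        by (simp add: q_def poly_pcompose \<tau>_def algebra_simps)
      then show ?thesis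
        by (simp add: poly_altdef)
    qed
    also have "\<dots> = (\<Sum>i\<le>degree q. coeff q i * (\<integral>t. (max 0 (min 1 t)) ^ i \<partial>\<nu>))"
    proof (subst Bochner_Integration.integral_sum)
      show "integrable \<nu> (\<lambda>t. coeff q i * (max 0 (min 1 t)) ^ i)" for i
        by (intro integrable_mult_right \<nu>.integrable_const_bound[where B = 1]) (auto simp: power_le_one)
    qed simp
    also have "\<dots> = (\<Sum>i\<le>degree q. coeff q i * rinner (polyop (\<alpha> ^ i) H x) x)"
      by (simp only: mom \<phi>_def)
    also have "\<dots> = rinner (polyop (pcompose q \<alpha>) H x) x"
      by (simp add: polyop_pcompose_power[OF bH] rinner_sum_left rinner_simps)
    finally show ?thesis
      by (simp add: qa)
  qed
  then show ?thesis
    using sup that by blast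
qed

lemma scalar_spectral_measure:
  assumes H: "selfadjoint H" and M: "0 < M" "\<And>x. \<bar>rinner (H x) x\<bar> \<le> M * (norm x)\<^sup>2"
  obtains \<mu> where "supported M \<mu>" "\<And>p. (\<integral>t. poly p t \<partial>\<mu>) = rinner (polyop p H x) x"
proof (cases "x = 0")
  case True
  have bH: "bounded_clinear H"
    using H by (rule selfadjoint_bounded)
  have "supported M (null_measure borel)"
    unfolding supported_def by (auto intro!: finite_measureI AE_I[of _ _ UNIV])
  moreover have "(\<integral>t. poly p t \<partial>null_measure borel) = rinner (polyop p H x) x" for p
    using True by (simp add: bounded_clinear_zero[OF bounded_clinear_polyop[OF bH]])
  ultimately show ?thesis
    by (rule that)
next
  case False
  have bH: "bounded_clinear H"
    using H by (rule selfadjoint_bounded)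
  define e where "e = (1 / norm x) *\<^sub>R x"
  have e: "norm e = 1"
    using False by (simp add: e_def)
  obtain \<nu> where \<nu>: "supported M \<nu>" "\<And>p. (\<integral>t. poly p t \<partial>\<nu>) = rinner (polyop p H e) e"
    using scalar_spectral_measure_unit[OF H M e] by blast
  define \<mu> where "\<mu> = density \<nu> (\<lambda>t. ennreal ((norm x)\<^sup>2))"
  have ig: "integrable \<nu> (\<lambda>t. (norm x)\<^sup>2)"
    by (intro supported_integrable[OF \<nu>(1)] continuous_intros)
  have "supported M \<mu>"
    unfolding \<mu>_def by (rule supported_density(1)[OF \<nu>(1) _ ig]) auto
  moreover have "(\<integral>t. poly p t \<partial>\<mu>) = rinner (polyop p H x) x" for p
  proof -
    have "(\<integral>t. poly p t \<partial>\<mu>) = (\<integral>t. (norm x)\<^sup>2 * poly p t \<partial>\<nu>)"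
      unfolding \<mu>_def
      by (rule supported_density(3)[OF \<nu>(1) _ ig]) (auto intro!: borel_measurable_continuous_onI continuous_intros)
    also have "\<dots> = (norm x)\<^sup>2 * rinner (polyop p H e) e"
      by (simp add: \<nu>(2))
    also have "\<dots> = rinner (polyop p H x) x"
      using False by (simp add: e_def bounded_clinear_scaleR[OF bounded_clinear_polyop[OF bH]]
          rinner_simps power2_eq_square)
    finally show ?thesis .
  qed
  ultimately show ?thesis
    by (rule that)
qed

subsection \<open>The spectral theorem for bounded selfadjoint operators\<close>

lemma rinner_scaleC_both: "rinner (c *\<^sub>C x) (c *\<^sub>C y) = (cmod c)\<^sup>2 * rinner x y"
proof -
  have "cinner (c *\<^sub>C x) (c *\<^sub>C y) = (c * cnj c) * cinner x y"
    by (simp only: cinner_scaleC_left cinner_scaleC_right mult_ac)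
  also have "c * cnj c = complex_of_real ((cmod c)\<^sup>2)"
    using complex_norm_square[of c] by simp
  finally show ?thesis
    by (simp only: rinner_def) simp
qed

lemma selfadjoint_cinner_self:
  assumes "selfadjoint H"
  shows "cinner (H x) x = complex_of_real (rinner (H x) x)"
proof -
  have "rinner (H x) (\<i> *\<^sub>C x) = rinner x (\<i> *\<^sub>C H x)"
    by (simp add: selfadjoint_rinner[OF assms] bounded_clinear_scaleC[OF selfadjoint_bounded[OF assms]])
  also have "\<dots> = - rinner (H x) (\<i> *\<^sub>C x)"
    by (metis rinner_commute rinner_ii_left add.inverse_inverse)
  finally have "rinner (H x) (\<i> *\<^sub>C x) = 0"
    by simp
  then show ?thesis
    by (simp add: cinner_conv_rinner complex_eq_iff)
qed

text \<open>The scalar measures are determined by their moments, and these are quadratic in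
  \<open>x\<close>; hence so is the mass of every Borel set, which defines \<open>E S\<close>. The
  commutation property is proved along with it because the uniqueness of the half-line projections
  rests on it.\<close>

theorem spectral_theorem:
  fixes H :: "'a::complex_hilbert \<Rightarrow> 'a"
  assumes H: "selfadjoint H"
  obtains E where "spectral_measure_of H E"
    "\<And>S T x. S \<in> sets borel \<Longrightarrow> selfadjoint T \<Longrightarrow> (\<And>y. T (H y) = H (T y)) \<Longrightarrow> E S (T x) = T (E S x)"
proof -
  have bH: "bounded_clinear H"
    using H by (rule selfadjoint_bounded)
  define M where "M = onorm H + 1"
  have M: "0 < M"
    using bounded_clinear_onorm_nonneg[OF bH] by (simp add: M_def)
  have HM: "\<bar>rinner (H x) x\<bar> \<le> M * (norm x)\<^sup>2" for x
  proof -
    have "\<bar>rinner (H x) x\<bar> \<le> norm (H x) * norm x"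
      by (rule abs_rinner_le)
    also have "\<dots> \<le> (M * norm x) * norm x"
      using bounded_clinear_norm_le[OF bH, of x]
      by (intro mult_right_mono) (auto simp: M_def distrib_right add_increasing2)
    finally show ?thesis
      by (simp add: power2_eq_square mult.assoc)
  qed
  have "\<exists>\<mu>. supported M \<mu> \<and> (\<forall>p. (\<integral>t. poly p t \<partial>\<mu>) = rinner (polyop p H x) x)" for x
    using scalar_spectral_measure[OF H M HM, of x] by blast
  then obtain \<mu> where sup: "\<And>x. supported M (\<mu> x)"
    and mom: "\<And>x p. (\<integral>t. poly p t \<partial>\<mu> x) = rinner (polyop p H x) x"
    by metis
  note sets_\<mu> = supportedD(2)[OF sup] and space_\<mu> = supportedD(3)[OF sup]
  have pw: "(\<integral>t. t ^ n \<partial>\<mu> x) = rinner ((H ^^ n) x) x" for n x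
    using mom[of x "monom 1 n"] by (simp add: poly_monom polyop_monom)
  have total: "measure (\<mu> x) UNIV = (norm x)\<^sup>2" for x
    using pw[of x 0] space_\<mu>[of x] by (simp add: rinner_self)
  have bHn: "bounded_clinear (H ^^ n)" for n
    by (rule bounded_clinear_funpow[OF bH])
  note Hn_simps = bounded_clinear_add[OF bHn] bounded_clinear_diff[OF bHn] bounded_clinear_scaleC[OF bHn]
  have "\<exists>T. selfadjoint T \<and> (\<forall>x. rinner (T x) x = measure (\<mu> x) S) \<and>
      (\<forall>x y. 4 * rinner (T x) y = measure (\<mu> (x + y)) S - measure (\<mu> (x - y)) S)" if S: "S \<in> sets borel" for S
  proof (rule quadratic_form_operator[of "\<lambda>x. measure (\<mu> x) S" 1])
    fix c and x :: 'a
    have "(\<Sum>(c, \<mu>)\<leftarrow>[(1, \<mu> (c *\<^sub>C x)), (- (cmod c)\<^sup>2, \<mu> x)]. c * measure \<mu> S) = 0"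
      by (rule signed_moments_unique_list[OF _ _ S, where M = M])
        (auto simp: sup pw Hn_simps rinner_scaleC_both)
    then show "measure (\<mu> (c *\<^sub>C x)) S = (cmod c)\<^sup>2 * measure (\<mu> x) S"
      by simp
  next
    fix x y :: 'a
    have "(\<Sum>(c, \<mu>)\<leftarrow>[(1, \<mu> (x + y)), (1, \<mu> (x - y)), (- 2, \<mu> x), (- 2, \<mu> y)]. c * measure \<mu> S) = 0"
      by (rule signed_moments_unique_list[OF _ _ S, where M = M])
        (auto simp: sup pw Hn_simps rinner_simps)
    then show "measure (\<mu> (x + y)) S + measure (\<mu> (x - y)) S = 2 * measure (\<mu> x) S + 2 * measure (\<mu> y) S"
      by simp
  next
    fix x
    have "measure (\<mu> x) S \<le> measure (\<mu> x) UNIV"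
      using S by (intro finite_measure.finite_measure_mono[OF supportedD(1)[OF sup]]) (auto simp: sets_\<mu>)
    then show "\<bar>measure (\<mu> x) S\<bar> \<le> 1 * (norm x)\<^sup>2"
      by (simp add: total)
  qed blast
  then obtain E where Esa: "\<And>S. S \<in> sets borel \<Longrightarrow> selfadjoint (E S)"
    and Eq: "\<And>S x. S \<in> sets borel \<Longrightarrow> rinner (E S x) x = measure (\<mu> x) S"
    and Epol: "\<And>S x y. S \<in> sets borel \<Longrightarrow> 4 * rinner (E S x) y = measure (\<mu> (x + y)) S - measure (\<mu> (x - y)) S"
    by metis
  have poly_measurable: "(\<lambda>t. poly p t) \<in> borel_measurable borel" "(\<lambda>t. (poly p t)\<^sup>2) \<in> borel_measurable borel"
    "(\<lambda>t::real. t ^ n) \<in> borel_measurable borel" for p :: "real poly" and n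
    by (auto intro!: borel_measurable_continuous_onI continuous_intros)
  have int_sq: "integrable (\<mu> x) (\<lambda>t. (poly p t)\<^sup>2)" for x p
    by (intro supported_integrable[OF sup] continuous_intros)
  \<comment> \<open>Passing from \<open>x\<close> to \<open>polyop p H x\<close> multiplies the
    measure by the square of \<open>p\<close>, since both measures have the same moments.\<close>
  have calculus: "measure (\<mu> (polyop p H x)) S = (\<integral>t. (poly p t)\<^sup>2 * indicator S t \<partial>\<mu> x)"
    if S: "S \<in> sets borel" for p x S
  proof -
    define \<nu> where "\<nu> = density (\<mu> x) (\<lambda>t. ennreal ((poly p t)\<^sup>2))"
    note dens = supported_density[OF sup[of x] poly_measurable(2)[of p] int_sq[of x p] zero_le_power2,
        folded \<nu>_def]
    have \<nu>mom: "(\<integral>t. t ^ n \<partial>\<nu>) = rinner ((H ^^ n) (polyop p H x)) (polyop p H x)" for n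
    proof -
      have "(\<integral>t. t ^ n \<partial>\<nu>) = (\<integral>t. poly (p * (monom 1 n * p)) t \<partial>\<mu> x)"
        unfolding dens(3)[OF poly_measurable(3)]
        by (intro Bochner_Integration.integral_cong) (auto simp: poly_monom power2_eq_square mult_ac)
      also have "\<dots> = rinner (polyop p H ((H ^^ n) (polyop p H x))) x"
        by (simp only: mom polyop_mult[OF bH] polyop_monom)
      finally show ?thesis
        by (simp only: selfadjoint_polyop[OF H])
    qed
    have "(\<Sum>(c, \<mu>)\<leftarrow>[(1, \<mu> (polyop p H x)), (- 1, \<nu>)]. c * measure \<mu> S) = 0"
      by (rule signed_moments_unique_list[OF _ _ S, where M = M]) (auto simp: sup dens(1) pw \<nu>mom)
    then show ?thesis
      using dens(2)[OF S] by simp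
  qed
  have local_moment: "(\<integral>t. indicator S t * t ^ n \<partial>\<mu> x) = rinner (E S ((H ^^ n) x)) x"
    if S: "S \<in> sets borel" for S n x
  proof -
    \<comment> \<open>The squares of \<open>p1\<close> and \<open>p2\<close> differ by four times
      the monomial, so polarization at \<open>(H ^^ n) x\<close> and \<open>x\<close> yields the
      moment.\<close>
    define p1 where "p1 = monom 1 n + (1 :: real poly)"
    define p2 where "p2 = monom 1 n + smult (- 1) (1 :: real poly)"
    have p1: "polyop p1 H x = (H ^^ n) x + x" and p2: "polyop p2 H x = (H ^^ n) x - x"
      by (simp_all only: p1_def p2_def polyop_add polyop_smult polyop_monom polyop_1) simp
    have ints: "integrable (\<mu> x) (\<lambda>t. (poly p t)\<^sup>2 * indicator S t)" for p
      using S by (intro integrable_real_mult_indicator int_sq) (simp add: sets_\<mu>)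
    have "4 * rinner (E S ((H ^^ n) x)) x
        = (\<integral>t. (poly p1 t)\<^sup>2 * indicator S t \<partial>\<mu> x) - (\<integral>t. (poly p2 t)\<^sup>2 * indicator S t \<partial>\<mu> x)"
      unfolding Epol[OF S] p1[symmetric] p2[symmetric] calculus[OF S] ..
    also have "\<dots> = (\<integral>t. (poly p1 t)\<^sup>2 * indicator S t - (poly p2 t)\<^sup>2 * indicator S t \<partial>\<mu> x)"
      by (rule Bochner_Integration.integral_diff[OF ints ints, symmetric])
    also have "\<dots> = (\<integral>t. 4 * (indicator S t * t ^ n) \<partial>\<mu> x)"
      by (intro Bochner_Integration.integral_cong)
        (auto simp: p1_def p2_def poly_monom power2_eq_square algebra_simps split: split_indicator)
    finally show ?thesis
      by simp
  qed
  \<comment> \<open>The polarization of the scalar measures at \<open>x\<close> and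
    \<open>E S x\<close> has the moments of the measure of \<open>x\<close> restricted to
    \<open>S\<close>; evaluating at \<open>T\<close> gives multiplicativity.\<close>
  have mult: "rinner (E T x) (E S x) = measure (\<mu> x) (S \<inter> T)"
    if S: "S \<in> sets borel" and T: "T \<in> sets borel" for S T x
  proof -
    define y where "y = E S x"
    have int_ind: "integrable (\<mu> x) (indicator S :: real \<Rightarrow> real)"
      using S finite_measure.finite_emeasure_space[OF supportedD(1)[OF sup[of x]]]
      by (intro integrable_real_indicator)
        (auto simp: sets_\<mu> less_top[symmetric] finite_measure.emeasure_finite[OF supportedD(1)[OF sup]])
    define \<nu> where "\<nu> = density (\<mu> x) (\<lambda>t. ennreal (indicator S t))"
    have ind_m: "(indicator S :: real \<Rightarrow> real) \<in> borel_measurable borel"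
      using S by simp
    note dens = supported_density[OF sup ind_m int_ind indicator_pos_le, folded \<nu>_def]
    have \<nu>mom: "(\<integral>t. t ^ n \<partial>\<nu>) = rinner ((H ^^ n) x) y" for n
      unfolding dens(3)[OF poly_measurable(3)] local_moment[OF S]
      by (simp add: y_def selfadjoint_rinner[OF Esa[OF S]])
    have "(\<Sum>(c, \<mu>)\<leftarrow>[(1, \<mu> (x + y)), (- 1, \<mu> (x - y)), (- 4, \<nu>)]. c * measure \<mu> T) = 0"
    proof (rule signed_moments_unique_list[OF _ _ T, where M = M])
      show "(\<Sum>(c, \<mu>)\<leftarrow>[(1, \<mu> (x + y)), (- 1, \<mu> (x - y)), (- 4, \<nu>)]. c * (\<integral>t. t ^ n \<partial>\<mu>)) = 0" for n
        using selfadjoint_funpow[OF H, of n y x] rinner_commute[of y "(H ^^ n) x"]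
        by (simp add: pw \<nu>mom Hn_simps rinner_simps)
    qed (auto simp: sup dens(1))
    then have "4 * rinner (E T x) y = 4 * measure \<nu> T"
      by (simp add: Epol[OF T])
    also have "measure \<nu> T = measure (\<mu> x) (S \<inter> T)"
    proof -
      have "measure \<nu> T = (\<integral>t. indicator (S \<inter> T) t \<partial>\<mu> x)"
        unfolding dens(2)[OF T] by (intro Bochner_Integration.integral_cong) (auto split: split_indicator)
      then show ?thesis
        using space_\<mu>[of x] by simp
    qed
    finally show ?thesis
      by (simp add: y_def)
  qed
  have norm_E: "(norm (E S x))\<^sup>2 = measure (\<mu> x) S" if "S \<in> sets borel" for S x
    using mult[OF that that, of x] by (simp add: rinner_self)
  have idem: "E S (E S x) = E S x" if S: "S \<in> sets borel" for S x
  proof (rule rinner_eqI)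
    fix z
    have sq: "(norm (E S v))\<^sup>2 = rinner (E S v) v" for v
      by (simp add: norm_E[OF S] Eq[OF S])
    have "rinner (E S z) (E S x) = rinner (E S z) x"
      using sq[of "z + x"] sq[of z] sq[of x] selfadjoint_rinner[OF Esa[OF S], of x z]
        rinner_commute[of x "E S z"]
      by (simp add: bounded_clinear_add[OF selfadjoint_bounded[OF Esa[OF S]]] norm_add_sq rinner_simps)
    then show "rinner z (E S (E S x)) = rinner z (E S x)"
      by (simp add: selfadjoint_rinner[OF Esa[OF S]])
  qed
  have E_UNIV: "E UNIV x = x" for x
  proof -
    have "(norm (E UNIV x - x))\<^sup>2 = 0"
      by (simp add: norm_diff_sq norm_E Eq total)
    then show ?thesis
      by simp
  qed
  have additive: "(\<lambda>n::nat. E (S n) x) sums E (\<Union>n. S n) x"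
    if S: "range S \<subseteq> sets borel" and disj: "disjoint_family S" for S x
  proof -
    define U where "U = (\<Union>n. S n)"
    have Sn: "S n \<in> sets borel" for n
      using S by auto
    have U: "U \<in> sets borel"
      unfolding U_def using Sn by auto
    \<comment> \<open>Orthogonality of the pieces reduces convergence of the vectors to countable
      additivity of the scalar measure.\<close>
    have dist: "(norm ((\<Sum>n<N. E (S n) x) - E U x))\<^sup>2 = measure (\<mu> x) U - (\<Sum>n<N. measure (\<mu> x) (S n))" for N
    proof -
      have "rinner (E (S n) x) (E (S m) x) = (if n = m then measure (\<mu> x) (S n) else 0)" for n m
        using disj mult[OF Sn Sn, of n x m] by (auto simp: disjoint_family_on_def)
      then have "(norm (\<Sum>n<N. E (S n) x))\<^sup>2 = (\<Sum>n<N. measure (\<mu> x) (S n))"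
        by (simp add: norm_sum_sq)
      moreover have "rinner (E (S n) x) (E U x) = measure (\<mu> x) (S n)" for n
      proof -
        have "U \<inter> S n = S n"
          by (auto simp: U_def)
        then show ?thesis
          using mult[OF U Sn, of n x] by simp
      qed
      ultimately show ?thesis
        by (simp add: norm_diff_sq rinner_sum_left norm_E[OF U])
    qed
    have "(\<lambda>n. measure (\<mu> x) (S n)) sums measure (\<mu> x) U"
      unfolding U_def using S disj
      by (intro finite_measure.finite_measure_UNION[OF supportedD(1)[OF sup]]) (auto simp: sets_\<mu>)
    then have "(\<lambda>N. measure (\<mu> x) U - (\<Sum>n<N. measure (\<mu> x) (S n))) \<longlonglongrightarrow> measure (\<mu> x) U - measure (\<mu> x) U"
      unfolding sums_def by (intro tendsto_intros)
    then have "(\<lambda>N. (norm ((\<Sum>n<N. E (S n) x) - E U x))\<^sup>2) \<longlonglongrightarrow> 0"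
      by (simp add: dist)
    then have "(\<lambda>N. sqrt ((norm ((\<Sum>n<N. E (S n) x) - E U x))\<^sup>2)) \<longlonglongrightarrow> sqrt 0"
      by (rule tendsto_real_sqrt)
    then have "(\<lambda>N. (\<Sum>n<N. E (S n) x) - E U x) \<longlonglongrightarrow> 0"
      by (simp add: tendsto_norm_zero_iff)
    then show ?thesis
      unfolding sums_def U_def[symmetric] by (rule LIM_zero_cancel)
  qed
  have pvm: "projection_valued_measure E"
    unfolding projection_valued_measure_def orthogonal_projection_def
    using Esa idem E_UNIV additive by (auto simp: fun_eq_iff)
  have scalar: "scalar_measure E x = \<mu> x" for x
  proof -
    have "scalar_measure E x = measure_of (space (\<mu> x)) (sets (\<mu> x)) (emeasure (\<mu> x))"
      unfolding scalar_measure_def space_\<mu> sets_\<mu>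
    proof (rule measure_of_eq)
      show "sets borel \<subseteq> Pow (UNIV :: real set)"
        by simp
      fix S :: "real set" assume "S \<in> sigma_sets UNIV (sets borel)"
      then have S: "S \<in> sets borel"
        using sets.sigma_sets_eq[of "borel :: real measure"] by simp
      show "ennreal ((norm (E S x))\<^sup>2) = emeasure (\<mu> x) S"
        by (simp add: norm_E[OF S] finite_measure.emeasure_eq_measure[OF supportedD(1)[OF sup]])
    qed
    then show ?thesis
      by (simp only: measure_of_of_measure)
  qed
  have "spectral_measure_of H E"
    unfolding spectral_measure_of_def scalar
  proof (intro conjI allI pvm)
    fix x
    show "integrable (\<mu> x) (\<lambda>t. t)"
      by (intro supported_integrable[OF sup] continuous_intros)
    show "cinner (H x) x = complex_of_real (\<integral>t. t \<partial>\<mu> x)"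
      using pw[of x 1] by (simp add: selfadjoint_cinner_self[OF H])
  qed
  moreover have "E S (T x) = T (E S x)"
    if S: "S \<in> sets borel" and T: "selfadjoint T" and comm: "\<And>y. T (H y) = H (T y)" for S T x
  proof (rule rinner_eqI)
    fix y
    have commn: "T ((H ^^ n) z) = (H ^^ n) (T z)" for n z
      by (induction n) (simp_all add: comm)
    \<comment> \<open>The polarizations at \<open>T x\<close>, \<open>y\<close> and at
      \<open>x\<close>, \<open>T y\<close> agree in all moments, because \<open>T\<close> is
      symmetric and commutes with the powers of \<open>H\<close>.\<close>
    have "(\<Sum>(c, \<mu>)\<leftarrow>[(1, \<mu> (T x + y)), (- 1, \<mu> (T x - y)), (- 1, \<mu> (x + T y)), (1, \<mu> (x - T y))]. c * measure \<mu> S) = 0"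
    proof (rule signed_moments_unique_list[OF _ _ S, where M = M])
      fix n
      have "rinner ((H ^^ n) (T x)) y = rinner ((H ^^ n) x) (T y)"
        by (simp add: commn[symmetric] selfadjoint_rinner[OF T])
      moreover have "rinner ((H ^^ n) y) (T x) = rinner ((H ^^ n) (T y)) x"
        by (simp add: commn[symmetric] selfadjoint_rinner[OF T])
      ultimately show "(\<Sum>(c, \<mu>)\<leftarrow>[(1, \<mu> (T x + y)), (- 1, \<mu> (T x - y)), (- 1, \<mu> (x + T y)), (1, \<mu> (x - T y))].
          c * (\<integral>t. t ^ n \<partial>\<mu>)) = 0"
        by (simp add: pw Hn_simps rinner_simps)
    qed (auto simp: sup)
    then have "rinner (E S (T x)) y = rinner (E S x) (T y)"
      using Epol[OF S, of "T x" y] Epol[OF S, of x "T y"] by simp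
    then show "rinner y (E S (T x)) = rinner y (T (E S x))"
      by (simp add: selfadjoint_rinner[OF T] rinner_commute[of y])
  qed
  ultimately show ?thesis
    by (rule that)
qed

subsection \<open>Uniqueness of the spectral projections onto half-lines\<close>

lemma orthogonal_projectionD:
  assumes "orthogonal_projection P"
  shows "selfadjoint P" "P (P x) = P x" "(norm (P x))\<^sup>2 = rinner (P x) x" "norm (P x) \<le> norm x"
proof -
  show sa: "selfadjoint P" and idem: "P (P x) = P x"
    using assms by (auto simp: orthogonal_projection_def fun_eq_iff)
  show sq: "(norm (P x))\<^sup>2 = rinner (P x) x"
    using selfadjoint_rinner[OF sa, of "P x" x] idem by (simp add: rinner_self)
  have "norm (P x) * norm (P x) \<le> norm (P x) * norm x"
    using sq abs_rinner_le[of "P x" x] by (simp add: power2_eq_square)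
  then show "norm (P x) \<le> norm x"
    by (cases "P x = 0") auto
qed

section \<open>Algebra of projection-valued measures and their scalar measures\<close>

locale pvm =
  fixes E :: "real set \<Rightarrow> 'a::complex_hilbert \<Rightarrow> 'a"
  assumes pvm: "projection_valued_measure E"
begin

lemma projection: "S \<in> sets borel \<Longrightarrow> orthogonal_projection (E S)"
  using pvm by (simp add: projection_valued_measure_def)

lemmas E_selfadjoint = orthogonal_projectionD(1)[OF projection]
  and E_idem = orthogonal_projectionD(2)[OF projection]
  and E_norm_sq = orthogonal_projectionD(3)[OF projection]
  and E_norm_le = orthogonal_projectionD(4)[OF projection]
lemmas E_bounded = selfadjoint_bounded[OF E_selfadjoint]

lemma E_UNIV: "E UNIV x = x"
  using pvm by (simp add: projection_valued_measure_def)

lemma E_sums: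
  "range S \<subseteq> sets borel \<Longrightarrow> disjoint_family S \<Longrightarrow> (\<lambda>n::nat. E (S n) x) sums E (\<Union>n. S n) x"
  using pvm by (simp add: projection_valued_measure_def)

lemma E_empty: "E {} x = 0"
proof -
  have "(\<lambda>n::nat. E {} x) sums E {} x"
    using E_sums[of "\<lambda>_. {}" x] by (simp add: disjoint_family_on_def)
  then have "(\<lambda>n::nat. E {} x) \<longlonglongrightarrow> 0"
    by (intro summable_LIMSEQ_zero sums_summable)
  then show ?thesis
    by (simp add: LIMSEQ_const_iff)
qed

lemma E_union:
  assumes "S \<in> sets borel" "T \<in> sets borel" "S \<inter> T = {}"
  shows "E (S \<union> T) x = E S x + E T x"
proof -
  have "(\<lambda>n. E (binaryset S T n) x) sums E (\<Union>n. binaryset S T n) x"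
    using assms by (intro E_sums) (auto simp: range_binaryset_eq disjoint_family_on_def binaryset_def)
  then have "(\<lambda>n. E (binaryset S T n) x) sums E (S \<union> T) x"
    by (simp add: UN_binaryset_eq)
  moreover have "(\<lambda>n. E (binaryset S T n) x) sums (\<Sum>n\<in>{0, Suc 0}. E (binaryset S T n) x)"
    by (rule sums_finite) (auto simp: binaryset_def E_empty)
  ultimately show ?thesis
    using sums_unique2 by (fastforce simp: binaryset_def)
qed

text \<open>For \<open>y\<close> in the range of \<open>E T\<close>, additivity gives
  \<open>E (S \<union> T) y\<close> the squared norm of \<open>E S y\<close> plus that of
  \<open>y\<close>, but a projection cannot increase norms. The definition asks only for countable
  additivity, so multiplicativity has to be derived in this way.\<close>

lemma E_disjoint:
  assumes S: "S \<in> sets borel" and T: "T \<in> sets borel" and disj: "S \<inter> T = {}"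
  shows "E S (E T x) = 0"
proof -
  define y where "y = E T x"
  have U: "S \<union> T \<in> sets borel"
    using S T by auto
  have "E (S \<union> T) y = E S y + y"
    using E_union[OF S T disj, of y] E_idem[OF T] by (simp add: y_def)
  then have "(norm (E (S \<union> T) y))\<^sup>2 = (norm (E S y))\<^sup>2 + (norm y)\<^sup>2"
    using E_norm_sq[OF U, of y] by (simp add: rinner_add_left rinner_self E_norm_sq[OF S])
  moreover have "(norm (E (S \<union> T) y))\<^sup>2 \<le> (norm y)\<^sup>2"
    by (intro power_mono E_norm_le U) auto
  ultimately have "(norm (E S y))\<^sup>2 \<le> 0"
    by simp
  then show ?thesis
    by (simp add: y_def)
qed

lemma E_split:
  assumes "S \<in> sets borel" "T \<in> sets borel"
  shows "E S x = E (S \<inter> T) x + E (S - T) x"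
proof -
  have "(S \<inter> T) \<union> (S - T) = S"
    by blast
  then show ?thesis
    using E_union[of "S \<inter> T" "S - T" x] assms by auto
qed

lemma E_inter:
  assumes S: "S \<in> sets borel" and T: "T \<in> sets borel"
  shows "E S (E T x) = E (S \<inter> T) x"
proof -
  have ST: "S \<inter> T \<in> sets borel" "S - T \<in> sets borel" "T - S \<in> sets borel" "T \<inter> S \<in> sets borel"
    using S T by auto
  have "E S (E T x) = E S (E (T \<inter> S) x) + E S (E (T - S) x)"
    by (subst E_split[OF T S]) (rule bounded_clinear_add[OF E_bounded[OF S]])
  also have "E S (E (T - S) x) = 0"
    using S ST by (intro E_disjoint) auto
  also have "E S (E (T \<inter> S) x) = E (S \<inter> T) (E (T \<inter> S) x) + E (S - T) (E (T \<inter> S) x)"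
    by (rule E_split[OF S T])
  also have "E (S - T) (E (T \<inter> S) x) = 0"
    using ST by (intro E_disjoint) auto
  finally show ?thesis
    by (simp add: Int_commute E_idem[OF ST(1)])
qed

lemma E_compl: "S \<in> sets borel \<Longrightarrow> E (- S) x = x - E S x"
  using E_split[of UNIV S x] E_UNIV[of x] by (simp add: Compl_eq_Diff_UNIV) (metis add_diff_cancel_left')

lemma scalar_measure_space: "space (scalar_measure E x) = UNIV"
  and scalar_measure_sets: "sets (scalar_measure E x) = sets borel"
  unfolding scalar_measure_def
  using sets.sigma_sets_eq[of "borel :: real measure"] by (simp_all add: space_measure_of_conv)

text \<open>\<open>measure_of\<close> takes the prescribed values only if they are countably
  additive; this comes from pairing the strongly convergent sums with \<open>x\<close>.\<close>

lemma scalar_measure_emeasure: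
  assumes "S \<in> sets borel"
  shows "emeasure (scalar_measure E x) S = ennreal ((norm (E S x))\<^sup>2)"
  unfolding scalar_measure_def
proof (rule emeasure_measure_of_sigma[OF _ _ _ assms])
  show "sigma_algebra UNIV (sets (borel :: real measure))"
    using sets.sigma_algebra_axioms[of "borel :: real measure"] by simp
  show "positive (sets borel) (\<lambda>S. ennreal ((norm (E S x))\<^sup>2))"
    by (simp add: positive_def E_empty)
  show "countably_additive (sets borel) (\<lambda>S. ennreal ((norm (E S x))\<^sup>2))"
    unfolding countably_additive_def
  proof (intro allI impI)
    fix S :: "nat \<Rightarrow> real set"
    assume S: "range S \<subseteq> sets borel" "disjoint_family S" "(\<Union>n. S n) \<in> sets borel"
    have "(\<lambda>n. rinner (E (S n) x) x) sums rinner (E (\<Union>n. S n) x) x"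
      using bounded_linear.sums[OF bounded_linear_rinner_left E_sums[OF S(1,2)]] .
    then have "(\<lambda>n. (norm (E (S n) x))\<^sup>2) sums (norm (E (\<Union>n. S n) x))\<^sup>2"
      using S by (simp add: E_norm_sq range_subsetD)
    then show "(\<Sum>n. ennreal ((norm (E (S n) x))\<^sup>2)) = ennreal ((norm (E (\<Union>n. S n) x))\<^sup>2)"
      by (intro suminf_ennreal_eq) auto
  qed
qed

lemma AE_scalar_measure:
  assumes "S \<in> sets borel" "E S x = 0"
  shows "AE t in scalar_measure E x. t \<notin> S"
proof (rule AE_not_in)
  show "S \<in> null_sets (scalar_measure E x)"
    using assms scalar_measure_emeasure[OF assms(1), of x]
    by (simp add: null_sets_def scalar_measure_sets)
qed

end

section \<open>Spectral resolutions of \<open>H\<close> and the sign of its quadratic form\<close>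

locale spectral_resolution = pvm E
  for E :: "real set \<Rightarrow> 'a::complex_hilbert \<Rightarrow> 'a" +
  fixes H :: "'a \<Rightarrow> 'a"
  assumes H: "selfadjoint H" and spectral: "spectral_measure_of H E"
begin

lemma integrable_scalar: "integrable (scalar_measure E x) (\<lambda>t. t)"
  and integral_scalar: "(\<integral>t. t \<partial>scalar_measure E x) = rinner (H x) x"
proof -
  show "integrable (scalar_measure E x) (\<lambda>t. t)"
    using spectral by (simp add: spectral_measure_of_def)
  have "complex_of_real (\<integral>t. t \<partial>scalar_measure E x) = complex_of_real (rinner (H x) x)"
    using spectral selfadjoint_cinner_self[OF H, of x] by (simp add: spectral_measure_of_def)
  then show "(\<integral>t. t \<partial>scalar_measure E x) = rinner (H x) x"
    by (simp only: of_real_eq_iff)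
qed

text \<open>\<open>u + v\<close> and \<open>u - v\<close> have the same scalar measure, as
  \<open>E T u\<close> and \<open>E T v\<close> are orthogonal for every \<open>T\<close>. Hence the
  form of \<open>H\<close> takes the same value at both, and the mixed term vanishes.\<close>

lemma reducing_orthogonal:
  assumes S: "S \<in> sets borel" and u: "E S u = u" and v: "E S v = 0"
  shows "rinner (H u) v = 0"
proof -
  have "scalar_measure E (u + v) = scalar_measure E (u - v)"
    unfolding scalar_measure_def
  proof (rule measure_of_eq)
    fix T :: "real set" assume "T \<in> sigma_sets UNIV (sets borel)"
    then have T: "T \<in> sets borel"
      using sets.sigma_sets_eq[of "borel :: real measure"] by simp
    have "E S (E T u) = E T u"
      using E_inter[OF T S, of u] E_inter[OF S T, of u] u by (simp add: Int_commute)
    then have "rinner (E T u) v = 0"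
      using selfadjoint_rinner[OF E_selfadjoint[OF S], of "E T u" v] by (simp add: v)
    moreover have "rinner (E T u) (E T v) = rinner (E T u) v"
      using selfadjoint_rinner[OF E_selfadjoint[OF T], of "E T u" v] E_idem[OF T] by simp
    ultimately show "ennreal ((norm (E T (u + v)))\<^sup>2) = ennreal ((norm (E T (u - v)))\<^sup>2)"
      by (simp add: bounded_clinear_add[OF E_bounded[OF T]] bounded_clinear_diff[OF E_bounded[OF T]]
          norm_add_sq norm_diff_sq)
  qed simp
  then have "rinner (H (u + v)) (u + v) = rinner (H (u - v)) (u - v)"
    by (simp only: integral_scalar[symmetric])
  moreover have "rinner (H v) u = rinner (H u) v"
    by (simp add: selfadjoint_rinner[OF H, of v u] rinner_commute[of v])
  ultimately show ?thesis
    by (simp add: bounded_clinear_add[OF selfadjoint_bounded[OF H]]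
        bounded_clinear_diff[OF selfadjoint_bounded[OF H]] rinner_simps)
qed

text \<open>\<open>H\<close> has no mixed terms between the range and the kernel of
  \<open>E S\<close>, so it is block diagonal with respect to them.\<close>

lemma E_commute:
  assumes S: "S \<in> sets borel"
  shows "E S (H x) = H (E S x)"
proof (rule rinner_eqI)
  fix z
  have dec: "rinner (H x') z' = rinner (H (E S x')) (E S z') + rinner (H (x' - E S x')) (z' - E S z')" for x' z'
  proof -
    have "rinner (H (E S x')) (z' - E S z') = 0"
      by (rule reducing_orthogonal[OF S])
        (simp_all add: E_idem[OF S] bounded_clinear_diff[OF E_bounded[OF S]])
    moreover have "rinner (H (E S z')) (x' - E S x') = 0"
      by (rule reducing_orthogonal[OF S])
        (simp_all add: E_idem[OF S] bounded_clinear_diff[OF E_bounded[OF S]])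
    moreover have "rinner (H (x' - E S x')) (E S z') = rinner (H (E S z')) (x' - E S x')"
      by (simp only: selfadjoint_rinner[OF H, of "x' - E S x'"] rinner_commute[of "x' - E S x'"])
    moreover have "rinner (H x') z' = rinner (H (E S x') + H (x' - E S x')) (E S z' + (z' - E S z'))"
      by (simp add: bounded_clinear_diff[OF selfadjoint_bounded[OF H]])
    ultimately show ?thesis
      by (simp only: rinner_add_left rinner_add_right add_0_left add_0_right)
  qed
  have "rinner (H x) (E S z) = rinner (H (E S x)) z"
    using dec[of x "E S z"] dec[of "E S x" z]
    by (simp add: E_idem[OF S] bounded_clinear_zero[OF selfadjoint_bounded[OF H]])
  then show "rinner z (E S (H x)) = rinner z (H (E S x))"
    using selfadjoint_rinner[OF E_selfadjoint[OF S], of "H x" z] by (simp add: rinner_commute)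
qed

lemma half_line_borel: "{t. 0 < \<sigma> * t} \<in> sets borel" for \<sigma> :: real
  by measurable

text \<open>The parameter \<open>\<sigma>\<close> is \<open>1\<close> or \<open>-1\<close> and selects the positive or the negative half-line.\<close>

lemma form_nonpos:
  assumes "E {t. 0 < \<sigma> * t} x = 0"
  shows "\<sigma> * rinner (H x) x \<le> 0"
proof -
  have "AE t in scalar_measure E x. 0 \<le> - (\<sigma> * t)"
    using AE_scalar_measure[OF half_line_borel assms] by eventually_elim auto
  then have "0 \<le> (\<integral>t. - (\<sigma> * t) \<partial>scalar_measure E x)"
    by (rule integral_nonneg_AE)
  then show ?thesis
    using integrable_scalar by (simp add: integral_scalar)
qed

text \<open>The integrand \<open>\<sigma> * t\<close> is strictly positive almost everywhere, so a
  vanishing integral forces the measure, whose total mass is \<open>(norm x)\<^sup>2\<close>, to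
  vanish.\<close>

lemma form_nonneg:
  assumes "E {t. 0 < \<sigma> * t} x = x"
  shows "0 \<le> \<sigma> * rinner (H x) x" "\<sigma> * rinner (H x) x = 0 \<Longrightarrow> x = 0"
proof -
  have "E (- {t. 0 < \<sigma> * t}) x = 0"
    using assms by (simp add: E_compl[OF half_line_borel])
  then have AE: "AE t in scalar_measure E x. 0 < \<sigma> * t"
    using AE_scalar_measure[of "- {t. 0 < \<sigma> * t}" x] borel_comp[OF half_line_borel]
    by (simp add: Compl_eq)
  then have AE0: "AE t in scalar_measure E x. 0 \<le> \<sigma> * t"
    by eventually_elim simp
  have int: "(\<integral>t. \<sigma> * t \<partial>scalar_measure E x) = \<sigma> * rinner (H x) x"
    by (simp add: integral_scalar)
  show "0 \<le> \<sigma> * rinner (H x) x"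
    using integral_nonneg_AE[OF AE0] by (simp only: int)
  assume "\<sigma> * rinner (H x) x = 0"
  then have "(\<integral>t. \<sigma> * t \<partial>scalar_measure E x) = 0"
    by (simp only: int)
  moreover have "integrable (scalar_measure E x) (\<lambda>t. \<sigma> * t)"
    using integrable_scalar by simp
  ultimately have "AE t in scalar_measure E x. \<sigma> * t = 0"
    using integral_nonneg_eq_0_iff_AE[OF _ AE0] by blast
  then have "AE t in scalar_measure E x. False"
    using AE by eventually_elim auto
  then have "emeasure (scalar_measure E x) UNIV = 0"
    using AE_iff_measurable[of UNIV "scalar_measure E x" "\<lambda>_. False"]
    by (simp add: scalar_measure_space scalar_measure_sets)
  then have "ennreal ((norm (E UNIV x))\<^sup>2) = 0"
    by (simp add: scalar_measure_emeasure)
  then show "x = 0"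
    by (simp add: E_UNIV)
qed

end

lemma spectral_resolutionI:
  "selfadjoint H \<Longrightarrow> spectral_measure_of H E \<Longrightarrow> spectral_resolution E H"
  by unfold_locales (auto simp: spectral_measure_of_def)

text \<open>The definite description requires every resolution \<open>E\<close> to agree with
  \<open>E0\<close> on the half-line. The two projections commute, since \<open>E S\<close> commutes
  with \<open>H\<close> and \<open>E0\<close> commutes with every selfadjoint operator that does. So
  \<open>P x - P0 (P x)\<close> lies in the range of \<open>P\<close> and in the kernel of
  \<open>P0\<close>, where \<open>\<sigma>\<close> times the form of \<open>H\<close> is both
  nonnegative and nonpositive, and the strictness in \<open>form_nonneg\<close> makes it 0; likewise
  with the roles exchanged.\<close>

lemma spectral_projection_half_line:
  assumes H: "selfadjoint H"
  obtains E where "spectral_resolution E H"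
    "\<And>\<sigma>. spectral_projection H {t. 0 < \<sigma> * t} = E {t. 0 < \<sigma> * t}"
proof -
  obtain E0 where E0: "spectral_measure_of H E0"
    and comm: "\<And>S T x. S \<in> sets borel \<Longrightarrow> selfadjoint T \<Longrightarrow> (\<And>y. T (H y) = H (T y)) \<Longrightarrow> E0 S (T x) = T (E0 S x)"
    using spectral_theorem[OF H] by blast
  interpret E0: spectral_resolution E0 H
    using H E0 by (rule spectral_resolutionI)
  have unique: "E {t. 0 < \<sigma> * t} = E0 {t. 0 < \<sigma> * t}" if E: "spectral_measure_of H E" for E \<sigma>
  proof
    fix x
    interpret E: spectral_resolution E H
      using H E by (rule spectral_resolutionI)
    define P where "P = E {t. 0 < \<sigma> * t}"
    define P0 where "P0 = E0 {t. 0 < \<sigma> * t}"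
    note borel = E.half_line_borel[of \<sigma>]
    have PP0: "P0 (P y) = P (P0 y)" for y
      unfolding P_def P0_def
      by (rule comm[OF borel E.E_selfadjoint[OF borel]]) (rule E.E_commute[OF borel])
    have idem: "P (P y) = P y" "P0 (P0 y) = P0 y" for y
      unfolding P_def P0_def by (rule E.E_idem[OF borel] E0.E_idem[OF borel])+
    have bP: "bounded_clinear P" "bounded_clinear P0"
      unfolding P_def P0_def by (rule E.E_bounded[OF borel] E0.E_bounded[OF borel])+
    have "P x - P0 (P x) = 0"
    proof (rule E.form_nonneg(2)[of \<sigma>, folded P_def])
      show "P (P x - P0 (P x)) = P x - P0 (P x)"
        by (simp add: bounded_clinear_diff[OF bP(1)] PP0[symmetric] idem)
      then have "0 \<le> \<sigma> * rinner (H (P x - P0 (P x))) (P x - P0 (P x))"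
        unfolding P_def by (rule E.form_nonneg(1))
      moreover have "P0 (P x - P0 (P x)) = 0"
        by (simp add: bounded_clinear_diff[OF bP(2)] idem)
      then have "\<sigma> * rinner (H (P x - P0 (P x))) (P x - P0 (P x)) \<le> 0"
        unfolding P0_def by (rule E0.form_nonpos)
      ultimately show "\<sigma> * rinner (H (P x - P0 (P x))) (P x - P0 (P x)) = 0"
        by simp
    qed
    moreover have "P0 x - P (P0 x) = 0"
    proof (rule E0.form_nonneg(2)[of \<sigma>, folded P0_def])
      show "P0 (P0 x - P (P0 x)) = P0 x - P (P0 x)"
        by (simp add: bounded_clinear_diff[OF bP(2)] PP0 idem)
      then have "0 \<le> \<sigma> * rinner (H (P0 x - P (P0 x))) (P0 x - P (P0 x))"
        unfolding P0_def by (rule E0.form_nonneg(1))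
      moreover have "P (P0 x - P (P0 x)) = 0"
        by (simp add: bounded_clinear_diff[OF bP(1)] idem)
      then have "\<sigma> * rinner (H (P0 x - P (P0 x))) (P0 x - P (P0 x)) \<le> 0"
        unfolding P_def by (rule E.form_nonpos)
      ultimately show "\<sigma> * rinner (H (P0 x - P (P0 x))) (P0 x - P (P0 x)) = 0"
        by simp
    qed
    ultimately show "E {t. 0 < \<sigma> * t} x = E0 {t. 0 < \<sigma> * t} x"
      using PP0[of x] by (simp add: P_def P0_def)
  qed
  have "spectral_projection H {t. 0 < \<sigma> * t} = E0 {t. 0 < \<sigma> * t}" for \<sigma>
    unfolding spectral_projection_def
  proof (rule the_equality)
    show "\<exists>E. spectral_measure_of H E \<and> E0 {t. 0 < \<sigma> * t} = E {t. 0 < \<sigma> * t}"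
      using E0 by blast
  qed (use unique in auto)
  then show ?thesis
    by (rule that[OF E0.spectral_resolution_axioms])
qed

subsection \<open>The inertia of the solutions\<close>

context resolvent_circle
begin

text \<open>A nonzero vector in the range of \<open>P\<close> killed by the positive spectral
  projection would have a form both positive and nonpositive; a nonzero positive spectral vector in
  the kernel of \<open>P\<close>, a form both negative and nonnegative. The complementary pair uses
  \<open>Q\<close> and \<open>\<sigma> = -1\<close>.\<close>

lemma strict_stein_inertia:
  assumes r1: "r = 1" and H: "selfadjoint H"
    and stein: "\<And>x. rinner (H (A x)) (A x) + \<delta> * (norm x)\<^sup>2 \<le> rinner (H x) x" and \<delta>: "0 < \<delta>"
  shows "hilbert_dim (range (riesz_projection_disk A)) =o hilbert_dim (range (spectral_projection H {0<..}))"
    and "hilbert_dim (range (riesz_projection_exterior A)) =o hilbert_dim (range (spectral_projection H {..<0}))"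
proof -
  define P where "P = riesz_integral A (circlepath 0 1)"
  define Q where "Q x = x - P x" for x
  define \<epsilon> where "\<epsilon> = \<delta> / (onorm A + 1)\<^sup>2"
  have "0 < onorm A + 1"
    using bounded_clinear_onorm_nonneg[OF A] by simp
  then have \<epsilon>: "0 < \<epsilon>"
    using \<delta> by (simp add: \<epsilon>_def)
  have P: "bounded_clinear P" "\<And>x. P (P x) = P x"
    using riesz_integral_bounded riesz_integral_idem unfolding P_def r1 by auto
  have Q: "bounded_clinear Q" "\<And>x. Q (Q x) = Q x"
    unfolding Q_def[abs_def]
    by (auto intro!: bounded_clinear_sub P simp: bounded_clinear_diff[OF P(1)] P(2))
  have disk: "riesz_projection_disk A = P" and ext: "riesz_projection_exterior A = Q"
    by (auto simp: riesz_projection_exterior_eq[OF A] riesz_projection_disk_def P_def Q_def)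
  have pos: "x = 0" if "P x = x" "rinner (H x) x \<le> 0" for x
  proof -
    have "\<delta> * (norm x)\<^sup>2 \<le> 0"
      using strict_stein_definite(1)[OF r1 selfadjoint_bounded[OF H] stein \<delta>, of x] that
      by (simp add: P_def)
    then show ?thesis
      using \<delta> by (simp add: mult_le_0_iff)
  qed
  have neg: "x = 0" if "P x = 0" "0 \<le> rinner (H x) x" for x
  proof -
    have "rinner (H x) x \<le> - \<epsilon> * (norm x)\<^sup>2"
      unfolding \<epsilon>_def
      by (rule strict_stein_definite(2)[OF r1 selfadjoint_bounded[OF H] stein \<delta>])
        (use that in \<open>simp add: P_def\<close>)
    then have "\<epsilon> * (norm x)\<^sup>2 \<le> 0"
      using that by simp
    then show ?thesis
      using \<epsilon> by (simp add: mult_le_0_iff)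
  qed
  obtain E where "spectral_resolution E H"
    and proj: "\<And>\<sigma>. spectral_projection H {t. 0 < \<sigma> * t} = E {t. 0 < \<sigma> * t}"
    using spectral_projection_half_line[OF H] by blast
  then interpret E: spectral_resolution E H
    by simp
  have half: "{0<..} = {t::real. 0 < 1 * t}" "{..<0} = {t::real. 0 < -1 * t}"
    by auto
  note bE = E.E_bounded[OF E.half_line_borel]
  note rngP = range_idempotent[OF P] and rngQ = range_idempotent[OF Q]
    and rngE = range_idempotent[OF bE E.E_idem[OF E.half_line_borel]]
  show "hilbert_dim (range (riesz_projection_disk A)) =o hilbert_dim (range (spectral_projection H {0<..}))"
    unfolding disk half(1) proj
  proof (rule hilbert_dim_eqI[OF rngP(2,3) rngE(2,3) bE _ _ P(1)])
    fix v assume v: "v \<in> range P" "E {t. 0 < 1 * t} v = 0"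
    then show "v = 0"
      using pos[of v] E.form_nonpos[of 1 v] rngP(1) by auto
  next
    fix w assume w: "w \<in> range (E {t. 0 < 1 * t})" "P w = 0"
    then have "E {t. 0 < 1 * t} w = w"
      using rngE(1)[of 1] by blast
    then show "w = 0"
      using neg[of w] w(2) E.form_nonneg(1)[of 1 w] by simp
  qed auto
  show "hilbert_dim (range (riesz_projection_exterior A)) =o hilbert_dim (range (spectral_projection H {..<0}))"
    unfolding ext half(2) proj
  proof (rule hilbert_dim_eqI[OF rngQ(2,3) rngE(2,3) bE _ _ Q(1)])
    fix v assume v: "v \<in> range Q" "E {t. 0 < -1 * t} v = 0"
    then have "P v = 0"
      using rngQ(1) by (auto simp: Q_def)
    then show "v = 0"
      using neg[of v] v(2) E.form_nonpos[of "-1" v] by simp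
  next
    fix w assume w: "w \<in> range (E {t. 0 < -1 * t})" "Q w = 0"
    then have "E {t. 0 < -1 * t} w = w"
      using rngE(1)[of "-1"] by blast
    then show "w = 0"
      using pos[of w] w(2) E.form_nonneg(1)[of "-1" w] by (simp add: Q_def)
  qed auto
qed

end

theorem theorem7p2:
  fixes A :: "'x::complex_hilbert \<Rightarrow> 'x"
    and B :: "'u::complex_hilbert \<Rightarrow> 'x"
    and C :: "'x \<Rightarrow> 'y::complex_hilbert"
    and D :: "'u \<Rightarrow> 'y"
  assumes "bounded_clinear A" and "bounded_clinear B" and "bounded_clinear C" and "bounded_clinear D"
    and "has_dichotomy A"
  shows "((SUP z\<in>sphere 0 1. onorm (transfer_function A B C D z)) < 1 \<longleftrightarrow>
           (\<exists>H. selfadjoint H \<and> boundedly_invertible H \<and> strict_KYP A B C D H)) \<and>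
         (\<forall>H. selfadjoint H \<and> boundedly_invertible H \<and> strict_KYP A B C D H \<longrightarrow>
           hilbert_dim (range (riesz_projection_disk A)) =o
             hilbert_dim (range (spectral_projection H {0<..})) \<and>
           hilbert_dim (range (riesz_projection_exterior A)) =o
             hilbert_dim (range (spectral_projection H {..<0})))"
proof -
  interpret resolvent_circle A 1
    using assms(1,5) by (rule has_dichotomy_resolvent_circle)
  note BCD = assms(2-4)
  \<comment> \<open>Invertibility is a consequence of the KYP inequality under dichotomy, so it is
    derived once for all solutions, including the one constructed from the storage.\<close>
  have inertia: "boundedly_invertible H \<and>
      hilbert_dim (range (riesz_projection_disk A)) =o hilbert_dim (range (spectral_projection H {0<..})) \<and>
      hilbert_dim (range (riesz_projection_exterior A)) =o hilbert_dim (range (spectral_projection H {..<0}))"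
    if H: "selfadjoint H" and kyp: "strict_KYP A B C D H" for H
  proof -
    obtain \<delta> where "0 < \<delta>" "\<And>x. rinner (H (A x)) (A x) + \<delta> * (norm x)\<^sup>2 \<le> rinner (H x) x"
      using strict_KYP_imp_strict_stein[OF BCD kyp] by blast
    then show ?thesis
      using strict_stein_invertible[OF refl H] strict_stein_inertia[OF refl H] by blast
  qed
  show ?thesis
    using contractive_imp_strict_KYP[OF refl BCD] strict_KYP_imp_contractive[OF refl BCD]
      inertia selfadjoint_bounded by blast
qed

end
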